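(* Let $(G_n)_{n\ge 1}$ be a sequence of finite simple graphs with $|V(G_n)|=n$ which converges to a graphon $\mathcal{G}$. Let $\phi_n(x)=\det(xI-A(G_n))$ be the characteristic polynomial of the adjacency matrix $A(G_n)$ of $G_n$, and let $\psi_n(z)$ be the polynomial given by $\psi_n(z)=\left(x^{-n}\phi_n(x)\right)\big|_{x=n/z}$ for $z\neq 0$ and $\psi_n(0)=1$. Then: 1. $\psi_n(z)$ converges pointwise on $\mathbb{C}$ as $n\to\infty$. 2. $\psi_n(z)$ converges uniformly on compact subsets of $\mathbb{C}$ as $n\to\infty$. 3. For each $k\ge 0$, the coefficient of $z^k$ in $\psi_n(z)$ converges as $n\to\infty$. Furthermore, the limit function is the characteristic power series $$\psi_{\mathcal{G}}(z)=\det{}^{(2)}(I-z\mathcal{G})\,\exp\left(z^2\cdot\frac{\|\mathcal{G}\|_2^2-\|\mathcal{G}\|_1}{2}\right),$$ it is an entire function of Laguerre-Pólya class, and its roots are the reciprocals of the nonzero eigenvalues of $\mathcal{G}$ (as a self-adjoint kernel operator), with multiplicity.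
   Context: A graphon $\mathcal{G}$ is (represented by) a symmetric measurable function $\mathcal{G}:[0,1]^2\to[0,1]$; two such kernels $U,W$ represent the same graphon if there are measure-preserving maps $f,g:[0,1]\to[0,1]$ with $U(f(x),f(y))=W(g(x),g(y))$ for almost every $(x,y)$. The kernel defines a self-adjoint Hilbert-Schmidt integral operator on $L^2([0,1])$ by $h\mapsto \int_0^1 \mathcal{G}(\cdot,y)h(y)\,dy$; "eigenvalues of $\mathcal{G}$" means eigenvalues of this operator, counted with multiplicity. $\|\mathcal{G}\|_1=\int_{[0,1]^2}|\mathcal{G}|$ and $\|\mathcal{G}\|_2^2=\int_{[0,1]^2}|\mathcal{G}|^2$. Convergence $G_n\to\mathcal{G}$ means left-convergence: for every finite simple graph $F$, $t(F,G_n)\to t(F,\mathcal{G})$, where $t(F,G)$ is the number of homomorphisms $F\to G$ divided by $|V(G)|^{|V(F)|}$, and $t(F,\mathcal{G})=\int_{[0,1]^{V(F)}}\prod_{uv\in E(F)}\mathcal{G}(x_u,x_v)\prod_{v\in V(F)} dx_v$. The regularized (Hilbert-Carleman) determinant is $\det^{(2)}(I-z\mathcal{G})=\prod_j (1-\lambda_j z)\exp(\lambda_j z)$, the product being over the eigenvalues $\lambda_j$ of $\mathcal{G}$ with multiplicity. An entire function is of Laguerre-Pólya class if it is the limit, uniformly on compact subsets of $\mathbb{C}$, of a sequence of real polynomials all of whose roots are real. *)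

theory Defs
  imports
    "HOL-Complex_Analysis.Complex_Analysis"
    "HOL-Library.Extended_Nat"
    "Jordan_Normal_Form.Char_Poly"
    "Graph_Theory.Pair_Digraph"
begin

text \<open>
  A finite simple graph is a \<^locale>\<open>pair_graph\<close>: finite, loop-free, without parallel arcs, and
  with every undirected edge \<open>uv\<close> present as the two arcs \<open>(u, v)\<close> and \<open>(v, u)\<close>.
\<close>

definition adjacency_mat :: "'v pair_pre_digraph \<Rightarrow> 'v list \<Rightarrow> complex mat" where
  "adjacency_mat G vs = Matrix.mat (length vs) (length vs)
     (\<lambda>(i, j). if (vs ! i, vs ! j) \<in> parcs G then 1 else 0)"

definition graph_homs :: "'u pair_pre_digraph \<Rightarrow> 'v pair_pre_digraph \<Rightarrow> ('u \<Rightarrow> 'v) set" where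
  "graph_homs F G = {f \<in> pverts F \<rightarrow>\<^sub>E pverts G. \<forall>(u, v) \<in> parcs F. (f u, f v) \<in> parcs G}"

definition hom_density :: "'u pair_pre_digraph \<Rightarrow> 'v pair_pre_digraph \<Rightarrow> real" where
  "hom_density F G = real (card (graph_homs F G)) / real (card (pverts G)) ^ card (pverts F)"

text \<open>
  Kernels are Lebesgue measurable on the unit square; only their values there matter.
\<close>

definition graphon :: "(real \<times> real \<Rightarrow> real) \<Rightarrow> bool" where
  "graphon W \<longleftrightarrow>
     W \<in> borel_measurable (lebesgue_on ({0..1} \<times> {0..1})) \<and>
     (\<forall>x\<in>{0..1}. \<forall>y\<in>{0..1}. W (x, y) \<in> {0..1} \<and> W (x, y) = W (y, x))"

text \<open>
  The condition \<open>u < v\<close> selects one of the two arcs of each edge of \<open>F\<close>. The product measure is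
  completed because \<open>x \<mapsto> W (x u, x v)\<close> need not be measurable for the product sigma-algebra
  itself when \<open>W\<close> is only Lebesgue measurable.
\<close>

definition graphon_density :: "nat pair_pre_digraph \<Rightarrow> (real \<times> real \<Rightarrow> real) \<Rightarrow> real" where
  "graphon_density F W =
     (\<integral>x. (\<Prod>(u, v) \<in> {(u, v). (u, v) \<in> parcs F \<and> u < v}. W (x u, x v))
       \<partial>completion (PiM (pverts F) (\<lambda>_. lebesgue_on {0..1})))"

text \<open>Every finite simple graph is isomorphic to one whose vertices are natural numbers.\<close>

definition left_convergent_to :: "(nat \<Rightarrow> 'v pair_pre_digraph) \<Rightarrow> (real \<times> real \<Rightarrow> real) \<Rightarrow> bool" where
  "left_convergent_to G W \<longleftrightarrow>
     (\<forall>F :: nat pair_pre_digraph. pair_graph F \<longrightarrow>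
        (\<lambda>n. hom_density F (G n)) \<longlonglongrightarrow> graphon_density F W)"

definition graphon_norm1 :: "(real \<times> real \<Rightarrow> real) \<Rightarrow> real" where
  "graphon_norm1 W = (\<integral>p. \<bar>W p\<bar> \<partial>lebesgue_on ({0..1} \<times> {0..1}))"

definition graphon_norm2 :: "(real \<times> real \<Rightarrow> real) \<Rightarrow> real" where
  "graphon_norm2 W = sqrt (\<integral>p. \<bar>W p\<bar>\<^sup>2 \<partial>lebesgue_on ({0..1} \<times> {0..1}))"

definition graphon_op :: "(real \<times> real \<Rightarrow> real) \<Rightarrow> (real \<Rightarrow> complex) \<Rightarrow> real \<Rightarrow> complex" where
  "graphon_op W h x = (\<integral>y. complex_of_real (W (x, y)) * h y \<partial>lebesgue_on {0..1})"

definition square_integrable :: "(real \<Rightarrow> complex) \<Rightarrow> bool" where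
  "square_integrable h \<longleftrightarrow>
     h \<in> borel_measurable (lebesgue_on {0..1}) \<and>
     integrable (lebesgue_on {0..1}) (\<lambda>x. (norm (h x))\<^sup>2)"

text \<open>
  Elements of the complex space \<open>L\<^sup>2([0,1])\<close> are represented by functions, so equality, nonvanishing
  and linear independence are all understood almost everywhere.
\<close>

definition eigenspace :: "(real \<times> real \<Rightarrow> real) \<Rightarrow> complex \<Rightarrow> (real \<Rightarrow> complex) set" where
  "eigenspace W lam =
     {h. square_integrable h \<and> (AE x in lebesgue_on {0..1}. graphon_op W h x = lam * h x)}"

definition graphon_eigenvalue :: "(real \<times> real \<Rightarrow> real) \<Rightarrow> complex \<Rightarrow> bool" where
  "graphon_eigenvalue W lam \<longleftrightarrow>
     (\<exists>h \<in> eigenspace W lam. \<not> (AE x in lebesgue_on {0..1}. h x = 0))"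

definition ae_independent :: "nat \<Rightarrow> (nat \<Rightarrow> real \<Rightarrow> complex) \<Rightarrow> bool" where
  "ae_independent m f \<longleftrightarrow>
     (\<forall>c. (AE x in lebesgue_on {0..1}. (\<Sum>i<m. c i * f i x) = 0) \<longrightarrow> (\<forall>i<m. c i = 0))"

text \<open>The dimension of the eigenspace in \<open>L\<^sup>2([0,1])\<close>.\<close>

definition eigenvalue_mult :: "(real \<times> real \<Rightarrow> real) \<Rightarrow> complex \<Rightarrow> enat" where
  "eigenvalue_mult W lam =
     Sup {enat m | m. \<exists>f. (\<forall>i<m. f i \<in> eigenspace W lam) \<and> ae_independent m f}"

text \<open>
  The product is the limit of the net of finite subproducts. An eigenvalue \<open>0\<close>, whose multiplicity
  may be infinite, would only contribute factors \<open>1\<close> and is left out.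
\<close>

definition regularized_det :: "(real \<times> real \<Rightarrow> real) \<Rightarrow> complex \<Rightarrow> complex" where
  "regularized_det W z =
     Lim (finite_subsets_at_top {lam. graphon_eigenvalue W lam \<and> lam \<noteq> 0})
       (\<lambda>S. \<Prod>lam\<in>S. ((1 - lam * z) * exp (lam * z)) ^ the_enat (eigenvalue_mult W lam))"

definition char_power_series :: "(real \<times> real \<Rightarrow> real) \<Rightarrow> complex \<Rightarrow> complex" where
  "char_power_series W z =
     regularized_det W z *
     exp (z\<^sup>2 * complex_of_real (((graphon_norm2 W)\<^sup>2 - graphon_norm1 W) / 2))"

definition laguerre_polya :: "(complex \<Rightarrow> complex) \<Rightarrow> bool" where
  "laguerre_polya f \<longleftrightarrow>
     f holomorphic_on UNIV \<and>
     (\<exists>p :: nat \<Rightarrow> real poly.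
        (\<forall>n z. poly (map_poly complex_of_real (p n)) z = 0 \<longrightarrow> z \<in> \<real>) \<and>
        (\<forall>K. compact K \<longrightarrow>
           uniform_limit K (\<lambda>n. poly (map_poly complex_of_real (p n))) f sequentially))"

end

theory Submission
  imports Defs "Jordan_Normal_Form.Schur_Decomposition" "HOL-Probability.Infinite_Product_Measure"
begin

text \<open>
  Both sides are determined by power sums. The polynomial \<open>\<psi>\<^sub>n\<close> is \<open>\<Prod>(1 - \<lambda> z)\<close> over the eigenvalues
  \<open>\<lambda>\<close> of \<open>A(G\<^sub>n)/n\<close>; the sum of the \<open>\<lambda>\<close> is zero, and the sum of the \<open>\<lambda>\<^sup>k\<close> is the homomorphism density
  of the \<open>k\<close>-cycle, where the \<open>2\<close>-cycle is an edge. Left convergence makes these sums converge, hence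
  by Newton's identities so do the coefficients, and \<open>|(1 - w) e\<^sup>w| \<le> exp(|w|\<^sup>2 / 2)\<close> gives a locally
  uniform bound that upgrades this to locally uniform convergence.

  On the limit side, the finite subproducts of \<open>det\<^sup>(\<^sup>2\<^sup>)(I - z W)\<close> are treated by the same argument.
  It remains to know that the sum of the \<open>k\<close>-th powers of the eigenvalues of \<open>W\<close> is the density of the
  \<open>k\<close>-cycle for \<open>k \<ge> 3\<close> and the squared norm of \<open>W\<close> for \<open>k = 2\<close>; the factor \<open>exp(c z\<^sup>2)\<close> accounts for
  the difference between that norm and the edge density. These trace formulas follow by subtracting
  from \<open>W\<close> a maximal orthonormal system of eigenfunctions with eigenvalues of modulus above
  \<open>\<epsilon>\<close>: a Hermitian kernel \<open>K\<close> whose eigenvalues are bounded by \<open>\<epsilon>\<close> satisfies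
  \<open>tr K\<^sup>4 \<le> \<epsilon>\<^sup>2 tr K\<^sup>2\<close>, which is read off the normalised powers of \<open>K\<close>, and so the remainders tend to zero
  weakly and, being orthogonal to what was subtracted, in norm.
\<close>

section \<open>Entire functions with prescribed power sums\<close>

text \<open>Both sides of the theorem become the same Newton series, so individual eigenvalues of
  the graphs never have to be matched with those of the graphon. The degree-one power sum is the
  obstacle behind the regularization: a kernel known almost everywhere has no trace, because the
  diagonal is a null set, whereas adjacency matrices have trace zero for lack of loops. Hence the
  factors exp(lambda z) can be inserted for free on the graph side and are indispensable on the
  other. Eigenfunctions are obtained from two inequalities alone: the even traces tr K^(2n+2) are
  log-convex and submultiplicative. Their ratios increase to some R, the kernels K^(2n+2) / R^(n+1)
  converge to a nonzero limit, and R is a squared eigenvalue. That the first ratio is at most R is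
  the inequality tr K^4 <= R tr K^2 behind the deflation argument. A Lebesgue measurable
  \<open>W\<close> need not be measurable for the product of two Lebesgue sigma-algebras, and its
  symmetry is given on the unit square only. It is therefore replaced by a Borel version
  \<open>W0\<close>, symmetric everywhere, after which kernel identities hold pointwise.\<close>

text \<open>Newton's identities solved for the elementary symmetric functions: the k-th value is
  (-1)^k e_k as a polynomial in the power sums of degrees 1 to k.\<close>

fun newton_coeff :: "(nat \<Rightarrow> complex) \<Rightarrow> nat \<Rightarrow> complex" where
  "newton_coeff p 0 = 1"
| "newton_coeff p (Suc k) = - (\<Sum>i\<in>{..k}. newton_coeff p i * p (Suc k - i)) / of_nat (Suc k)"

definition newton_series :: "(nat \<Rightarrow> complex) \<Rightarrow> complex \<Rightarrow> complex" where
  "newton_series p z = (\<Sum>k. newton_coeff p k * z ^ k)"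

text \<open>This says \<open>f' = - f \<cdot> (\<Sum>k. p (k + 1) z\<^sup>k)\<close>, that is Newton's identities: \<open>p k\<close> for \<open>k \<ge> 1\<close> is
  the power sum of degree \<open>k\<close> of the reciprocal roots of \<open>f\<close>. The value \<open>p 0\<close> is irrelevant.\<close>

definition has_power_sums :: "(complex \<Rightarrow> complex) \<Rightarrow> (nat \<Rightarrow> complex) \<Rightarrow> bool" where
  "has_power_sums f p \<longleftrightarrow> f holomorphic_on UNIV \<and> f 0 = 1 \<and>
     fps_deriv (fps_expansion f 0) = - (fps_expansion f 0 * Abs_fps (\<lambda>k. p (Suc k)))"

lemma entire_has_fps_expansion:
  "f holomorphic_on UNIV \<Longrightarrow> f has_fps_expansion fps_expansion f 0"
  by (rule has_fps_expansion_fps_expansion[of UNIV]) auto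

lemma has_power_sumsI:
  assumes hol: "f holomorphic_on UNIV" and f0: "f 0 = 1"
    and deriv: "\<And>z. deriv f z = - (f z * g z)"
    and g: "g has_fps_expansion Abs_fps (\<lambda>k. p (Suc k))"
  shows "has_power_sums f p"
proof -
  have F: "f has_fps_expansion fps_expansion f 0"
    by (rule entire_has_fps_expansion[OF hol])
  have "deriv f has_fps_expansion - (fps_expansion f 0 * Abs_fps (\<lambda>k. p (Suc k)))"
    unfolding deriv by (intro has_fps_expansion_minus has_fps_expansion_mult F g)
  with has_fps_expansion_deriv[OF F] show ?thesis
    unfolding has_power_sums_def using hol f0 fps_expansion_unique_complex by blast
qed

lemma has_power_sums_mult:
  assumes "has_power_sums f p" "has_power_sums g q"
  shows "has_power_sums (\<lambda>z. f z * g z) (\<lambda>k. p k + q k)"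
proof -
  have hol: "f holomorphic_on UNIV" "g holomorphic_on UNIV"
    using assms by (auto simp: has_power_sums_def)
  have *: "fps_expansion (\<lambda>z. f z * g z) 0 = fps_expansion f 0 * fps_expansion g 0"
    by (intro fps_expansion_eqI has_fps_expansion_mult entire_has_fps_expansion hol)
  have **: "Abs_fps (\<lambda>k. p (Suc k) + q (Suc k)) = Abs_fps (\<lambda>k. p (Suc k)) + Abs_fps (\<lambda>k. q (Suc k))"
    by (simp add: fps_eq_iff)
  show ?thesis
    using assms unfolding has_power_sums_def * **
    by (auto intro!: holomorphic_intros simp: algebra_simps)
qed

lemma has_power_sums_one: "has_power_sums (\<lambda>z. 1) (\<lambda>k. 0)"
proof (rule has_power_sumsI)
  have "Abs_fps (\<lambda>k. 0::complex) = 0" by (simp add: fps_eq_iff)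
  then show "(\<lambda>z. 0 :: complex) has_fps_expansion Abs_fps (\<lambda>k. 0)" by simp
qed auto

lemma has_power_sums_power:
  "has_power_sums f p \<Longrightarrow> has_power_sums (\<lambda>z. f z ^ m) (\<lambda>k. of_nat m * p k)"
proof (induction m)
  case (Suc m)
  from has_power_sums_mult[OF Suc.prems Suc.IH[OF Suc.prems]] show ?case
    by (simp add: algebra_simps)
qed (use has_power_sums_one in simp)

lemma has_power_sums_prod:
  "finite S \<Longrightarrow> (\<And>s. s \<in> S \<Longrightarrow> has_power_sums (f s) (p s)) \<Longrightarrow>
    has_power_sums (\<lambda>z. \<Prod>s\<in>S. f s z) (\<lambda>k. \<Sum>s\<in>S. p s k)"
  by (induction S rule: finite_induct) (auto intro: has_power_sums_one has_power_sums_mult)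

lemma has_power_sums_linear: "has_power_sums (\<lambda>z. 1 - c * z) (\<lambda>k. c ^ k)"
proof -
  have F: "(\<lambda>z. 1 - c * z) has_fps_expansion (1 - fps_const c * fps_X)"
    by (intro fps_expansion_intros)
  have "(1 - fps_const c * fps_X) * Abs_fps (\<lambda>k. c ^ Suc k) = fps_const c"
    by (rule fps_ext) (auto simp: algebra_simps fps_X_mult_nth power_eq_if)
  with fps_expansion_eqI[OF F] show ?thesis
    unfolding has_power_sums_def by (auto intro!: holomorphic_intros)
qed

text \<open>There are no roots here: the power sums are formal, read off from the logarithmic
  derivative c, which is constant and so contributes to degree 1 only.\<close>

lemma has_power_sums_exp: "has_power_sums (\<lambda>z. exp (c * z)) (\<lambda>k. if k = 1 then - c else 0)"
proof (rule has_power_sumsI)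
  show "deriv (\<lambda>z. exp (c * z)) z = - (exp (c * z) * - c)" for z
    by (rule DERIV_imp_deriv) (auto intro!: derivative_eq_intros)
  have "Abs_fps (\<lambda>k. if Suc k = 1 then - c else 0) = fps_const (- c)"
    by (simp add: fps_eq_iff)
  then show "(\<lambda>z. - c) has_fps_expansion Abs_fps (\<lambda>k. if Suc k = 1 then - c else 0)"
    by (simp only: has_fps_expansion_const)
qed (auto intro!: holomorphic_intros)

text \<open>The logarithmic derivative 2 c z is linear, so only the second power sum changes. This
  is how a factor exp(c z^2) corrects it.\<close>

lemma has_power_sums_exp_square:
  "has_power_sums (\<lambda>z. exp (z\<^sup>2 * c)) (\<lambda>k. if k = 2 then - 2 * c else 0)"
proof (rule has_power_sumsI)
  show "deriv (\<lambda>z. exp (z\<^sup>2 * c)) z = - (exp (z\<^sup>2 * c) * (- 2 * c * z))" for z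
    by (rule DERIV_imp_deriv) (auto intro!: derivative_eq_intros)
  have "Abs_fps (\<lambda>k. if Suc k = 2 then - 2 * c else 0) = fps_const (- 2 * c) * fps_X"
    by (simp add: fps_eq_iff fps_X_def)
  then show "(\<lambda>z. - 2 * c * z) has_fps_expansion Abs_fps (\<lambda>k. if Suc k = 2 then - 2 * c else 0)"
    by (simp only:) (intro fps_expansion_intros)
qed (auto intro!: holomorphic_intros)

text \<open>Comparing coefficients in the differential equation of \<open>has_power_sums\<close>
  gives exactly the recursion of \<open>newton_coeff\<close>; the power sums thus determine the
  function.\<close>

lemma has_power_sums_nth:
  assumes "has_power_sums f p"
  shows "fps_nth (fps_expansion f 0) k = newton_coeff p k"
proof (induction k rule: less_induct)
  case (less k)
  let ?F = "fps_expansion f 0"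
  show ?case
  proof (cases k)
    case 0
    then show ?thesis using assms by (simp add: has_power_sums_def fps_expansion_def)
  next
    case (Suc j)
    have "of_nat (Suc j) * fps_nth ?F (Suc j) = fps_nth (fps_deriv ?F) j" by simp
    also have "\<dots> = - (\<Sum>i=0..j. fps_nth ?F i * p (Suc (j - i)))"
      using assms by (simp add: has_power_sums_def fps_mult_nth)
    also have "(\<Sum>i=0..j. fps_nth ?F i * p (Suc (j - i))) = (\<Sum>i\<in>{..j}. newton_coeff p i * p (Suc j - i))"
      by (rule sum.cong) (auto simp: less Suc Suc_diff_le)
    finally show ?thesis
      unfolding Suc by (simp add: field_simps del: of_nat_Suc)
  qed
qed

text \<open>Each coefficient is a polynomial in finitely many power sums. The filter is arbitrary
  because both a sequence of graphs and the net of finite sets of eigenvalues are needed.\<close>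

lemma newton_coeff_tendsto:
  assumes "\<And>k. ((\<lambda>s. p s (Suc k)) \<longlongrightarrow> q (Suc k)) F"
  shows "((\<lambda>s. newton_coeff (p s) k) \<longlongrightarrow> newton_coeff q k) F"
proof (induction k rule: less_induct)
  case (less k)
  show ?case
  proof (cases k)
    case (Suc j)
    have "((\<lambda>s. p s (Suc j - i)) \<longlongrightarrow> q (Suc j - i)) F" if "i \<le> j" for i
      using assms[of "j - i"] that by (simp add: Suc_diff_le)
    then show ?thesis unfolding Suc newton_coeff.simps
      by (intro tendsto_intros less) (auto simp: Suc simp del: of_nat_Suc)
  qed simp
qed

lemma has_power_sums_series:
  assumes "has_power_sums f p"
  shows "newton_series p z = f z"
proof -
  have hol: "f holomorphic_on UNIV" using assms by (simp add: has_power_sums_def)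
  have "(\<lambda>n. fps_nth (fps_expansion f 0) n * z ^ n) sums f z"
    by (rule has_fps_expansion_imp_sums_complex[where r = \<infinity>])
       (use entire_has_fps_expansion[OF hol] hol in \<open>auto intro: holomorphic_on_subset\<close>)
  then show ?thesis
    unfolding newton_series_def has_power_sums_nth[OF assms] by (simp add: sums_iff)
qed

lemma newton_coeff_bound:
  assumes "has_power_sums f p" and bound: "\<And>z. norm (f z) \<le> B (norm z)" and "r > 0"
  shows "norm (newton_coeff p k) \<le> B r / r ^ k"
proof -
  have hol: "f holomorphic_on A" for A
    using assms(1) by (auto simp: has_power_sums_def intro: holomorphic_on_subset)
  have "norm ((deriv ^^ k) f 0) \<le> fact k * B r / r ^ k"
  proof (rule Cauchy_inequality[OF hol holomorphic_on_imp_continuous_on[OF hol] \<open>r > 0\<close>])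
    show "norm (f x) \<le> B r" if "norm (0 - x) = r" for x
      using bound[of x] that by simp
  qed
  then have "norm ((deriv ^^ k) f 0 / fact k) \<le> B r / r ^ k"
    by (simp add: norm_divide field_simps)
  then show ?thesis
    using has_power_sums_nth[OF assms(1), of k] by (simp add: fps_expansion_def)
qed

text \<open>By the Cauchy estimates, a locally uniform bound turns convergence of the power sums, hence
  of the Taylor coefficients, into locally uniform convergence (Tannery's theorem).\<close>

lemma newton_series_limit:
  fixes f :: "'s \<Rightarrow> complex \<Rightarrow> complex"
  assumes nontriv: "F \<noteq> bot"
    and ev: "eventually (\<lambda>s. has_power_sums (f s) (p s) \<and> (\<forall>z. norm (f s z) \<le> B (norm z))) F"
    and lim: "\<And>k. ((\<lambda>s. p s (Suc k)) \<longlongrightarrow> q (Suc k)) F"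
  shows newton_series_uniform_limit: "compact K \<Longrightarrow> uniform_limit K f (newton_series q) F"
    and newton_series_holomorphic: "newton_series q holomorphic_on UNIV"
    and newton_series_coeff: "(deriv ^^ k) (newton_series q) 0 / fact k = newton_coeff q k"
proof -
  note coeff_lim = newton_coeff_tendsto[of p q F, OF lim]
  have bound: "norm (newton_coeff q k) \<le> B r / r ^ k" if "r > 0" for r k
  proof (rule tendsto_upperbound[OF tendsto_norm[OF coeff_lim]])
    show "\<forall>\<^sub>F s in F. norm (newton_coeff (p s) k) \<le> B r / r ^ k"
      using ev by eventually_elim (use newton_coeff_bound that in blast)
  qed fact
  have R: "uniform_limit (cball 0 R) f (newton_series q) F" if "R > 0" for R :: real
  proof -
    let ?d = "\<lambda>k s. norm (newton_coeff (p s) k - newton_coeff q k) * R ^ k"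
    \<comment> \<open>Cauchy estimates on the circle of radius 2 R leave a factor (1/2)^k on the
      disc of radius R; the leading 2 accounts for the two coefficients being subtracted.\<close>
    let ?M = "\<lambda>k. 2 * B (2 * R) * (1/2) ^ k"
    have ev': "eventually (\<lambda>s. \<forall>k. norm (newton_coeff (p s) k) \<le> B (2 * R) / (2 * R) ^ k) F"
      using ev by eventually_elim (use newton_coeff_bound[where r = "2 * R"] that in auto)
    have sm: "summable ?M" by (intro summable_mult summable_geometric) auto
    have Mb: "?d k s \<le> ?M k" if "\<forall>k. norm (newton_coeff (p s) k) \<le> B (2 * R) / (2 * R) ^ k" for k s
    proof -
      have "norm (newton_coeff (p s) k - newton_coeff q k) \<le> 2 * (B (2 * R) / (2 * R) ^ k)"
        using that bound[of "2*R" k] \<open>R > 0\<close>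
        by (intro order_trans[OF norm_triangle_ineq4]) (auto intro: order_trans[OF add_mono])
      then have "?d k s \<le> 2 * (B (2 * R) / (2 * R) ^ k) * R ^ k"
        using \<open>R > 0\<close> by (intro mult_right_mono) auto
      then show ?thesis using \<open>R > 0\<close> by (simp add: power_mult_distrib field_simps)
    qed
    have tan: "eventually (\<lambda>s. summable (\<lambda>k. norm (?d k s))) F \<and> summable (\<lambda>k. norm (0::real)) \<and>
        ((\<lambda>s. \<Sum>k. ?d k s) \<longlongrightarrow> (\<Sum>k. 0::real)) F"
    proof (rule tannerys_theorem)
      show "((\<lambda>s. ?d k s) \<longlongrightarrow> 0) F" for k
        using tendsto_mult_right[OF tendsto_norm[OF tendsto_diff[OF coeff_lim[of k] tendsto_const[of "newton_coeff q k"]]], of "R ^ k"]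
        by simp
      show "\<forall>\<^sub>F (k, s) in at_top \<times>\<^sub>F F. norm (?d k s) \<le> ?M k"
        unfolding eventually_prod_filter
        by (rule exI[of _ "\<lambda>_. True"], rule exI, intro conjI, simp, rule ev')
           (use Mb that in \<open>auto\<close>)
    qed (use sm nontriv in auto)
    show ?thesis
      unfolding uniform_limit_iff
    proof (intro allI impI)
      fix e :: real assume "e > 0"
      with tan have "eventually (\<lambda>s. (\<Sum>k. ?d k s) < e) F"
        by (intro order_tendstoD[where y = "\<Sum>k. 0::real"]) auto
      with ev show "\<forall>\<^sub>F s in F. \<forall>z\<in>cball 0 R. dist (f s z) (newton_series q z) < e"
        using ev' conjunct1[OF tan]
      proof eventually_elim
        case (elim s)
        show ?case
        proof
          fix z :: complex assume "z \<in> cball 0 R"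
          then have z: "norm z \<le> R" by simp
          have *: "norm (c * z ^ k) \<le> norm c * R ^ k" for c k
            using z by (auto simp: norm_mult norm_power intro!: mult_left_mono power_mono)
          have le: "norm (newton_coeff (p s) k) * R ^ k \<le> B (2 * R) * (1/2) ^ k"
            "norm (newton_coeff q k) * R ^ k \<le> B (2 * R) * (1/2) ^ k" for k
            using mult_right_mono[OF elim(3)[rule_format, of k], of "R^k"] mult_right_mono[OF bound[of "2*R" k], of "R^k"] \<open>R > 0\<close>
            by (auto simp: power_mult_distrib field_simps)
          have smq: "summable (\<lambda>k. newton_coeff q k * z ^ k)" "summable (\<lambda>k. newton_coeff (p s) k * z ^ k)"
            by (rule summable_comparison_test'[where N = 0 and g = "\<lambda>k. B (2*R) * (1/2)^k"],
                intro summable_mult summable_geometric, simp, rule order_trans[OF * le(2)],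
                rule summable_comparison_test'[where N = 0 and g = "\<lambda>k. B (2*R) * (1/2)^k"],
                intro summable_mult summable_geometric, simp, rule order_trans[OF * le(1)])
          have smd: "summable (\<lambda>k. norm ((newton_coeff (p s) k - newton_coeff q k) * z ^ k))"
            by (rule summable_comparison_test'[where N = 0 and g = "\<lambda>k. ?d k s"])
               (use elim(4) \<open>R > 0\<close> * in auto)
          have "f s z - newton_series q z = (\<Sum>k. (newton_coeff (p s) k - newton_coeff q k) * z ^ k)"
            using elim(1) has_power_sums_series[of "f s" "p s" z] suminf_diff[OF smq(2,1)]
            by (simp add: newton_series_def algebra_simps)
          also have "norm \<dots> \<le> (\<Sum>k. norm ((newton_coeff (p s) k - newton_coeff q k) * z ^ k))"
            by (rule summable_norm[OF smd])
          also have "\<dots> \<le> (\<Sum>k. ?d k s)"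
            by (rule suminf_le) (use smd elim(4) \<open>R > 0\<close> * in auto)
          finally show "dist (f s z) (newton_series q z) < e"
            using elim(2) by (simp add: dist_norm)
        qed
      qed
    qed
  qed
  show *: "compact K \<Longrightarrow> uniform_limit K f (newton_series q) F" for K
  proof -
    assume "compact K"
    then obtain R where "R > 0" "\<forall>x\<in>K. norm x \<le> R"
      using compact_imp_bounded bounded_pos by metis
    then show ?thesis
      by (intro uniform_limit_on_subset[OF R[of R]]) auto
  qed
  show hol: "newton_series q holomorphic_on UNIV"
  proof -
    have "newton_series q holomorphic_on ball 0 R" if "R > 0" for R
    proof -
      have "\<forall>\<^sub>F s in F. continuous_on (cball 0 R) (f s) \<and> f s holomorphic_on ball 0 R"
        using ev by eventually_elim
          (auto simp: has_power_sums_def intro!: holomorphic_on_imp_continuous_on intro: holomorphic_on_subset)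
      from holomorphic_uniform_limit[OF this R[OF that] nontriv] show ?thesis by blast
    qed
    note ball = this
    show ?thesis
    proof (rule holomorphic_onI)
      fix z :: complex
      have "newton_series q field_differentiable at z"
        by (rule holomorphic_on_imp_differentiable_at[OF ball[of "norm z + 1"]]) (auto simp: add_nonneg_pos)
      then show "newton_series q field_differentiable at z within UNIV" by simp
    qed
  qed
  \<comment> \<open>The bound survives in the limit coefficients, so the series converges everywhere
    and is its own Taylor expansion.\<close>
  have "newton_series q has_fps_expansion Abs_fps (newton_coeff q)"
  proof (rule has_fps_expansionI, rule always_eventually, rule allI)
    fix z :: complex
    define R where "R = norm z + 1"
    have R: "R > 0" "norm z \<le> R" by (auto simp: R_def add_nonneg_pos)
    have "norm (newton_coeff q k * z ^ k) \<le> B (2 * R) * (1/2) ^ k" for k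
    proof -
      have "norm (newton_coeff q k * z ^ k) \<le> B (2 * R) / (2 * R) ^ k * R ^ k"
        unfolding norm_mult norm_power using bound[of "2 * R" k] R
        by (intro mult_mono power_mono bound) (auto intro: order_trans[OF norm_ge_zero])
      then show ?thesis using R by (simp add: power_mult_distrib field_simps)
    qed
    note le = this
    have "summable (\<lambda>k. B (2 * R) * (1/2) ^ k)"
      by (intro summable_mult summable_geometric) simp
    from summable_comparison_test'[OF this le] have "summable (\<lambda>k. newton_coeff q k * z ^ k)" .
    then show "(\<lambda>k. fps_nth (Abs_fps (newton_coeff q)) k * z ^ k) sums newton_series q z"
      unfolding newton_series_def by (simp add: summable_sums)
  qed
  from fps_nth_fps_expansion[OF this, of k]
  show "(deriv ^^ k) (newton_series q) 0 / fact k = newton_coeff q k" by simp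
qed

section \<open>Regularized products\<close>

definition reg_prod :: "(complex \<Rightarrow> nat) \<Rightarrow> complex set \<Rightarrow> complex \<Rightarrow> complex" where
  "reg_prod m S z = (\<Prod>l\<in>S. ((1 - l * z) * exp (l * z)) ^ m l)"

text \<open>The product in \<open>regularized_det\<close> with spectrum and multiplicities as
  parameters, so that its analysis is independent of graphons.\<close>

definition reg_det :: "(complex \<Rightarrow> nat) \<Rightarrow> complex set \<Rightarrow> complex \<Rightarrow> complex" where
  "reg_det m E z = Lim (finite_subsets_at_top E) (\<lambda>S. reg_prod m S z)"

text \<open>The exponential factors remove the power sum of degree \<open>1\<close>.\<close>

definition reg_sum :: "(complex \<Rightarrow> nat) \<Rightarrow> complex \<Rightarrow> nat \<Rightarrow> complex" where
  "reg_sum m l k = of_nat (m l) * (if k = 1 then 0 else l ^ k)"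

lemma has_power_sums_reg_prod:
  assumes "finite S"
  shows "has_power_sums (reg_prod m S) (\<lambda>k. \<Sum>l\<in>S. reg_sum m l k)"
proof -
  have "(\<lambda>k. l ^ k + (if k = 1 then - l else 0)) = (\<lambda>k. if k = 1 then 0 else l ^ k)" for l :: complex
    by auto
  then have factor: "has_power_sums (\<lambda>z. (1 - l * z) * exp (l * z)) (\<lambda>k. if k = 1 then 0 else l ^ k)" for l
    using has_power_sums_mult[OF has_power_sums_linear[of l] has_power_sums_exp[of l]] by (simp only:)
  show ?thesis
    unfolding reg_prod_def[abs_def] reg_sum_def
    by (intro has_power_sums_prod[OF assms] has_power_sums_power factor)
qed

text \<open>The linear term -2 Re w of |1 - w|^2 is cancelled by |exp w|^2, by way of 1 + t <= exp
  t. Only a quadratic term survives, so second moments suffice to bound products.\<close>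

lemma norm_elementary_factor_le:
  fixes w :: complex
  shows "norm ((1 - w) * exp w) \<le> exp ((norm w)\<^sup>2 / 2)"
proof -
  have "(norm (1 - w))\<^sup>2 = 1 + ((norm w)\<^sup>2 - 2 * Re w)"
    unfolding cmod_power2 by (simp add: power2_eq_square algebra_simps)
  also have "\<dots> \<le> exp ((norm w)\<^sup>2 - 2 * Re w)" by (rule exp_ge_add_one_self)
  finally have "(norm ((1 - w) * exp w))\<^sup>2 \<le> exp ((norm w)\<^sup>2 - 2 * Re w) * (exp (Re w))\<^sup>2"
    by (simp add: norm_mult power_mult_distrib mult_right_mono)
  also have "\<dots> = (exp ((norm w)\<^sup>2 / 2))\<^sup>2"
    by (simp add: power2_eq_square flip: exp_add)
  finally show ?thesis by (rule power2_le_imp_le) simp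
qed

lemma norm_reg_prod_le:
  assumes "finite S"
  shows "norm (reg_prod m S z) \<le> exp ((norm z)\<^sup>2 / 2 * (\<Sum>l\<in>S. real (m l) * (norm l)\<^sup>2))"
proof -
  have "norm (reg_prod m S z) \<le> (\<Prod>l\<in>S. exp ((norm (l * z))\<^sup>2 / 2) ^ m l)"
    unfolding reg_prod_def prod_norm[symmetric] norm_power
    by (intro prod_mono conjI power_mono norm_elementary_factor_le) auto
  also have "\<dots> = exp (\<Sum>l\<in>S. real (m l) * ((norm (l * z))\<^sup>2 / 2))"
    unfolding exp_sum[OF assms] exp_of_nat_mult ..
  also have "(\<Sum>l\<in>S. real (m l) * ((norm (l * z))\<^sup>2 / 2)) = (norm z)\<^sup>2 / 2 * (\<Sum>l\<in>S. real (m l) * (norm l)\<^sup>2)"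
    by (simp add: sum_distrib_left norm_mult power_mult_distrib algebra_simps)
  finally show ?thesis .
qed

text \<open>Models the nonzero spectrum of a Hilbert-Schmidt operator: \<open>E\<close> holds the
  distinct values, \<open>m\<close> their repetition. First moments may diverge, which is why the
  exponential factors are there.\<close>

locale square_summable_multiset =
  fixes m :: "complex \<Rightarrow> nat" and E :: "complex set"
  assumes pos: "l \<in> E \<Longrightarrow> m l > 0"
    and summable: "(\<lambda>l. real (m l) * (norm l)\<^sup>2) summable_on E"
begin

definition total :: real where "total = (\<Sum>\<^sub>\<infinity>l\<in>E. real (m l) * (norm l)\<^sup>2)"

lemma sum_le_total: "finite S \<Longrightarrow> S \<subseteq> E \<Longrightarrow> (\<Sum>l\<in>S. real (m l) * (norm l)\<^sup>2) \<le> total"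
  unfolding total_def by (rule finite_sum_le_infsum[OF summable]) auto

lemma norm_le_total: "l \<in> E \<Longrightarrow> (norm l)\<^sup>2 \<le> total"
proof -
  assume l: "l \<in> E"
  have "(norm l)\<^sup>2 \<le> real (m l) * (norm l)\<^sup>2"
    using pos[OF l] mult_right_mono[of 1 "real (m l)" "(norm l)\<^sup>2"] by simp
  also have "\<dots> \<le> total" using sum_le_total[of "{l}"] l by simp
  finally show ?thesis .
qed

text \<open>Degree 1 is trivial because \<open>reg_sum\<close> vanishes there. In higher degree two
  powers of l provide summability and the remaining ones are bounded by powers of
  \<open>sqrt total\<close>.\<close>

lemma reg_sum_summable: "(\<lambda>l. reg_sum m l (Suc k)) summable_on E"
proof (cases "k = 0")
  case False
  then obtain j where k: "Suc k = j + 2" by (cases k) auto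
  have "norm (reg_sum m l (Suc k)) \<le> sqrt total ^ j * (real (m l) * (norm l)\<^sup>2)" if "l \<in> E" for l
  proof -
    have "norm l \<le> sqrt total" using norm_le_total[OF that] by (rule real_le_rsqrt)
    then have "norm l ^ j * (real (m l) * (norm l)\<^sup>2) \<le> sqrt total ^ j * (real (m l) * (norm l)\<^sup>2)"
      by (intro mult_right_mono power_mono) auto
    then show ?thesis
      by (simp add: reg_sum_def k norm_mult norm_power power_add power2_eq_square mult_ac)
  qed
  then have "(\<lambda>l. norm (reg_sum m l (Suc k))) summable_on E"
    by (intro summable_on_comparison_test[OF summable_on_cmult_right[OF summable, of "sqrt total ^ j"]]) auto
  then show ?thesis by (rule abs_summable_summable)
qed (simp add: reg_sum_def)

lemma reg_sum_tendsto:
  "((\<lambda>S. \<Sum>l\<in>S. reg_sum m l (Suc k)) \<longlongrightarrow> (\<Sum>\<^sub>\<infinity>l\<in>E. reg_sum m l (Suc k))) (finite_subsets_at_top E)"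
  using has_sum_infsum[OF reg_sum_summable] by (simp add: has_sum_def)

context
  fixes c :: complex
begin

private definition "q = (\<lambda>k. (\<Sum>\<^sub>\<infinity>l\<in>E. reg_sum m l k) + (if k = 2 then - 2 * c else 0))"
private definition "f = (\<lambda>S z. reg_prod m S z * exp (z\<^sup>2 * c))"
private definition "B = (\<lambda>r::real. exp (r\<^sup>2 / 2 * total) * exp (r\<^sup>2 * norm c))"

private lemma reg_prod_exp_eventually:
  "eventually (\<lambda>S. has_power_sums (f S) (\<lambda>k. (\<Sum>l\<in>S. reg_sum m l k) + (if k = 2 then - 2 * c else 0)) \<and>
     (\<forall>z. norm (f S z) \<le> B (norm z))) (finite_subsets_at_top E)"
proof (rule eventually_finite_subsets_at_top_weakI, intro conjI allI)
  fix S assume S: "finite S" "S \<subseteq> E"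
  show "has_power_sums (f S) (\<lambda>k. (\<Sum>l\<in>S. reg_sum m l k) + (if k = 2 then - 2 * c else 0))"
    unfolding f_def by (intro has_power_sums_mult has_power_sums_reg_prod has_power_sums_exp_square S)
  fix z
  have "norm (exp (z\<^sup>2 * c)) \<le> exp ((norm z)\<^sup>2 * norm c)"
    using norm_exp[of "z\<^sup>2 * c"] by (simp add: norm_mult norm_power)
  moreover have "norm (reg_prod m S z) \<le> exp ((norm z)\<^sup>2 / 2 * total)"
    by (rule order_trans[OF norm_reg_prod_le[OF S(1)]]) (auto intro!: mult_left_mono sum_le_total S)
  ultimately show "norm (f S z) \<le> B (norm z)"
    unfolding f_def B_def norm_mult by (intro mult_mono) auto
qed

private lemma q_tendsto:
  "((\<lambda>S. (\<Sum>l\<in>S. reg_sum m l (Suc k)) + (if Suc k = 2 then - 2 * c else 0)) \<longlongrightarrow> q (Suc k)) (finite_subsets_at_top E)"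
  unfolding q_def by (intro tendsto_intros reg_sum_tendsto)

private lemma lim_f: "((\<lambda>S. f S z) \<longlongrightarrow> newton_series q z) (finite_subsets_at_top E)"
  using newton_series_uniform_limit[OF _ reg_prod_exp_eventually q_tendsto, of "{z}"]
  by (auto dest: tendsto_uniform_limitI)

text \<open>\<open>newton_series_limit\<close> again, now along the net of finite subsets of
  \<open>E\<close>. The factor exp(c z^2) is carried along so that the limit is directly the series
  to be compared with the graphs.\<close>

lemma reg_prod_exp_tendsto:
  "((\<lambda>S. reg_prod m S z * exp (z\<^sup>2 * c)) \<longlongrightarrow>
    newton_series (\<lambda>k. (\<Sum>\<^sub>\<infinity>l\<in>E. reg_sum m l k) + (if k = 2 then - 2 * c else 0)) z) (finite_subsets_at_top E)"
  using lim_f unfolding f_def q_def .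

lemma newton_series_reg_holomorphic:
  "newton_series (\<lambda>k. (\<Sum>\<^sub>\<infinity>l\<in>E. reg_sum m l k) + (if k = 2 then - 2 * c else 0)) holomorphic_on UNIV"
  using newton_series_holomorphic[OF _ reg_prod_exp_eventually q_tendsto] unfolding q_def by simp

end

lemma reg_det_tendsto: "((\<lambda>S. reg_prod m S z) \<longlongrightarrow> reg_det m E z) (finite_subsets_at_top E)"
  using reg_prod_exp_tendsto[of z 0] tendsto_Lim[OF _ reg_prod_exp_tendsto[of z 0]]
  by (simp add: reg_det_def)

lemma reg_det_exp_eq:
  "reg_det m E z * exp (z\<^sup>2 * c) =
     newton_series (\<lambda>k. (\<Sum>\<^sub>\<infinity>l\<in>E. reg_sum m l k) + (if k = 2 then - 2 * c else 0)) z"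
  by (rule tendsto_unique[OF _ tendsto_mult_right[OF reg_det_tendsto] reg_prod_exp_tendsto]) simp

lemma reg_det_holomorphic: "reg_det m E holomorphic_on UNIV"
proof -
  have "reg_det m E = newton_series (\<lambda>k. (\<Sum>\<^sub>\<infinity>l\<in>E. reg_sum m l k) + (if k = 2 then - 2 * 0 else 0))"
    using reg_det_exp_eq[of _ 0] by (intro ext) simp
  then show ?thesis using newton_series_reg_holomorphic[of 0] by (simp only:)
qed

section \<open>Zeros of the regularized determinant\<close>

lemma square_summable_multiset_Diff: "square_summable_multiset m (E - S0)"
  by standard (use pos summable_on_subset_banach[OF summable, of "E - S0"] in auto)

text \<open>The finite sets containing \<open>S0\<close> are cofinal, so the limit over
  \<open>E\<close> may be taken along \<open>S0 \<union> S\<close> with S running through the finite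
  subsets of the complement.\<close>

lemma reg_det_split:
  assumes "finite S0" "S0 \<subseteq> E"
  shows "reg_det m E z = reg_prod m S0 z * reg_det m (E - S0) z"
proof (rule tendsto_unique)
  interpret D: square_summable_multiset m "E - S0" by (rule square_summable_multiset_Diff)
  show "((\<lambda>S. reg_prod m S0 z * reg_prod m S z) \<longlongrightarrow> reg_prod m S0 z * reg_det m (E - S0) z) (finite_subsets_at_top (E - S0))"
    by (intro tendsto_intros D.reg_det_tendsto)
  have "filterlim (\<lambda>S. S0 \<union> S) (finite_subsets_at_top E) (finite_subsets_at_top (E - S0))"
    unfolding filterlim_finite_subsets_at_top
  proof (intro allI impI)
    fix X assume X: "finite X \<and> X \<subseteq> E"
    show "\<forall>\<^sub>F S in finite_subsets_at_top (E - S0). finite (S0 \<union> S) \<and> X \<subseteq> S0 \<union> S \<and> S0 \<union> S \<subseteq> E"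
      unfolding eventually_finite_subsets_at_top
      by (rule exI[of _ "X - S0"]) (use X assms in auto)
  qed
  from filterlim_compose[OF reg_det_tendsto[of z] this]
  have "((\<lambda>S. reg_prod m (S0 \<union> S) z) \<longlongrightarrow> reg_det m E z) (finite_subsets_at_top (E - S0))" .
  then show "((\<lambda>S. reg_prod m S0 z * reg_prod m S z) \<longlongrightarrow> reg_det m E z) (finite_subsets_at_top (E - S0))"
  proof (rule Lim_transform_eventually)
    show "\<forall>\<^sub>F S in finite_subsets_at_top (E - S0). reg_prod m (S0 \<union> S) z = reg_prod m S0 z * reg_prod m S z"
      by (rule eventually_finite_subsets_at_top_weakI)
         (use assms in \<open>auto simp: reg_prod_def intro!: prod.union_disjoint\<close>)
  qed
qed simp

text \<open>Far out in the product the factors are so close to \<open>1\<close> that a whole tail stays above \<open>1/2\<close>.\<close>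

lemma reg_det_nonzero:
  assumes nz: "\<And>l. l \<in> E \<Longrightarrow> l * z \<noteq> 1"
  shows "reg_det m E z \<noteq> 0"
proof -
  define t where "t = (\<lambda>l. real (m l) * (norm l)\<^sup>2)"
  \<comment> \<open>The 3 in the next inequality is the constant of the bound |(1 - w) exp w - 1| <=
    3 |w|^2 for |w| <= 1/2; \<open>d\<close> makes the total loss of the tail at most 1/2.\<close>
  define d where "d = 1 / (6 * ((norm z)\<^sup>2 + 1))"
  have d: "d > 0" "3 * (norm z)\<^sup>2 * d \<le> 1 / 2"
    by (auto simp: d_def divide_simps) (use zero_le_power2[of "norm z"] in linarith)+
  have "(t has_sum total) E" unfolding t_def total_def by (rule has_sum_infsum[OF summable])
  then have "\<forall>\<^sub>F S in finite_subsets_at_top E. dist (sum t S) total < d"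
    unfolding has_sum_def using d(1) by (rule tendstoD)
  then obtain S0 where S0: "finite S0" "S0 \<subseteq> E" "dist (sum t S0) total < d"
    unfolding eventually_finite_subsets_at_top by blast
  interpret D: square_summable_multiset m "E - S0" by (rule square_summable_multiset_Diff)
  have tail: "sum t S \<le> d" if "finite S" "S \<subseteq> E - S0" for S
  proof -
    have "sum t S0 + sum t S = sum t (S0 \<union> S)"
      using that S0 by (subst sum.union_disjoint) auto
    also have "\<dots> \<le> total" unfolding t_def using that S0 by (intro sum_le_total) auto
    finally show ?thesis using S0(3) by (simp add: dist_real_def abs_if split: if_splits)
  qed
  have half: "1 / 2 \<le> norm (reg_prod m S z)" if S: "finite S" "S \<subseteq> E - S0" for S
  proof -
    have small: "3 * (norm (l * z))\<^sup>2 \<le> 1 / 2" if "l \<in> S" for l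
    proof -
      have "(norm l)\<^sup>2 \<le> t l"
        using pos[of l] S that mult_right_mono[of 1 "real (m l)" "(norm l)\<^sup>2"] by (auto simp: t_def)
      also have "\<dots> \<le> d" using tail[of "{l}"] S that by auto
      finally have "3 * (norm z)\<^sup>2 * (norm l)\<^sup>2 \<le> 3 * (norm z)\<^sup>2 * d" by (intro mult_left_mono) auto
      then show ?thesis using d(2) by (simp add: norm_mult power_mult_distrib mult_ac)
    qed
    have factor: "1 - real (m l) * (3 * (norm (l * z))\<^sup>2) \<le> norm (((1 - l * z) * exp (l * z)) ^ m l)"
      if "l \<in> S" for l
    proof -
      have "(norm (l * z))\<^sup>2 \<le> (1 / 2)\<^sup>2" using small[OF that] by (simp add: power2_eq_square)
      then have "norm (l * z) \<le> 1 / 2" by (rule power2_le_imp_le) simp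
      from weierstrass_factor_bound[OF this, of 1]
      have "norm ((1 - l * z) * exp (l * z) - 1) \<le> 3 * (norm (l * z))\<^sup>2"
        by (simp add: weierstrass_factor_def power2_eq_square)
      then have "1 - 3 * (norm (l * z))\<^sup>2 \<le> norm ((1 - l * z) * exp (l * z))"
        using norm_triangle_ineq2[of 1 "1 - (1 - l * z) * exp (l * z)"]
        by (simp add: norm_minus_commute)
      then have "(1 - 3 * (norm (l * z))\<^sup>2) ^ m l \<le> norm ((1 - l * z) * exp (l * z)) ^ m l"
        using small[OF that] by (intro power_mono) auto
      \<comment> \<open>Bernoulli's inequality makes the loss of an m-fold factor linear in m, so
        that multiplicities enter as the weights of the tail sum.\<close>
      moreover have "1 + real (m l) * (- (3 * (norm (l * z))\<^sup>2)) \<le> (1 + - (3 * (norm (l * z))\<^sup>2)) ^ m l"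
        using small[OF that] by (intro Bernoulli_inequality) auto
      ultimately show ?thesis by (simp add: norm_power)
    qed
    have tot: "(\<Sum>l\<in>S. real (m l) * (3 * (norm (l * z))\<^sup>2)) \<le> 1 / 2"
    proof -
      have "(\<Sum>l\<in>S. real (m l) * (3 * (norm (l * z))\<^sup>2)) = 3 * (norm z)\<^sup>2 * sum t S"
        by (simp add: t_def sum_distrib_left norm_mult power_mult_distrib mult_ac)
      also have "\<dots> \<le> 3 * (norm z)\<^sup>2 * d" using tail[OF S] by (intro mult_left_mono) auto
      finally show ?thesis using d(2) by simp
    qed
    have le: "real (m l) * (3 * (norm (l * z))\<^sup>2) \<le> 1" if "l \<in> S" for l
    proof -
      have "real (m l) * (3 * (norm (l * z))\<^sup>2) \<le> (\<Sum>l\<in>S. real (m l) * (3 * (norm (l * z))\<^sup>2))"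
        by (rule member_le_sum) (use S that in auto)
      then show ?thesis using tot by simp
    qed
    have "1 / 2 \<le> 1 - (\<Sum>l\<in>S. real (m l) * (3 * (norm (l * z))\<^sup>2))" using tot by simp
    also have "\<dots> \<le> (\<Prod>l\<in>S. 1 - real (m l) * (3 * (norm (l * z))\<^sup>2))"
      by (rule Weierstrass_prod_ineq) (use le in auto)
    also have "\<dots> \<le> (\<Prod>l\<in>S. norm (((1 - l * z) * exp (l * z)) ^ m l))"
      by (rule prod_mono) (use factor le in auto)
    also have "\<dots> = norm (reg_prod m S z)" by (simp add: reg_prod_def prod_norm)
    finally show ?thesis .
  qed
  have "1 / 2 \<le> norm (reg_det m (E - S0) z)"
    by (rule tendsto_lowerbound[OF tendsto_norm[OF D.reg_det_tendsto]
          eventually_finite_subsets_at_top_weakI[OF half]]) auto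
  moreover have "reg_prod m S0 z \<noteq> 0"
    using S0 nz by (auto simp: reg_prod_def)
  ultimately show ?thesis using reg_det_split[OF S0(1,2), of z] by auto
qed

lemma reg_det_factor:
  assumes "l \<in> E"
  shows "reg_det m E z = ((1 - l * z) * exp (l * z)) ^ m l * reg_det m (E - {l}) z"
  using reg_det_split[of "{l}" z] assms by (simp add: reg_prod_def)

lemma reg_det_eq_0_iff: "reg_det m E z = 0 \<longleftrightarrow> (\<exists>l\<in>E. l * z = 1)"
  using reg_det_nonzero reg_det_factor[of _ z] pos by (metis diff_self mult_zero_left power_0_left not_gr0)

text \<open>Splitting off the factor of l leaves a determinant over the other values, none of which
  has its reciprocal at 1/l; the split factor is a power of - l (w - 1/l) times an
  exponential.\<close>

lemma zorder_reg_det_exp: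
  assumes l: "l \<in> E" "l \<noteq> 0"
  shows "zorder (\<lambda>z. reg_det m E z * exp (z\<^sup>2 * c)) (inverse l) = int (m l)"
proof (rule zorder_eqI[where S = UNIV])
  interpret D: square_summable_multiset m "E - {l}" by (rule square_summable_multiset_Diff)
  let ?g = "\<lambda>z. (- l) ^ m l * exp (l * z) ^ m l * reg_det m (E - {l}) z * exp (z\<^sup>2 * c)"
  show "?g holomorphic_on UNIV"
    by (intro holomorphic_intros D.reg_det_holomorphic)
  have "k * inverse l \<noteq> 1" if "k \<in> E - {l}" for k
    using that l by (auto simp: field_simps)
  then have "reg_det m (E - {l}) (inverse l) \<noteq> 0"
    by (rule D.reg_det_nonzero)
  then show "?g (inverse l) \<noteq> 0" using l by simp
  fix w
  have "1 - l * w = - l * (w - inverse l)" using l by (simp add: algebra_simps)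
  then show "reg_det m E w * exp (w\<^sup>2 * c) = ?g w * (w - inverse l) powi int (m l)"
    unfolding reg_det_factor[OF l(1), of w] by (simp only: power_mult_distrib power_int_of_nat mult_ac)
qed auto

end

section \<open>Traces, closed walks and cycles\<close>

definition mat_trace :: "complex mat \<Rightarrow> complex" where
  "mat_trace A = (\<Sum>i<dim_row A. A $$ (i, i))"

lemma mat_mult_index_sum:
  assumes "A \<in> carrier_mat n m" "B \<in> carrier_mat m k" "i < n" "j < k"
  shows "(A * B) $$ (i, j) = (\<Sum>s<m. A $$ (i, s) * B $$ (s, j))"
  using assms by (auto simp: scalar_prod_def atLeast0LessThan intro!: sum.cong)

lemma mat_trace_commute:
  assumes "A \<in> carrier_mat n n" "B \<in> carrier_mat n n"
  shows "mat_trace (A * B) = mat_trace (B * A)"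
proof -
  have "mat_trace (A * B) = (\<Sum>i<n. \<Sum>s<n. A $$ (i, s) * B $$ (s, i))"
    using assms by (auto simp: mat_trace_def mat_mult_index_sum[OF assms] intro!: sum.cong simp del: index_mult_mat(1))
  also have "\<dots> = (\<Sum>s<n. \<Sum>i<n. B $$ (s, i) * A $$ (i, s))"
    by (subst sum.swap) (simp add: mult.commute)
  also have "\<dots> = mat_trace (B * A)"
    using assms by (auto simp: mat_trace_def mat_mult_index_sum[OF assms(2,1)] intro!: sum.cong simp del: index_mult_mat(1))
  finally show ?thesis .
qed

lemma pow_mat_Suc_left:
  assumes A: "(A :: 'a :: semiring_1 mat) \<in> carrier_mat n n"
  shows "A ^\<^sub>m Suc k = A * A ^\<^sub>m k"
proof (induction k)
  case (Suc k)
  have "A ^\<^sub>m Suc (Suc k) = A * A ^\<^sub>m k * A" using Suc.IH by simp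
  also have "\<dots> = A * (A ^\<^sub>m k * A)"
    by (rule assoc_mult_mat) (use A in auto)
  finally show ?case by simp
qed (use A in auto)

lemma mat_trace_similar:
  assumes A: "A \<in> carrier_mat n n" and sim: "similar_mat_wit A B P Q"
  shows "mat_trace A = mat_trace B"
proof -
  note w = similar_mat_witD2[OF A sim]
  have "mat_trace A = mat_trace (P * (B * Q))"
    using w by (simp add: assoc_mult_mat[of P n n B n Q n])
  also have "\<dots> = mat_trace (B * Q * P)"
    by (rule mat_trace_commute[of _ n]) (use w in auto)
  also have "B * Q * P = B"
    using w by (simp add: assoc_mult_mat[of B n n Q n P n])
  finally show ?thesis .
qed

text \<open>Both claims go into one induction: diagonal entries multiply only because everything
  below the diagonal vanishes.\<close>

lemma upper_triangular_pow:
  assumes B: "(B :: complex mat) \<in> carrier_mat n n" "upper_triangular B"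
  shows "(\<forall>i<n. \<forall>j<i. (B ^\<^sub>m k) $$ (i, j) = 0) \<and> (\<forall>i<n. (B ^\<^sub>m k) $$ (i, i) = (B $$ (i, i)) ^ k)"
proof (induction k)
  case 0
  then show ?case using B by auto
next
  case (Suc k)
  have car: "B ^\<^sub>m k \<in> carrier_mat n n" using B by simp
  have ent: "(B ^\<^sub>m Suc k) $$ (i, j) = (\<Sum>s<n. (B ^\<^sub>m k) $$ (i, s) * B $$ (s, j))" if "i < n" "j < n" for i j
    using mat_mult_index_sum[OF car B(1) that] by simp
  have ut: "B $$ (i, j) = 0" if "j < i" "i < n" for i j
    using upper_triangularD[OF B(2) that(1)] that B(1) by auto
  show ?case
  proof (intro conjI allI impI)
    fix i j assume "i < n" "j < i"
    then show "(B ^\<^sub>m Suc k) $$ (i, j) = 0"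
      unfolding ent[OF \<open>i < n\<close> less_trans[OF \<open>j < i\<close> \<open>i < n\<close>]]
      using Suc.IH ut by (intro sum.neutral) (metis lessThan_iff less_trans linorder_neqE_nat mult_zero_left mult_zero_right)
  next
    fix i assume i: "i < n"
    have "(\<Sum>s<n. (B ^\<^sub>m k) $$ (i, s) * B $$ (s, i)) = (\<Sum>s\<in>{i}. (B ^\<^sub>m k) $$ (i, s) * B $$ (s, i))"
    proof (rule sum.mono_neutral_right)
      show "\<forall>s\<in>{..<n} - {i}. (B ^\<^sub>m k) $$ (i, s) * B $$ (s, i) = 0"
      proof
        fix s assume "s \<in> {..<n} - {i}"
        then have "s < i \<or> i < s \<and> s < n" by auto
        then show "(B ^\<^sub>m k) $$ (i, s) * B $$ (s, i) = 0"
          using i Suc.IH ut by auto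
      qed
    qed (use i in auto)
    then show "(B ^\<^sub>m Suc k) $$ (i, i) = (B $$ (i, i)) ^ Suc k"
      unfolding ent[OF i i] using Suc.IH i by (simp add: mult.commute)
  qed
qed

text \<open>Schur triangularization puts the roots of the characteristic polynomial on a diagonal,
  and similarity preserves the traces of powers. One list serves both, with algebraic
  multiplicities.\<close>

lemma trace_pow_eigenvalues:
  assumes A: "(A :: complex mat) \<in> carrier_mat n n"
  obtains es where "char_poly A = (\<Prod>a\<leftarrow>es. [:- a, 1:])" "length es = n"
    "\<And>k. mat_trace (A ^\<^sub>m k) = (\<Sum>a\<leftarrow>es. a ^ k)"
proof -
  from char_poly_factorized[OF A] obtain es where es: "char_poly A = (\<Prod>a\<leftarrow>es. [:- a, 1:])" "length es = n"
    by blast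
  obtain B P Q where BPQ: "schur_decomposition A es = (B, P, Q)" by (cases "schur_decomposition A es") auto
  from schur_decomposition[OF A es(1) BPQ]
  have sim: "similar_mat_wit A B P Q" and ut: "upper_triangular B" and diag: "diag_mat B = es" by auto
  have B: "B \<in> carrier_mat n n" using similar_mat_witD2[OF A sim] by simp
  have "mat_trace (A ^\<^sub>m k) = (\<Sum>a\<leftarrow>es. a ^ k)" for k
  proof -
    have "mat_trace (A ^\<^sub>m k) = mat_trace (B ^\<^sub>m k)"
      by (rule mat_trace_similar[OF pow_carrier_mat[OF A] similar_mat_wit_pow[OF sim]])
    also have "\<dots> = (\<Sum>i<n. (B $$ (i, i)) ^ k)"
      using upper_triangular_pow[OF B ut, of k] B by (auto simp: mat_trace_def)
    also have "\<dots> = (\<Sum>a\<leftarrow>es. a ^ k)"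
      unfolding diag[symmetric] diag_mat_def using B
      by (simp add: sum_list_sum_nth atLeast0LessThan o_def)
    finally show ?thesis .
  qed
  with es that show ?thesis by blast
qed

text \<open>The quadratic form \<open>Q\<close> equals its own conjugate by symmetry, and equals
  \<open>e\<close> times the nonzero real number \<open>N\<close>. Reality gives both the real roots
  and the bound of the polynomials by a sum of squares.\<close>

lemma real_symmetric_eigenvalue_real:
  assumes A: "(A :: complex mat) \<in> carrier_mat n n"
    and sym: "\<And>i j. i < n \<Longrightarrow> j < n \<Longrightarrow> A $$ (i, j) = A $$ (j, i)"
    and real: "\<And>i j. i < n \<Longrightarrow> j < n \<Longrightarrow> A $$ (i, j) \<in> \<real>"
    and ev: "poly (char_poly A) e = 0"
  shows "e \<in> \<real>"
proof -
  from ev eigenvalue_root_char_poly[OF A] obtain v where v: "v \<in> carrier_vec n" "v \<noteq> 0\<^sub>v n" "A *\<^sub>v v = e \<cdot>\<^sub>v v"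
    using A by (auto simp: eigenvalue_def eigenvector_def)
  have ent: "(\<Sum>j<n. A $$ (i, j) * v $ j) = e * v $ i" if "i < n" for i
  proof -
    have "(A *\<^sub>v v) $ i = (\<Sum>j<n. A $$ (i, j) * v $ j)"
      using A v(1) that by (auto simp: scalar_prod_def atLeast0LessThan intro!: sum.cong)
    then show ?thesis using v that by simp
  qed
  define N where "N = (\<Sum>i<n. (norm (v $ i))\<^sup>2)"
  define Q where "Q = (\<Sum>i<n. \<Sum>j<n. A $$ (i, j) * v $ j * cnj (v $ i))"
  have "Q = (\<Sum>i<n. e * v $ i * cnj (v $ i))"
    unfolding Q_def by (intro sum.cong refl) (simp add: ent[symmetric] sum_distrib_right)
  also have "\<dots> = e * of_real N"
    unfolding N_def of_real_sum sum_distrib_left complex_norm_square by (simp add: mult.assoc)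
  finally have Q: "Q = e * of_real N" .
  have "cnj Q = (\<Sum>i<n. \<Sum>j<n. A $$ (i, j) * cnj (v $ j) * v $ i)"
    unfolding Q_def cnj_sum by (intro sum.cong refl) (use real in \<open>simp add: Reals_cnj_iff\<close>)
  also have "\<dots> = Q"
    unfolding Q_def by (subst sum.swap) (intro sum.cong refl, use sym in \<open>simp add: mult_ac\<close>)
  finally have "Q \<in> \<real>" by (simp add: Reals_cnj_iff)
  moreover have "N \<noteq> 0"
  proof
    assume "N = 0"
    then have "\<forall>i<n. v $ i = 0"
      by (auto simp: N_def sum_nonneg_eq_0_iff)
    then have "v = 0\<^sub>v n" using v(1) by auto
    with v(2) show False by contradiction
  qed
  moreover from this have "e = Q / of_real N" using Q by simp
  ultimately show ?thesis by simp
qed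

text \<open>The cycle on \<open>Suc j\<close> vertices; for \<open>j = 1\<close> it is the single edge.\<close>

definition cycle_graph :: "nat \<Rightarrow> nat pair_pre_digraph" where
  "cycle_graph j = \<lparr>pverts = {..j},
     parcs = {(i, Suc i) | i. i < j} \<union> {(Suc i, i) | i. i < j} \<union> {(0, j), (j, 0)}\<rparr>"

lemma cycle_finite: "finite (pverts (cycle_graph j))" "finite (parcs (cycle_graph j))"
  "(u, v) \<in> parcs (cycle_graph j) \<Longrightarrow> u \<in> pverts (cycle_graph j) \<and> v \<in> pverts (cycle_graph j)"
proof -
  have "parcs (cycle_graph j) \<subseteq> {..j} \<times> {..j}" by (auto simp: cycle_graph_def)
  then show "finite (parcs (cycle_graph j))" by (rule finite_subset) auto
qed (auto simp: cycle_graph_def)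

lemma pverts_cycle_graph: "pverts (cycle_graph j) = {..j}"
  by (simp add: cycle_graph_def)

lemma pair_graph_cycle_graph:
  assumes "j \<ge> 1"
  shows "pair_graph (cycle_graph j)"
proof
  show "finite (parcs (cycle_graph j))" by (rule cycle_finite)
  show "symmetric (with_proj (cycle_graph j))"
    by (auto simp: symmetric_def sym_def arcs_ends_def arc_to_ends_def cycle_graph_def)
qed (use assms in \<open>auto simp: cycle_graph_def\<close>)

text \<open>Summing over the last vertex of a closed walk composes the kernel with the closing weight.\<close>

lemma sum_PiE_path:
  fixes a :: "'v \<Rightarrow> 'v \<Rightarrow> 'b :: comm_ring_1"
  assumes V: "finite V"
  shows "(\<Sum>f\<in>{..k} \<rightarrow>\<^sub>E V. (\<Prod>i<k. a (f i) (f (Suc i))) * g (f k) (f 0)) =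
    (\<Sum>u\<in>V. ((\<lambda>g x y. \<Sum>s\<in>V. a x s * g s y) ^^ k) g u u)"
proof (induction k arbitrary: g)
  case 0
  have "(\<Sum>f\<in>{..0::nat} \<rightarrow>\<^sub>E V. g (f 0) (f 0)) = (\<Sum>u\<in>V. g u u)"
  proof (rule sum.reindex_bij_witness[where i = "\<lambda>u. \<lambda>x\<in>{..0::nat}. u" and j = "\<lambda>f. f 0"])
    fix f assume "f \<in> {..0::nat} \<rightarrow>\<^sub>E V"
    then show "(\<lambda>x\<in>{..0::nat}. f 0) = f" by (intro ext) (auto simp: restrict_def PiE_def extensional_def)
  qed auto
  then show ?case by simp
next
  case (Suc k)
  have "(\<Sum>f\<in>{..Suc k} \<rightarrow>\<^sub>E V. (\<Prod>i<Suc k. a (f i) (f (Suc i))) * g (f (Suc k)) (f 0)) =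
      (\<Sum>(s, f)\<in>V \<times> ({..k} \<rightarrow>\<^sub>E V). (\<Prod>i<k. a (f i) (f (Suc i))) * (a (f k) s * g s (f 0)))"
  proof (rule sum.reindex_bij_witness[where j = "\<lambda>f. (f (Suc k), restrict f {..k})" and i = "\<lambda>(s, f). f(Suc k := s)"])
    fix f assume f: "f \<in> {..Suc k} \<rightarrow>\<^sub>E V"
    show "(case (f (Suc k), restrict f {..k}) of (s, f) \<Rightarrow> f(Suc k := s)) = f"
      using f by (intro ext) (auto simp: restrict_def PiE_def extensional_def le_Suc_eq)
    show "(f (Suc k), restrict f {..k}) \<in> V \<times> ({..k} \<rightarrow>\<^sub>E V)"
      using f by auto
    show "(case (f (Suc k), restrict f {..k}) of (s, f) \<Rightarrow> (\<Prod>i<k. a (f i) (f (Suc i))) * (a (f k) s * g s (f 0))) =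
        (\<Prod>i<Suc k. a (f i) (f (Suc i))) * g (f (Suc k)) (f 0)"
      by (simp add: mult_ac)
  next
    fix p assume p: "p \<in> V \<times> ({..k} \<rightarrow>\<^sub>E V)"
    show "((case p of (s, f) \<Rightarrow> f(Suc k := s)) (Suc k), restrict (case p of (s, f) \<Rightarrow> f(Suc k := s)) {..k}) = p"
      using p by (auto simp: restrict_def PiE_def extensional_def fun_eq_iff)
    show "(case p of (s, f) \<Rightarrow> f(Suc k := s)) \<in> {..Suc k} \<rightarrow>\<^sub>E V"
      using p by (auto simp: PiE_def extensional_def Pi_def le_Suc_eq)
  qed
  also have "\<dots> = (\<Sum>f\<in>{..k} \<rightarrow>\<^sub>E V. (\<Prod>i<k. a (f i) (f (Suc i))) * (\<Sum>s\<in>V. a (f k) s * g s (f 0)))"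
    by (subst sum.cartesian_product[symmetric], subst sum.swap) (simp add: sum_distrib_left)
  also have "\<dots> = (\<Sum>u\<in>V. ((\<lambda>g x y. \<Sum>s\<in>V. a x s * g s y) ^^ Suc k) g u u)"
    unfolding Suc.IH[of "\<lambda>x y. \<Sum>s\<in>V. a x s * g s y"] by (simp only: funpow_Suc_right o_def)
  finally show ?case .
qed

text \<open>Both sides count closed walks of length j + 1; symmetry of the graph supplies the
  reversed arcs. For \<open>j = 1\<close> a closed walk crosses one edge back and forth, so the
  count is still that of homomorphisms from an edge.\<close>

lemma card_cycle_homs:
  assumes G: "pair_graph G" and j: "j \<ge> 1" and vs: "distinct vs" "set vs = pverts G"
  shows "of_nat (card (graph_homs (cycle_graph j) G)) = mat_trace (adjacency_mat G vs ^\<^sub>m Suc j)"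
proof -
  interpret pair_graph G by fact
  let ?V = "pverts G" and ?n = "length vs"
  define a where "a = (\<lambda>u v. if (u, v) \<in> parcs G then 1 else 0 :: complex)"
  define T where "T = (\<lambda>(g :: 'a \<Rightarrow> 'a \<Rightarrow> complex) x y. \<Sum>s\<in>?V. a x s * g s y)"
  define A where "A = adjacency_mat G vs"
  have V: "finite ?V" by (rule pair_finite_verts)
  have sym: "(v, u) \<in> parcs G" if "(u, v) \<in> parcs G" for u v
    using that arcs_symmetric by auto
  have A: "A \<in> carrier_mat ?n ?n" by (simp add: A_def adjacency_mat_def)
  have sumV: "(\<Sum>s<?n. h (vs ! s)) = (\<Sum>s\<in>?V. h s)" for h :: "'a \<Rightarrow> complex"
    using sum.reindex_bij_betw[OF bij_betw_nth[OF vs(1) refl refl], of h] vs(2) by simp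
  \<comment> \<open>The recursion starts from the kernel \<open>a\<close> itself, so its k-th
    iterate is the power k + 1 of the matrix.\<close>
  have ent: "(A ^\<^sub>m Suc k) $$ (i, l) = (T ^^ k) a (vs ! i) (vs ! l)" if "i < ?n" "l < ?n" for i l k
    using that
  proof (induction k arbitrary: i l)
    case 0
    then show ?case using A by (simp add: A_def adjacency_mat_def a_def)
  next
    case (Suc k)
    have "A ^\<^sub>m Suc (Suc k) = A * A ^\<^sub>m Suc k"
      using pow_mat_Suc_left[OF A] by blast
    then have "(A ^\<^sub>m Suc (Suc k)) $$ (i, l) = (\<Sum>s<?n. A $$ (i, s) * (A ^\<^sub>m Suc k) $$ (s, l))"
      using mat_mult_index_sum[OF A pow_carrier_mat[OF A, of "Suc k"] Suc.prems] by (simp only:)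
    also have "\<dots> = (\<Sum>s<?n. a (vs ! i) (vs ! s) * (T ^^ k) a (vs ! s) (vs ! l))"
      by (intro sum.cong refl) (use Suc in \<open>auto simp: A_def adjacency_mat_def a_def simp del: pow_mat.simps\<close>)
    also have "\<dots> = (T ^^ Suc k) a (vs ! i) (vs ! l)"
      unfolding sumV[of "\<lambda>s. a (vs ! i) s * (T ^^ k) a s (vs ! l)"] by (simp add: T_def)
    finally show ?case .
  qed
  have "mat_trace (A ^\<^sub>m Suc j) = (\<Sum>i<?n. (T ^^ j) a (vs ! i) (vs ! i))"
    unfolding mat_trace_def using ent A by (intro sum.cong) auto
  also have "\<dots> = (\<Sum>u\<in>?V. (T ^^ j) a u u)"
    by (rule sumV[of "\<lambda>u. (T ^^ j) a u u"])
  also have "\<dots> = (\<Sum>f\<in>{..j} \<rightarrow>\<^sub>E ?V. (\<Prod>i<j. a (f i) (f (Suc i))) * a (f j) (f 0))"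
    unfolding T_def by (rule sum_PiE_path[OF V, symmetric])
  also have "\<dots> = (\<Sum>f\<in>{..j} \<rightarrow>\<^sub>E ?V. if f \<in> graph_homs (cycle_graph j) G then 1 else 0)"
  proof (rule sum.cong[OF refl])
    fix f assume f: "f \<in> {..j} \<rightarrow>\<^sub>E ?V"
    have "(\<Prod>i<j. a (f i) (f (Suc i))) * a (f j) (f 0) =
        (if (\<forall>i<j. (f i, f (Suc i)) \<in> parcs G) \<and> (f j, f 0) \<in> parcs G then 1 else 0)"
      by (auto simp: a_def prod_zero_iff)
    moreover have arcs: "(\<forall>(u, v)\<in>parcs (cycle_graph j). P u v) \<longleftrightarrow>
        (\<forall>i<j. P i (Suc i)) \<and> (\<forall>i<j. P (Suc i) i) \<and> P 0 j \<and> P j 0" for P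
      unfolding cycle_graph_def by (simp add: ball_Un) blast
    have "f \<in> graph_homs (cycle_graph j) G \<longleftrightarrow>
        (\<forall>i<j. (f i, f (Suc i)) \<in> parcs G) \<and> (f j, f 0) \<in> parcs G"
      using f sym unfolding graph_homs_def arcs by (auto simp: cycle_graph_def)
    ultimately show "(\<Prod>i<j. a (f i) (f (Suc i))) * a (f j) (f 0) =
        (if f \<in> graph_homs (cycle_graph j) G then 1 else 0)" by simp
  qed
  also have "\<dots> = of_nat (card (graph_homs (cycle_graph j) G))"
  proof -
    have "graph_homs (cycle_graph j) G \<subseteq> {..j} \<rightarrow>\<^sub>E ?V"
      by (auto simp: graph_homs_def cycle_graph_def)
    then show ?thesis using V by (simp add: sum.If_cases finite_PiE Int_absorb1)
  qed
  finally show ?thesis by (simp add: A_def)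
qed

section \<open>Bounded kernels on a probability space\<close>

text \<open>Boundedness is demanded everywhere and not almost everywhere: on a probability space all
  products are then integrable, and every row and column of a kernel is again of this kind.\<close>

definition bdd_meas :: "'b measure \<Rightarrow> ('b \<Rightarrow> complex) \<Rightarrow> bool" where
  "bdd_meas N f \<longleftrightarrow> f \<in> borel_measurable N \<and> (\<exists>B. \<forall>x. norm (f x) \<le> B)"

lemma bdd_measI: "f \<in> borel_measurable N \<Longrightarrow> (\<And>x. norm (f x) \<le> B) \<Longrightarrow> bdd_meas N f"
  by (auto simp: bdd_meas_def)

lemma bdd_meas_measurable [measurable_dest]: "bdd_meas N f \<Longrightarrow> f \<in> borel_measurable N"
  by (simp add: bdd_meas_def)

lemma bdd_measE:
  assumes "bdd_meas N f"
  obtains B where "B \<ge> 0" "\<And>x. norm (f x) \<le> B"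
proof -
  from assms obtain B where B: "\<And>x. norm (f x) \<le> B" by (auto simp: bdd_meas_def)
  have "B \<ge> 0" using order_trans[OF norm_ge_zero B] .
  with B that show ?thesis by blast
qed

named_theorems bdd_intros

lemma bdd_meas_const [bdd_intros]: "bdd_meas N (\<lambda>x. c)"
  by (rule bdd_measI[where B = "norm c"]) auto

lemma bdd_meas_mult [bdd_intros]:
  assumes "bdd_meas N f" "bdd_meas N g"
  shows "bdd_meas N (\<lambda>x. f x * g x)"
proof -
  obtain A B where "A \<ge> 0" "\<And>x. norm (f x) \<le> A" "B \<ge> 0" "\<And>x. norm (g x) \<le> B"
    using assms by (metis bdd_measE)
  then show ?thesis
    by (intro bdd_measI[where B = "A * B"])
       (use assms in \<open>auto simp: norm_mult bdd_meas_def intro!: mult_mono\<close>)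
qed

lemma bdd_meas_add [bdd_intros]:
  assumes "bdd_meas N f" "bdd_meas N g"
  shows "bdd_meas N (\<lambda>x. f x + g x)"
proof -
  obtain A B where "\<And>x. norm (f x) \<le> A" "\<And>x. norm (g x) \<le> B"
    using assms by (metis bdd_measE)
  then show ?thesis
    by (intro bdd_measI[where B = "A + B"] order_trans[OF norm_triangle_ineq] add_mono)
       (use assms in \<open>auto simp: bdd_meas_def\<close>)
qed

lemma bdd_meas_uminus [bdd_intros]: "bdd_meas N f \<Longrightarrow> bdd_meas N (\<lambda>x. - f x)"
  by (auto simp: bdd_meas_def)

lemma bdd_meas_diff [bdd_intros]:
  "bdd_meas N f \<Longrightarrow> bdd_meas N g \<Longrightarrow> bdd_meas N (\<lambda>x. f x - g x)"
  using bdd_meas_add[of N f "\<lambda>x. - g x"] bdd_meas_uminus[of N g] by simp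

lemma borel_measurable_cnj [measurable (raw)]:
  "f \<in> borel_measurable N \<Longrightarrow> (\<lambda>x. cnj (f x)) \<in> borel_measurable N"
  by (rule measurable_compose[OF _ borel_measurable_continuous_onI]) (auto intro: continuous_intros)

lemma bdd_meas_cnj [bdd_intros]: "bdd_meas N f \<Longrightarrow> bdd_meas N (\<lambda>x. cnj (f x))"
  by (auto simp: bdd_meas_def)

lemma bdd_meas_sum [bdd_intros]:
  "(\<And>i. i \<in> I \<Longrightarrow> bdd_meas N (f i)) \<Longrightarrow> bdd_meas N (\<lambda>x. \<Sum>i\<in>I. f i x)"
  by (induction I rule: infinite_finite_induct) (auto intro: bdd_intros)

lemma bdd_meas_prod [bdd_intros]:
  "(\<And>i. i \<in> I \<Longrightarrow> bdd_meas N (f i)) \<Longrightarrow> bdd_meas N (\<lambda>x. \<Prod>i\<in>I. f i x)"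
  by (induction I rule: infinite_finite_induct) (auto intro: bdd_intros)

lemma bdd_meas_indicator: "X \<in> sets N \<Longrightarrow> bdd_meas N (indicator X)"
  by (rule bdd_measI[where B = 1]) (auto simp: indicator_def)

section \<open>Inner products of bounded functions\<close>

definition ip :: "'b measure \<Rightarrow> ('b \<Rightarrow> complex) \<Rightarrow> ('b \<Rightarrow> complex) \<Rightarrow> complex" where
  "ip N f g = (\<integral>x. f x * cnj (g x) \<partial>N)"

definition sqn :: "'b measure \<Rightarrow> ('b \<Rightarrow> complex) \<Rightarrow> real" where
  "sqn N f = (\<integral>x. (norm (f x))\<^sup>2 \<partial>N)"

lemma sqn_nonneg [simp]: "sqn N f \<ge> 0"
  by (simp add: sqn_def)

lemma ip_self: "ip N f f = of_real (sqn N f)"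
  unfolding ip_def sqn_def integral_complex_of_real[symmetric] complex_norm_square ..

lemma cnj_ip: "cnj (ip N f g) = ip N g f"
  unfolding ip_def by (subst Bochner_Integration.integral_cnj[symmetric]) (simp add: mult.commute)

context prob_space
begin

lemma bdd_meas_integrable: "bdd_meas M f \<Longrightarrow> integrable M f"
  by (auto simp: bdd_meas_def intro!: integrable_const_bound)

lemma ip_integrable: "bdd_meas M f \<Longrightarrow> bdd_meas M g \<Longrightarrow> integrable M (\<lambda>x. f x * cnj (g x))"
  by (intro bdd_meas_integrable bdd_intros)

lemma sqn_integrable:
  assumes "bdd_meas M f"
  shows "integrable M (\<lambda>x. (norm (f x))\<^sup>2)"
proof -
  have "(\<lambda>x. (norm (f x))\<^sup>2) = (\<lambda>x. Re (f x * cnj (f x)))"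
    by (simp flip: complex_norm_square)
  with integrable_bounded_linear[OF bounded_linear_Re ip_integrable[OF assms assms]] show ?thesis
    by (simp only:)
qed

lemma ip_diff_left: "bdd_meas M f \<Longrightarrow> bdd_meas M g \<Longrightarrow> bdd_meas M h \<Longrightarrow>
    ip M (\<lambda>x. f x - g x) h = ip M f h - ip M g h"
  unfolding ip_def by (simp add: ip_integrable left_diff_distrib)

lemma ip_cmult_left: "ip M (\<lambda>x. c * f x) h = c * ip M f h"
  unfolding ip_def by (simp add: mult.assoc)

lemma ip_sum_left: "(\<And>i. i \<in> I \<Longrightarrow> bdd_meas M (f i)) \<Longrightarrow> bdd_meas M h \<Longrightarrow>
    ip M (\<lambda>x. \<Sum>i\<in>I. f i x) h = (\<Sum>i\<in>I. ip M (f i) h)"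
  unfolding ip_def sum_distrib_right by (rule Bochner_Integration.integral_sum) (simp add: ip_integrable)

lemma ip_diff_right: "bdd_meas M f \<Longrightarrow> bdd_meas M g \<Longrightarrow> bdd_meas M h \<Longrightarrow>
    ip M h (\<lambda>x. f x - g x) = ip M h f - ip M h g"
  using ip_diff_left[of f g h] cnj_ip by (metis complex_cnj_diff)

lemma ip_cmult_right: "ip M h (\<lambda>x. c * f x) = cnj c * ip M h f"
  using ip_cmult_left[of c f h] cnj_ip by (metis complex_cnj_mult)

lemma ip_sum_right: "(\<And>i. i \<in> I \<Longrightarrow> bdd_meas M (f i)) \<Longrightarrow> bdd_meas M h \<Longrightarrow>
    ip M h (\<lambda>x. \<Sum>i\<in>I. f i x) = (\<Sum>i\<in>I. ip M h (f i))"
  using ip_sum_left[of I f h] cnj_ip[of M _ h] by (metis (mono_tags, lifting) cnj_sum sum.cong)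

lemma sqn_diff: "bdd_meas M f \<Longrightarrow> bdd_meas M g \<Longrightarrow>
    sqn M (\<lambda>x. f x - g x) = sqn M f - 2 * Re (ip M f g) + sqn M g"
proof -
  assume f: "bdd_meas M f" and g: "bdd_meas M g"
  have "complex_of_real (sqn M (\<lambda>x. f x - g x)) = ip M f f - ip M g f - (ip M f g - ip M g g)"
    unfolding ip_self[symmetric] by (simp add: ip_diff_left ip_diff_right f g bdd_intros)
  moreover have "Re (ip M g f) = Re (ip M f g)" using cnj_ip[of M f g] by (metis cnj.sel(1))
  ultimately show ?thesis
    by (simp add: complex_eq_iff ip_self)
qed

lemma sqn_cmult: "sqn M (\<lambda>x. c * f x) = (norm c)\<^sup>2 * sqn M f"
  unfolding sqn_def by (simp add: norm_mult power_mult_distrib)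

lemma sqn_eq_0_iff: "bdd_meas M f \<Longrightarrow> sqn M f = 0 \<longleftrightarrow> (AE x in M. f x = 0)"
  unfolding sqn_def by (subst integral_nonneg_eq_0_iff_AE) (auto intro: sqn_integrable)

lemma ip_zero_AE: "bdd_meas M f \<Longrightarrow> bdd_meas M g \<Longrightarrow> sqn M g = 0 \<Longrightarrow> ip M f g = 0"
proof -
  assume *: "bdd_meas M f" "bdd_meas M g" "sqn M g = 0"
  then have "AE x in M. f x * cnj (g x) = 0" by (auto simp: sqn_eq_0_iff)
  then show ?thesis unfolding ip_def by (rule integral_eq_zero_AE)
qed

lemma Cauchy_Schwarz_ip:
  assumes f: "bdd_meas M f" and g: "bdd_meas M g"
  shows "(norm (ip M f g))\<^sup>2 \<le> sqn M f * sqn M g"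
proof (cases "sqn M g = 0")
  case True
  then show ?thesis using ip_zero_AE[OF f g] by simp
next
  case False
  then have pos: "sqn M g > 0" using sqn_nonneg[of M g] by linarith
  define c where "c = ip M f g / of_real (sqn M g)"
  have n: "norm c = norm (ip M f g) / sqn M g" using pos by (simp add: c_def norm_divide)
  have "0 \<le> sqn M (\<lambda>x. f x - c * g x)" by simp
  also have "\<dots> = sqn M f - 2 * Re (cnj c * ip M f g) + (norm c)\<^sup>2 * sqn M g"
    using f g by (simp add: sqn_diff bdd_intros ip_cmult_right sqn_cmult)
  also have "cnj c * ip M f g = of_real ((norm (ip M f g))\<^sup>2 / sqn M g)"
    by (simp add: c_def complex_norm_square mult.commute del: of_real_power)
  finally have "0 \<le> sqn M f - (norm (ip M f g))\<^sup>2 / sqn M g"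
    using pos by (simp add: n power_divide power2_eq_square field_simps)
  then show ?thesis using pos by (simp add: field_simps)
qed

lemma norm_ip_le:
  "bdd_meas M f \<Longrightarrow> bdd_meas M g \<Longrightarrow> norm (ip M f g) \<le> sqrt (sqn M f) * sqrt (sqn M g)"
  unfolding real_sqrt_mult[symmetric] by (rule real_le_rsqrt[OF Cauchy_Schwarz_ip])

end

section \<open>Integral operators and composition of kernels\<close>

locale kernel_space = prob_space M for M :: "'a measure" +
  assumes space_UNIV [simp]: "space M = UNIV"
begin

abbreviation P where "P \<equiv> M \<Otimes>\<^sub>M M"

sublocale P: pair_prob_space M M ..

definition app :: "('a \<times> 'a \<Rightarrow> complex) \<Rightarrow> ('a \<Rightarrow> complex) \<Rightarrow> 'a \<Rightarrow> complex" where
  "app K f x = (\<integral>s. K (x, s) * f s \<partial>M)"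

definition kcomp :: "('a \<times> 'a \<Rightarrow> complex) \<Rightarrow> ('a \<times> 'a \<Rightarrow> complex) \<Rightarrow> 'a \<times> 'a \<Rightarrow> complex" where
  "kcomp K L = (\<lambda>(x, y). app K (\<lambda>s. L (s, y)) x)"

text \<open>Symmetry holds at every pair of points, so that identities between rows and columns, and
  hence between powers, need no exceptional null sets.\<close>

definition hermitian :: "('a \<times> 'a \<Rightarrow> complex) \<Rightarrow> bool" where
  "hermitian K \<longleftrightarrow> bdd_meas P K \<and> (\<forall>x y. K (x, y) = cnj (K (y, x)))"

lemma hermitian_bdd: "hermitian K \<Longrightarrow> bdd_meas P K"
  unfolding hermitian_def by blast

lemma hermitian_cnj: "hermitian K \<Longrightarrow> cnj (K (y, x)) = K (x, y)"
  unfolding hermitian_def by metis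

lemma bdd_meas_row: "bdd_meas P K \<Longrightarrow> bdd_meas M (\<lambda>s. K (x, s))"
  and bdd_meas_col: "bdd_meas P K \<Longrightarrow> bdd_meas M (\<lambda>s. K (s, x))"
  unfolding bdd_meas_def by (auto intro: measurable_Pair1 measurable_Pair2)

lemma bdd_meas_fst: "bdd_meas M f \<Longrightarrow> bdd_meas P (\<lambda>p. f (fst p))"
  and bdd_meas_snd: "bdd_meas M f \<Longrightarrow> bdd_meas P (\<lambda>p. f (snd p))"
  unfolding bdd_meas_def by auto

lemma norm_integral_le:
  assumes "bdd_meas M f" "\<And>x. norm (f x) \<le> B"
  shows "norm (\<integral>x. f x \<partial>M) \<le> B"
proof -
  have "norm (\<integral>x. f x \<partial>M) \<le> (\<integral>x. norm (f x) \<partial>M)" by (rule integral_norm_bound)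
  also have "\<dots> \<le> B"
    by (rule integral_le_const) (use assms bdd_meas_integrable in auto)
  finally show ?thesis .
qed

lemma norm_app_le:
  assumes "bdd_meas P K" "bdd_meas M f" "\<And>p. norm (K p) \<le> A" "\<And>x. norm (f x) \<le> B"
  shows "norm (app K f x) \<le> A * B"
proof -
  have "0 \<le> A" using order_trans[OF norm_ge_zero assms(3)] .
  then show ?thesis
    unfolding app_def using assms
    by (intro norm_integral_le bdd_intros bdd_meas_row[OF assms(1)]) (auto simp: norm_mult intro!: mult_mono)
qed

lemma bdd_meas_app [bdd_intros]:
  assumes K: "bdd_meas P K" and f: "bdd_meas M f"
  shows "bdd_meas M (app K f)"
proof -
  obtain A B where "\<And>p. norm (K p) \<le> A" "\<And>x. norm (f x) \<le> B" using K f by (metis bdd_measE)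
  then have "norm (app K f x) \<le> A * B" for x using K f by (intro norm_app_le)
  moreover have "app K f \<in> borel_measurable M"
  proof -
    have [measurable]: "K \<in> borel_measurable (M \<Otimes>\<^sub>M M)" "f \<in> borel_measurable M"
      using K f by auto
    show ?thesis unfolding app_def by measurable
  qed
  ultimately show ?thesis by (intro bdd_measI)
qed

lemma bdd_meas_kcomp [bdd_intros]:
  assumes K: "bdd_meas P K" and L: "bdd_meas P L"
  shows "bdd_meas P (kcomp K L)"
proof -
  obtain A B where "\<And>p. norm (K p) \<le> A" "\<And>x. norm (L x) \<le> B" using K L by (metis bdd_measE)
  then have "norm (kcomp K L p) \<le> A * B" for p
    unfolding kcomp_def by (cases p) (auto intro!: norm_app_le[OF K bdd_meas_col[OF L]])
  moreover have "kcomp K L \<in> borel_measurable P"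
  proof -
    have [measurable]: "K \<in> borel_measurable (M \<Otimes>\<^sub>M M)" "L \<in> borel_measurable (M \<Otimes>\<^sub>M M)"
      using K L by auto
    show ?thesis unfolding kcomp_def app_def by measurable
  qed
  ultimately show ?thesis by (intro bdd_measI)
qed

lemma Fubini_bdd:
  assumes "bdd_meas P (\<lambda>(x, y). f x y)"
  shows "(\<integral>y. (\<integral>x. f x y \<partial>M) \<partial>M) = (\<integral>x. (\<integral>y. f x y \<partial>M) \<partial>M)"
    and "(\<integral>x. (\<integral>y. f x y \<partial>M) \<partial>M) = (\<integral>p. (case p of (x, y) \<Rightarrow> f x y) \<partial>P)"
  using P.Fubini_integral[of f] P.integral_fst[of f] P.P.bdd_meas_integrable[OF assms] by auto

text \<open>Fubini. It turns sesquilinear forms of the operator into Hilbert-Schmidt pairings of its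
  kernel, the form in which weak convergence of kernels is tested.\<close>

lemma ip_app_rank_one:
  assumes K: "bdd_meas P K" and f: "bdd_meas M f" and g: "bdd_meas M g"
  shows "ip M (app K f) g = ip P K (\<lambda>(x, y). g x * cnj (f y))"
proof -
  have b: "bdd_meas P (\<lambda>(x, y). K (x, y) * f y * cnj (g x))"
    using bdd_meas_mult[OF bdd_meas_mult[OF K bdd_meas_snd[OF f]] bdd_meas_cnj[OF bdd_meas_fst[OF g]]]
    by (simp add: case_prod_unfold)
  have "ip M (app K f) g = (\<integral>x. (\<integral>y. K (x, y) * f y * cnj (g x) \<partial>M) \<partial>M)"
    unfolding ip_def app_def by simp
  also have "\<dots> = (\<integral>p. (case p of (x, y) \<Rightarrow> K (x, y) * f y * cnj (g x)) \<partial>P)"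
    by (rule Fubini_bdd(2)[OF b])
  finally show ?thesis unfolding ip_def by (simp add: case_prod_unfold mult_ac)
qed

lemma ip_app_hermitian:
  assumes K: "hermitian K" and f: "bdd_meas M f" and g: "bdd_meas M g"
  shows "ip M (app K f) g = ip M f (app K g)"
proof -
  note Kb = hermitian_bdd[OF K]
  have b: "bdd_meas P (\<lambda>(x, y). K (x, y) * f y * cnj (g x))"
    using bdd_meas_mult[OF bdd_meas_mult[OF Kb bdd_meas_snd[OF f]] bdd_meas_cnj[OF bdd_meas_fst[OF g]]]
    by (simp add: case_prod_unfold)
  have "ip M (app K f) g = (\<integral>x. (\<integral>y. K (x, y) * f y * cnj (g x) \<partial>M) \<partial>M)"
    unfolding ip_def app_def by simp
  also have "\<dots> = (\<integral>y. (\<integral>x. K (x, y) * f y * cnj (g x) \<partial>M) \<partial>M)"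
    by (rule Fubini_bdd(1)[OF b, symmetric])
  also have "\<dots> = (\<integral>y. f y * cnj (\<integral>x. K (y, x) * g x \<partial>M) \<partial>M)"
  proof (rule Bochner_Integration.integral_cong[OF refl])
    fix y
    have "cnj (\<integral>x. K (y, x) * g x \<partial>M) = (\<integral>x. K (x, y) * cnj (g x) \<partial>M)"
      by (subst Bochner_Integration.integral_cnj[symmetric]) (simp add: hermitian_cnj[OF K])
    then show "(\<integral>x. K (x, y) * f y * cnj (g x) \<partial>M) = f y * cnj (\<integral>x. K (y, x) * g x \<partial>M)"
      by (simp add: mult.assoc[symmetric] mult.commute[of _ "f y"] flip: Bochner_Integration.integral_mult_right_zero)
  qed
  finally show ?thesis unfolding ip_def app_def .
qed

lemma ip_columns:
  assumes "bdd_meas P A" "bdd_meas P B"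
  shows "ip P A B = (\<integral>y. ip M (\<lambda>x. A (x, y)) (\<lambda>x. B (x, y)) \<partial>M)"
proof -
  have b: "bdd_meas P (\<lambda>(x, y). A (x, y) * cnj (B (x, y)))"
    using bdd_meas_mult[OF assms(1) bdd_meas_cnj[OF assms(2)]] by (simp add: case_prod_unfold)
  from Fubini_bdd[OF b] show ?thesis
    unfolding ip_def by (simp add: case_prod_unfold)
qed

lemma kcomp_column: "(\<lambda>x. kcomp K A (x, y)) = app K (\<lambda>s. A (s, y))"
  by (simp add: kcomp_def)

lemma ip_kcomp_hermitian:
  assumes "hermitian K" "bdd_meas P A" "bdd_meas P B"
  shows "ip P (kcomp K A) B = ip P A (kcomp K B)"
  using assms hermitian_bdd[OF assms(1)]
  by (simp add: ip_columns bdd_meas_kcomp kcomp_column ip_app_hermitian bdd_meas_col[OF assms(2)] bdd_meas_col[OF assms(3)])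

lemma app_kcomp:
  assumes K: "bdd_meas P K" and L: "bdd_meas P L" and f: "bdd_meas M f"
  shows "app (kcomp K L) f = app K (app L f)"
proof
  fix x
  have b: "bdd_meas P (\<lambda>(s, y). K (x, s) * L (s, y) * f y)"
    using bdd_meas_mult[OF bdd_meas_mult[OF bdd_meas_fst[OF bdd_meas_row[OF K]] L] bdd_meas_snd[OF f]]
    by (simp add: case_prod_unfold)
  have "app (kcomp K L) f x = (\<integral>y. (\<integral>s. K (x, s) * L (s, y) * f y \<partial>M) \<partial>M)"
    unfolding app_def kcomp_def by simp
  also have "\<dots> = (\<integral>s. (\<integral>y. K (x, s) * L (s, y) * f y \<partial>M) \<partial>M)"
    by (rule Fubini_bdd(1)[OF b])
  also have "\<dots> = app K (app L f) x"
    unfolding app_def by (simp add: mult.assoc)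
  finally show "app (kcomp K L) f x = app K (app L f) x" .
qed

lemma kcomp_assoc:
  assumes "bdd_meas P K" "bdd_meas P L" "bdd_meas P A"
  shows "kcomp (kcomp K L) A = kcomp K (kcomp L A)"
  using app_kcomp[OF assms(1,2) bdd_meas_col[OF assms(3)]]
  by (auto simp: kcomp_def)

lemma app_add: "bdd_meas P K \<Longrightarrow> bdd_meas M f \<Longrightarrow> bdd_meas M g \<Longrightarrow>
    app K (\<lambda>x. f x + g x) = (\<lambda>x. app K f x + app K g x)"
  unfolding app_def by (simp add: distrib_left bdd_meas_integrable bdd_meas_mult bdd_meas_row[of K])

lemma app_diff: "bdd_meas P K \<Longrightarrow> bdd_meas M f \<Longrightarrow> bdd_meas M g \<Longrightarrow>
    app K (\<lambda>x. f x - g x) = (\<lambda>x. app K f x - app K g x)"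
  unfolding app_def by (simp add: right_diff_distrib bdd_meas_integrable bdd_meas_mult bdd_meas_row[of K])

lemma app_sum: "bdd_meas P K \<Longrightarrow> (\<And>i. i \<in> I \<Longrightarrow> bdd_meas M (f i)) \<Longrightarrow>
    app K (\<lambda>x. \<Sum>i\<in>I. f i x) = (\<lambda>x. \<Sum>i\<in>I. app K (f i) x)"
  unfolding app_def sum_distrib_left
  by (intro ext Bochner_Integration.integral_sum bdd_meas_integrable bdd_meas_mult bdd_meas_row[of K])

lemma app_cmult: "app K (\<lambda>x. c * f x) = (\<lambda>x. c * app K f x)"
proof
  fix x
  have "(\<lambda>s. K (x, s) * (c * f s)) = (\<lambda>s. c * (K (x, s) * f s))" by (simp add: mult_ac)
  then show "app K (\<lambda>x. c * f x) x = c * app K f x" by (simp add: app_def)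
qed

lemma app_cong_AE:
  "bdd_meas P K \<Longrightarrow> bdd_meas M f \<Longrightarrow> bdd_meas M g \<Longrightarrow> AE x in M. f x = g x \<Longrightarrow> app K f = app K g"
  unfolding app_def
  by (intro ext integral_cong_AE bdd_meas_measurable[OF bdd_meas_mult] bdd_meas_row[of K]) auto

text \<open>Cauchy-Schwarz for a row of \<open>K\<close> against a column of \<open>A\<close>,
  integrated over the column index and then over the row index.\<close>

lemma sqn_kcomp_le:
  assumes K: "bdd_meas P K" and A: "bdd_meas P A"
  shows "sqn P (kcomp K A) \<le> sqn P K * sqn P A"
proof -
  have sqnP: "sqn P B = (\<integral>x. sqn M (\<lambda>y. B (x, y)) \<partial>M)" "sqn P B = (\<integral>y. sqn M (\<lambda>x. B (x, y)) \<partial>M)"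
    "integrable M (\<lambda>x. sqn M (\<lambda>y. B (x, y)))" "integrable M (\<lambda>y. sqn M (\<lambda>x. B (x, y)))"
    if "bdd_meas P B" for B
    using P.P.sqn_integrable[OF that] P.integral_fst'[of "\<lambda>p. (norm (B p))\<^sup>2"]
      P.integral_snd[of "\<lambda>x y. (norm (B (x, y)))\<^sup>2"] P.integrable_fst'[of "\<lambda>p. (norm (B p))\<^sup>2"]
      P.integrable_snd[of "\<lambda>x y. (norm (B (x, y)))\<^sup>2"]
    by (auto simp: sqn_def case_prod_unfold)
  have le: "(norm (kcomp K A (x, y)))\<^sup>2 \<le> sqn M (\<lambda>s. K (x, s)) * sqn M (\<lambda>s. A (s, y))" for x y
  proof -
    have "kcomp K A (x, y) = ip M (\<lambda>s. K (x, s)) (\<lambda>s. cnj (A (s, y)))"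
      by (simp add: kcomp_def app_def ip_def)
    moreover have "sqn M (\<lambda>s. cnj (A (s, y))) = sqn M (\<lambda>s. A (s, y))" by (simp add: sqn_def)
    ultimately show ?thesis
      using Cauchy_Schwarz_ip[OF bdd_meas_row[OF K] bdd_meas_cnj[OF bdd_meas_col[OF A]], of x y] by simp
  qed
  have kA: "bdd_meas P (kcomp K A)" using K A by (rule bdd_meas_kcomp)
  have inner: "sqn M (\<lambda>y. kcomp K A (x, y)) \<le> sqn M (\<lambda>s. K (x, s)) * sqn P A" for x
  proof -
    have "sqn M (\<lambda>y. kcomp K A (x, y)) \<le> (\<integral>y. sqn M (\<lambda>s. K (x, s)) * sqn M (\<lambda>s. A (s, y)) \<partial>M)"
      unfolding sqn_def[of M "\<lambda>y. kcomp K A (x, y)"]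
      by (intro integral_mono sqn_integrable bdd_meas_row[OF kA] integrable_mult_right sqnP A le)
    then show ?thesis using sqnP(2)[OF A] by simp
  qed
  have "sqn P (kcomp K A) = (\<integral>x. sqn M (\<lambda>y. kcomp K A (x, y)) \<partial>M)" by (rule sqnP(1)[OF kA])
  also have "\<dots> \<le> (\<integral>x. sqn M (\<lambda>s. K (x, s)) * sqn P A \<partial>M)"
    by (intro integral_mono sqnP kA integrable_mult_left K inner)
  also have "\<dots> = sqn P K * sqn P A" using sqnP(1)[OF K] by simp
  finally show ?thesis .
qed

text \<open>Indices are shifted so that the undefined power zero does not occur: \<open>kpow K n\<close> is the
  \<open>(n + 1)\<close>-st power of \<open>K\<close>, and \<open>ktr K n\<close> is the trace of the \<open>(n + 2)\<close>-nd.\<close>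

definition kpow :: "('a \<times> 'a \<Rightarrow> complex) \<Rightarrow> nat \<Rightarrow> 'a \<times> 'a \<Rightarrow> complex" where
  "kpow K n = (kcomp K ^^ n) K"

lemma kpow_simps [simp]: "kpow K 0 = K" "kpow K (Suc n) = kcomp K (kpow K n)"
  by (simp_all add: kpow_def)

lemma bdd_meas_kpow [bdd_intros]: "bdd_meas P K \<Longrightarrow> bdd_meas P (kpow K n)"
  by (induction n) (auto intro: bdd_intros)

lemma kpow_add: "bdd_meas P K \<Longrightarrow> kpow K (Suc (m + n)) = kcomp (kpow K m) (kpow K n)"
  by (induction m) (simp_all add: kcomp_assoc bdd_intros)

lemma hermitian_kpow:
  assumes K: "hermitian K"
  shows "hermitian (kpow K n)"
proof (induction n)
  case (Suc n)
  note Kb = hermitian_bdd[OF K]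
  have "kpow K (Suc n) (x, y) = cnj (kpow K (Suc n) (y, x))" for x y
  proof -
    have "cnj (kpow K (Suc n) (y, x)) = (\<integral>s. cnj (K (y, s) * kpow K n (s, x)) \<partial>M)"
      unfolding kpow_simps kcomp_def app_def by (simp only: prod.case Bochner_Integration.integral_cnj)
    also have "\<dots> = (\<integral>s. kpow K n (x, s) * K (s, y) \<partial>M)"
      by (simp add: hermitian_cnj[OF K] hermitian_cnj[OF Suc] mult.commute)
    also have "\<dots> = kcomp (kpow K n) (kpow K 0) (x, y)" by (simp add: kcomp_def app_def)
    also have "\<dots> = kpow K (Suc n) (x, y)" using kpow_add[OF Kb, of n 0] by simp
    finally show ?thesis by simp
  qed
  then show ?case unfolding hermitian_def using bdd_meas_kpow[OF Kb] by blast
qed (use K in simp)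

definition ktr :: "('a \<times> 'a \<Rightarrow> complex) \<Rightarrow> nat \<Rightarrow> real" where
  "ktr K n = Re (ip P (kpow K n) K)"

text \<open>Self-adjointness moves one factor at a time from the right argument to the left, so the
  Gram matrix of the powers is a real Hankel matrix.\<close>

lemma ip_kpow:
  assumes K: "hermitian K"
  shows "ip P (kpow K m) (kpow K n) = of_real (ktr K (m + n))"
proof -
  note Kb = hermitian_bdd[OF K]
  have shift: "ip P (kpow K m) (kpow K n) = ip P (kpow K (m + n)) K" for m n
  proof (induction n arbitrary: m)
    case (Suc n)
    have "ip P (kpow K m) (kpow K (Suc n)) = ip P (kpow K (Suc m)) (kpow K n)"
      unfolding kpow_simps by (rule ip_kcomp_hermitian[symmetric]) (use K Kb in \<open>auto intro: bdd_intros\<close>)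
    then show ?case using Suc[of "Suc m"] by simp
  qed simp
  have "cnj (ip P (kpow K (m + n)) K) = ip P (kpow K (m + n)) K"
    using cnj_ip[of P "kpow K (m + n)" K] shift[of 0 "m + n"] by simp
  then have "ip P (kpow K (m + n)) K = of_real (ktr K (m + n))"
    by (simp add: ktr_def complex_eq_iff)
  with shift show ?thesis by simp
qed

lemma sqn_kpow: "hermitian K \<Longrightarrow> sqn P (kpow K n) = ktr K (2 * n)"
  using ip_kpow[of K n n] ip_self[of P "kpow K n"] by (simp add: mult_2)

lemma ktr_nonneg: "hermitian K \<Longrightarrow> ktr K (2 * n) \<ge> 0"
  using sqn_kpow[of K n] by (metis sqn_nonneg)

text \<open>Cauchy-Schwarz for two powers. Indices that differ by two give log-convexity of the even
  traces; \<open>n = 0\<close> controls the odd traces by even ones.\<close>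

lemma ktr_square_le: "hermitian K \<Longrightarrow> (ktr K (m + n))\<^sup>2 \<le> ktr K (2 * m) * ktr K (2 * n)"
  using P.P.Cauchy_Schwarz_ip[of "kpow K m" "kpow K n"]
  by (simp add: ip_kpow sqn_kpow bdd_intros hermitian_bdd)

lemma ktr_submult: "hermitian K \<Longrightarrow> ktr K (2 * Suc (m + n)) \<le> ktr K (2 * m) * ktr K (2 * n)"
  using sqn_kcomp_le[of "kpow K m" "kpow K n"] kpow_add[of K m n] sqn_kpow[of K "Suc (m + n)"]
  by (simp add: sqn_kpow bdd_intros hermitian_bdd del: mult_Suc_right)

end

section \<open>Weakly null sequences of kernels\<close>

context kernel_space
begin

text \<open>The chain |A f|^2 = <A A f, f> = <A A, R>, with \<open>R\<close> the rank-one kernel of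
  f, ends in Cauchy-Schwarz. Thus smallness of tr A^4 makes A small on bounded functions.\<close>

lemma sqn_app_le:
  assumes A: "hermitian A" and f: "bdd_meas M f" "\<And>x. norm (f x) \<le> 1"
  shows "sqn M (app A f) \<le> sqrt (sqn P (kcomp A A))"
proof -
  note Ab = hermitian_bdd[OF A]
  define R where "R = (\<lambda>p. f (fst p) * cnj (f (snd p)))"
  have R: "bdd_meas P R"
    unfolding R_def by (intro bdd_intros bdd_meas_fst[OF f(1)] bdd_meas_snd[OF f(1)])
  have R1: "sqn P R \<le> 1"
  proof -
    have "norm (R p) \<le> 1" for p
      unfolding R_def norm_mult complex_mod_cnj using f(2) by (intro mult_le_one) auto
    then have "(norm (R p))\<^sup>2 \<le> 1" for p by (intro power_le_one) auto
    then show ?thesis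
      unfolding sqn_def by (intro P.P.integral_le_const P.P.sqn_integrable R) auto
  qed
  have "complex_of_real (sqn M (app A f)) = ip M (app A f) (app A f)" by (simp add: ip_self)
  also have "\<dots> = ip M (app A (app A f)) f"
    by (rule ip_app_hermitian[OF A, symmetric]) (auto intro: bdd_intros Ab f)
  also have "\<dots> = ip M (app (kcomp A A) f) f" by (simp add: app_kcomp Ab f)
  also have "\<dots> = ip P (kcomp A A) R"
    unfolding R_def by (simp add: ip_app_rank_one bdd_meas_kcomp Ab f case_prod_unfold)
  finally have "sqn M (app A f) = norm (ip P (kcomp A A) R)"
    by (metis norm_of_real abs_of_nonneg sqn_nonneg)
  also have "\<dots> \<le> sqrt (sqn P (kcomp A A)) * sqrt (sqn P R)"
    by (intro P.P.norm_ip_le bdd_intros Ab R)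
  also have "\<dots> \<le> sqrt (sqn P (kcomp A A)) * 1"
    using R1 by (intro mult_left_mono) auto
  finally show ?thesis by simp
qed

lemma sqn_diff_tendsto_0:
  assumes u: "bdd_meas P u" and v: "\<And>k. bdd_meas P (v k)"
    and lim: "\<And>p. (\<lambda>k. v k p) \<longlonglongrightarrow> u p" and B: "\<And>k p. norm (v k p) \<le> B"
  shows "(\<lambda>k. sqn P (\<lambda>p. u p - v k p)) \<longlonglongrightarrow> 0"
proof -
  have uB: "norm (u p) \<le> B" for p
    by (rule LIMSEQ_le_const2[OF tendsto_norm[OF lim]]) (use B in auto)
  have "(\<lambda>k. \<integral>p. (norm (u p - v k p))\<^sup>2 \<partial>P) \<longlonglongrightarrow> (\<integral>p. 0 \<partial>P)"
  proof (rule integral_dominated_convergence[where w = "\<lambda>_. (B + B)\<^sup>2"])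
    show "(\<lambda>p. (norm (u p - v k p))\<^sup>2) \<in> borel_measurable P" for k
      using P.P.sqn_integrable[OF bdd_meas_diff[OF u v]] by (rule borel_measurable_integrable)
    show "AE p in P. (\<lambda>k. (norm (u p - v k p))\<^sup>2) \<longlonglongrightarrow> 0"
    proof (rule AE_I2)
      fix p
      have "(\<lambda>k. (norm (u p - v k p))\<^sup>2) \<longlonglongrightarrow> (norm (u p - u p))\<^sup>2" by (intro tendsto_intros lim)
      then show "(\<lambda>k. (norm (u p - v k p))\<^sup>2) \<longlonglongrightarrow> 0" by simp
    qed
    show "AE p in P. norm ((norm (u p - v k p))\<^sup>2) \<le> (B + B)\<^sup>2" for k
    proof (rule AE_I2)
      fix p
      have "norm (u p - v k p) \<le> B + B" by (rule order_trans[OF norm_triangle_ineq4 add_mono[OF uB B]])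
      then have "(norm (u p - v k p))\<^sup>2 \<le> (B + B)\<^sup>2" by (rule power_mono) simp
      then show "norm ((norm (u p - v k p))\<^sup>2) \<le> (B + B)\<^sup>2" by simp
    qed
  qed auto
  then show ?thesis by (simp add: sqn_def)
qed

text \<open>Convergence is stated for one test kernel at a time, so that the good test kernels form
  a class to which measure-theoretic induction applies.\<close>

definition weak_null :: "(nat \<Rightarrow> 'a \<times> 'a \<Rightarrow> complex) \<Rightarrow> ('a \<times> 'a \<Rightarrow> complex) \<Rightarrow> bool" where
  "weak_null A u \<longleftrightarrow> (\<lambda>n. ip P (A n) u) \<longlonglongrightarrow> 0"

context
  fixes A :: "nat \<Rightarrow> 'a \<times> 'a \<Rightarrow> complex" and C :: real
  assumes A: "\<And>n. hermitian (A n)" and C: "\<And>n. sqn P (A n) \<le> C"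
    and square_null: "(\<lambda>n. sqn P (kcomp (A n) (A n))) \<longlonglongrightarrow> 0"
begin

lemma weak_null_rectangle:
  assumes X: "X \<in> sets M" and Y: "Y \<in> sets M"
  shows "weak_null A (indicator (X \<times> Y))"
proof -
  note ind = bdd_meas_indicator
  note Ab = hermitian_bdd[OF A]
  \<comment> \<open>The outer square root comes from Cauchy-Schwarz for the pairing on
    \<open>M\<close>, the inner one from \<open>sqn_app_le\<close>.\<close>
  have bound: "norm (ip P (A n) (indicator (X \<times> Y))) \<le> sqrt (sqrt (sqn P (kcomp (A n) (A n))))" for n
  proof -
    have "indicator (X \<times> Y) = (\<lambda>(x, y). indicator X x * cnj (indicator Y y) :: complex)"
      by (auto simp: fun_eq_iff indicator_def)
    then have "ip P (A n) (indicator (X \<times> Y)) = ip M (app (A n) (indicator Y)) (indicator X)"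
      by (simp add: ip_app_rank_one Ab ind X Y)
    then have "norm (ip P (A n) (indicator (X \<times> Y))) \<le> sqrt (sqn M (app (A n) (indicator Y))) * sqrt (sqn M (indicator X))"
      using norm_ip_le[of "app (A n) (indicator Y)" "indicator X"] by (simp add: bdd_intros Ab ind X Y)
    also have "\<dots> \<le> sqrt (sqrt (sqn P (kcomp (A n) (A n)))) * sqrt 1"
    proof (intro mult_mono real_sqrt_le_mono)
      show "sqn M (app (A n) (indicator Y)) \<le> sqrt (sqn P (kcomp (A n) (A n)))"
        by (rule sqn_app_le[OF A ind[OF Y]]) (auto simp: indicator_def)
      show "sqn M (indicator X) \<le> 1"
        unfolding sqn_def
      proof (rule integral_le_const[OF sqn_integrable[OF ind[OF X]]], rule AE_I2)
        show "(norm (indicator X x :: complex))\<^sup>2 \<le> 1" for x by (simp add: indicator_def)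
      qed
    qed simp_all
    finally show ?thesis by simp
  qed
  have "(\<lambda>n. sqrt (sqrt (sqn P (kcomp (A n) (A n))))) \<longlonglongrightarrow> sqrt (sqrt 0)"
    by (intro tendsto_real_sqrt square_null)
  then have "(\<lambda>n. sqrt (sqrt (sqn P (kcomp (A n) (A n))))) \<longlonglongrightarrow> 0" by simp
  from Lim_null_comparison[OF always_eventually[OF allI[OF bound]] this]
  show ?thesis unfolding weak_null_def .
qed

lemma weak_null_limit:
  assumes u: "bdd_meas P u" and v: "\<And>k. bdd_meas P (v k)" "\<And>k. weak_null A (v k)"
    and lim: "(\<lambda>k. sqn P (\<lambda>p. u p - v k p)) \<longlonglongrightarrow> 0"
  shows "weak_null A u"
  unfolding weak_null_def
proof (rule LIMSEQ_I)
  fix e :: real assume e: "e > 0"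
  note Ab = hermitian_bdd[OF A]
  have "(\<lambda>k. sqrt C * sqrt (sqn P (\<lambda>p. u p - v k p))) \<longlonglongrightarrow> sqrt C * sqrt 0"
    by (intro tendsto_intros lim)
  then have "(\<lambda>k. sqrt C * sqrt (sqn P (\<lambda>p. u p - v k p))) \<longlonglongrightarrow> 0" by simp
  from order_tendstoD(2)[OF this, of "e/2"] e obtain k
    where k: "sqrt C * sqrt (sqn P (\<lambda>p. u p - v k p)) < e / 2"
    by (auto simp: eventually_sequentially)
  from LIMSEQ_D[OF v(2)[of k, unfolded weak_null_def], of "e/2"] e
  obtain N where N: "\<And>n. n \<ge> N \<Longrightarrow> norm (ip P (A n) (v k)) < e / 2" by auto
  have "norm (ip P (A n) u) < e" if "n \<ge> N" for n
  proof -
    have "ip P (A n) u = ip P (A n) (v k) + ip P (A n) (\<lambda>p. u p - v k p)"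
      using P.P.ip_diff_right[OF u v(1) Ab] by simp
    moreover have "norm (ip P (A n) (\<lambda>p. u p - v k p)) \<le> sqrt C * sqrt (sqn P (\<lambda>p. u p - v k p))"
      by (rule order_trans[OF P.P.norm_ip_le[OF Ab bdd_meas_diff[OF u v(1)]]])
         (use C in \<open>auto intro!: mult_right_mono\<close>)
    ultimately show ?thesis
      using k N[OF that] norm_triangle_ineq[of "ip P (A n) (v k)" "ip P (A n) (\<lambda>p. u p - v k p)"] by simp
  qed
  then show "\<exists>N. \<forall>n\<ge>N. norm (ip P (A n) u - 0) < e" by auto
qed

lemma weak_null_diff:
  assumes "bdd_meas P u" "bdd_meas P v" "weak_null A u" "weak_null A v"
  shows "weak_null A (\<lambda>p. u p - v p)"
proof -
  have "(\<lambda>n. ip P (A n) u - ip P (A n) v) \<longlonglongrightarrow> 0 - 0"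
    using assms(3,4) unfolding weak_null_def by (rule tendsto_diff)
  then show ?thesis
    unfolding weak_null_def P.P.ip_diff_right[OF assms(1,2) hermitian_bdd[OF A]] by simp
qed

lemma weak_null_sum:
  assumes "\<And>i. i \<in> I \<Longrightarrow> bdd_meas P (u i)" "\<And>i. i \<in> I \<Longrightarrow> weak_null A (u i)"
  shows "weak_null A (\<lambda>p. \<Sum>i\<in>I. c i * u i p)"
proof -
  have "(\<lambda>n. \<Sum>i\<in>I. cnj (c i) * ip P (A n) (u i)) \<longlonglongrightarrow> (\<Sum>i\<in>I. cnj (c i) * 0)"
    using assms(2) unfolding weak_null_def by (intro tendsto_intros)
  then show ?thesis
    unfolding weak_null_def using assms(1)
    by (simp add: P.P.ip_sum_right P.P.ip_cmult_right hermitian_bdd[OF A] bdd_meas_mult bdd_meas_const)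
qed

text \<open>Induction from rectangles over a generated sigma-algebra, in its form for disjoint
  unions: complements are differences of indicators, and countable disjoint unions are limits in
  norm of finite ones.\<close>

lemma weak_null_indicator:
  assumes X: "X \<in> sets P"
  shows "weak_null A (indicator X)"
proof -
  let ?G = "{a \<times> b | a b. a \<in> sets M \<and> b \<in> sets M}"
  have PX: "X \<in> sigma_sets (UNIV \<times> UNIV) ?G" using X by (simp add: sets_pair_measure)
  have setsP: "Y \<in> sigma_sets (UNIV \<times> UNIV) ?G \<Longrightarrow> Y \<in> sets P" for Y
    by (simp add: sets_pair_measure)
  have univ: "weak_null A (indicator (UNIV :: ('a \<times> 'a) set))"
    using weak_null_rectangle[of UNIV UNIV] sets.top[of M] by simp
  have closed: "?G \<subseteq> Pow (UNIV \<times> UNIV)" by auto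
  from Int_stable_pair_measure_generator closed PX show ?thesis
  proof (induct rule: sigma_sets_induct_disjoint)
    case (basic Y)
    then show ?case using weak_null_rectangle by auto
  next
    case empty
    show ?case by (simp add: weak_null_def ip_def indicator_def)
  next
    case (compl Y)
    have "indicator (UNIV \<times> UNIV - Y) = (\<lambda>p. indicator UNIV p - indicator Y p :: complex)"
      by (auto simp: fun_eq_iff indicator_def)
    moreover have "UNIV \<in> sets P" using sets.top[of P] by (simp add: space_pair_measure)
    ultimately show ?case
      using weak_null_diff[OF bdd_meas_indicator bdd_meas_indicator univ compl(2)] setsP[OF compl(1)] by simp
  next
    case (union Y)
    have Ys: "Y i \<in> sets P" for i using union(2) setsP by blast
    let ?v = "\<lambda>k p. indicator (\<Union>i<k. Y i) p :: complex"
    have v: "?v k = (\<lambda>p. \<Sum>i<k. 1 * indicator (Y i) p)" for k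
    proof
      fix p
      have "disjoint_family_on Y {..<k}" using union(1) by (auto simp: disjoint_family_on_def)
      then show "?v k p = (\<Sum>i<k. 1 * indicator (Y i) p)" by (simp add: indicator_UN_disjoint)
    qed
    show ?case
    proof (rule weak_null_limit[where v = ?v])
      show "bdd_meas P (indicator (\<Union>i. Y i))" "\<And>k. bdd_meas P (?v k)"
        using Ys by (auto intro!: bdd_meas_indicator)
      show "weak_null A (?v k)" for k
        unfolding v by (rule weak_null_sum) (use union(3) bdd_meas_indicator[OF Ys] in auto)
      show "(\<lambda>k. sqn P (\<lambda>p. indicator (\<Union>i. Y i) p - ?v k p)) \<longlonglongrightarrow> 0"
        by (rule sqn_diff_tendsto_0[where B = 1])
           (use Ys in \<open>auto intro!: bdd_meas_indicator LIMSEQ_indicator_UN, auto simp: indicator_def\<close>)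
    qed
  qed
qed

text \<open>The class of test functions contains the rectangles, because the squares tend to zero, and is
  closed under bounded limits, because the norms are bounded.\<close>

lemma weak_null_bdd_meas:
  assumes u: "bdd_meas P u"
  shows "weak_null A u"
proof -
  from u obtain B where B: "\<And>p. norm (u p) \<le> B" by (metis bdd_measE)
  from borel_measurable_implies_sequence_metric[of u P 0] u
  obtain F where F: "\<And>i. simple_function P (F i)" "\<And>p. (\<lambda>i. F i p) \<longlonglongrightarrow> u p"
    "\<And>i p. dist (F i p) 0 \<le> 2 * dist (u p) 0"
    by (auto simp: space_pair_measure)
  have FB: "norm (F i p) \<le> 2 * B" for i p
    using F(3)[of i p] B[of p] by simp
  have Fb: "bdd_meas P (F i)" for i
    by (rule bdd_measI[OF borel_measurable_simple_function[OF F(1)] FB])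
  show ?thesis
  proof (rule weak_null_limit[OF u Fb])
    show "(\<lambda>k. sqn P (\<lambda>p. u p - F k p)) \<longlonglongrightarrow> 0"
      by (rule sqn_diff_tendsto_0[OF u Fb F(2) FB])
    fix i
    have "F i = (\<lambda>p. \<Sum>y\<in>F i ` UNIV. y * indicator (F i -` {y}) p)"
    proof
      fix p
      have "F i p = (\<Sum>y\<in>F i ` UNIV. indicator (F i -` {y}) p *\<^sub>R y)"
        using simple_function_indicator_representation_banach[OF F(1)[of i], of p]
        by (simp only: space_pair_measure space_UNIV UNIV_Times_UNIV Int_UNIV_right UNIV_I)
      also have "\<dots> = (\<Sum>y\<in>F i ` UNIV. y * indicator (F i -` {y}) p)"
        by (intro sum.cong refl) (auto simp: indicator_def)
      finally show "F i p = (\<Sum>y\<in>F i ` UNIV. y * indicator (F i -` {y}) p)" .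
    qed
    moreover have "F i -` {y} \<in> sets P" for y
      using simple_functionD(2)[OF F(1)[of i], of "{y}"] by (simp add: space_pair_measure)
    then have "weak_null A (\<lambda>p. \<Sum>y\<in>F i ` UNIV. y * indicator (F i -` {y}) p)"
      by (intro weak_null_sum weak_null_indicator bdd_meas_indicator)
    ultimately show "weak_null A (F i)" by simp
  qed
qed

end

end

section \<open>Existence of eigenfunctions\<close>

text \<open>The model is s n = tr K^(2n+2), with \<open>R\<close> as the largest squared eigenvalue.
  Log-convexity makes the ratios increase, submultiplicativity bounds them by \<open>s 0\<close>,
  and \<open>R\<close> is their limit. As m grows, s (n + 1 + m) / s m tends to R^(n+1) while
  staying below s n, whence the lower bound; the normalised sequence then decreases and stays above
  1.\<close>

lemma log_convex_submult_growth:
  fixes s :: "nat \<Rightarrow> real"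
  assumes pos: "\<And>n. s n > 0"
    and convex: "\<And>n. (s (Suc n))\<^sup>2 \<le> s n * s (Suc (Suc n))"
    and submult: "\<And>m n. s (Suc (m + n)) \<le> s m * s n"
  obtains R where "R > 0" "\<And>n. s (Suc n) \<le> R * s n" "\<And>n. R ^ Suc n \<le> s n"
    "convergent (\<lambda>n. s n / R ^ Suc n)"
proof -
  define r where "r = (\<lambda>n. s (Suc n) / s n)"
  have "incseq r"
  proof (rule incseq_SucI)
    fix n
    show "r n \<le> r (Suc n)"
      using convex[of n] pos[of n] pos[of "Suc n"] by (simp add: r_def field_simps power2_eq_square)
  qed
  moreover have "r n \<le> s 0" for n
    using submult[of 0 n] pos[of n] by (simp add: r_def field_simps)
  ultimately obtain R where R: "r \<longlonglongrightarrow> R" "\<And>n. r n \<le> R"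
    using incseq_convergent[of r "s 0"] by metis
  have Rpos: "R > 0"
    using R(2)[of 0] divide_pos_pos[OF pos[of 1] pos[of 0]] by (simp add: r_def)
  have step: "s (Suc n) \<le> R * s n" for n
    using R(2)[of n] pos[of n] by (simp add: r_def field_simps)
  have lower: "R ^ Suc n \<le> s n" for n
  proof -
    have tele: "(\<Prod>i<k. r (i + m)) = s (k + m) / s m" for k m
      by (induction k) (use pos in \<open>auto simp: r_def less_imp_neq[THEN not_sym]\<close>)
    have "(\<lambda>m. \<Prod>i<Suc n. r (i + m)) \<longlonglongrightarrow> (\<Prod>i<Suc n. R)"
    proof (rule tendsto_prod)
      show "(\<lambda>m. r (i + m)) \<longlonglongrightarrow> R" for i
        using LIMSEQ_ignore_initial_segment[OF R(1), of i] by (simp add: add.commute)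
    qed
    then have lim: "(\<lambda>m. s (Suc n + m) / s m) \<longlonglongrightarrow> R ^ Suc n" unfolding tele by simp
    have "s (Suc n + m) / s m \<le> s n" for m
      using submult[of m n] pos[of m] by (simp add: field_simps add.commute)
    then show ?thesis by (intro LIMSEQ_le_const2[OF lim]) auto
  qed
  have "decseq (\<lambda>n. s n / R ^ Suc n)"
    by (rule decseq_SucI) (use step Rpos in \<open>simp add: field_simps\<close>)
  moreover have "1 \<le> s n / R ^ Suc n" for n using lower[of n] Rpos by simp
  ultimately have "convergent (\<lambda>n. s n / R ^ Suc n)"
    using decseq_convergent[of "\<lambda>n. s n / R ^ Suc n" 1] by (metis convergentI)
  with Rpos step lower that show ?thesis by blast
qed

context kernel_space
begin

lemma app_tendsto:
  assumes K: "bdd_meas P K" and h: "\<And>n. bdd_meas M (h n)" "\<And>n x. norm (h n x) \<le> B"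
    and lim: "\<And>x. (\<lambda>n. h n x) \<longlonglongrightarrow> g x"
  shows "(\<lambda>n. app K (h n) x) \<longlonglongrightarrow> app K g x"
proof -
  obtain A where A: "A \<ge> 0" "\<And>p. norm (K p) \<le> A" using K by (metis bdd_measE)
  have g: "g \<in> borel_measurable M"
    by (rule borel_measurable_LIMSEQ_metric[of h]) (use h lim in auto)
  show ?thesis
    unfolding app_def
  proof (rule integral_dominated_convergence[where w = "\<lambda>_. A * B"])
    show "(\<lambda>s. K (x, s) * g s) \<in> borel_measurable M" "\<And>n. (\<lambda>s. K (x, s) * h n s) \<in> borel_measurable M"
      by (intro borel_measurable_times g bdd_meas_measurable[OF bdd_meas_row[OF K]] bdd_meas_measurable[OF h(1)])+
    show "AE s in M. (\<lambda>n. K (x, s) * h n s) \<longlonglongrightarrow> K (x, s) * g s"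
      by (intro AE_I2 tendsto_intros lim)
    show "AE s in M. norm (K (x, s) * h n s) \<le> A * B" for n
      using A h(2) by (intro AE_I2) (auto simp: norm_mult intro!: mult_mono)
  qed simp
qed

text \<open>Schwarz iteration: the suitably normalised even powers of the kernel converge uniformly, and
  the columns of the limit are eigenfunctions of the square of the operator.\<close>

lemma exists_square_eigenfunction:
  assumes K: "hermitian K" and nz: "ktr K 0 \<noteq> 0"
  obtains R f where "R > 0" "bdd_meas M f" "sqn M f \<noteq> 0" "app K (app K f) = (\<lambda>x. of_real R * f x)"
    "ktr K 2 \<le> R * ktr K 0"
proof -
  note Kb = hermitian_bdd[OF K]
  define s where "s = (\<lambda>n. ktr K (2 * n))"
  have s0: "s n \<ge> 0" for n unfolding s_def by (rule ktr_nonneg[OF K])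
  have convex: "(s (Suc n))\<^sup>2 \<le> s n * s (Suc (Suc n))" for n
    using ktr_square_le[OF K, of n "Suc (Suc n)"] by (simp add: s_def mult_2)
  have submult: "s (Suc (m + n)) \<le> s m * s n" for m n
    using ktr_submult[OF K, of m n] by (simp only: s_def)
  \<comment> \<open>If tr K^4 vanished, the constant sequence K would be weakly null; tested against
    K itself this gives tr K^2 = 0.\<close>
  have "s 1 \<noteq> 0"
  proof
    assume "s 1 = 0"
    then have "sqn P (kcomp K K) = 0" using sqn_kpow[OF K, of 1] by (simp add: s_def)
    then have "weak_null (\<lambda>_. K) K"
      by (intro weak_null_bdd_meas[where C = "sqn P K"]) (use K Kb in auto)
    then have "ip P K K = 0" unfolding weak_null_def by (simp add: LIMSEQ_const_iff)
    with nz show False by (simp add: ktr_def)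
  qed
  then have s1: "s 1 > 0" using s0[of 1] by linarith
  have "s (Suc n) > 0" for n
  proof (induction n)
    case (Suc n)
    then have "0 < (s (Suc n))\<^sup>2" by simp
    then have "0 < s n * s (Suc (Suc n))" using convex[of n] by linarith
    then show ?case using s0[of n] by (simp add: zero_less_mult_iff)
  qed (use s1 in simp)
  moreover have "s 0 > 0" using nz s0[of 0] by (simp add: s_def)
  ultimately have pos: "s n > 0" for n by (cases n) auto
  obtain R where R: "R > 0" "\<And>n. s (Suc n) \<le> R * s n" "\<And>n. R ^ Suc n \<le> s n"
    "convergent (\<lambda>n. s n / R ^ Suc n)"
    using log_convex_submult_growth[OF pos convex submult] by blast
  define c where "c = (\<lambda>n. s n / R ^ Suc n)"
  \<comment> \<open>\<open>g n\<close> is K^(2n+2) / R^(n+1). Its inner product with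
    \<open>g m\<close> depends on n + m only and is \<open>c (n + m + 1)\<close>, so convergence of
    the numbers \<open>c\<close> makes \<open>g\<close> a Cauchy sequence in norm.\<close>
  define g where "g = (\<lambda>n p. kpow K (2 * n + 1) p * of_real (inverse (R ^ Suc n)))"
  have g': "g n = (\<lambda>p. of_real (inverse (R ^ Suc n)) * kpow K (2 * n + 1) p)" for n
    by (simp add: g_def mult.commute)
  have gb: "bdd_meas P (g n)" for n unfolding g_def by (intro bdd_intros Kb)
  have ipg: "ip P (g n) (g m) = of_real (c (n + m + 1))" for n m
  proof -
    have "ip P (g n) (g m) = of_real (inverse (R ^ Suc n)) * (of_real (inverse (R ^ Suc m)) * of_real (ktr K (2 * n + 1 + (2 * m + 1))))"
      unfolding g' P.P.ip_cmult_left P.P.ip_cmult_right complex_cnj_complex_of_real ip_kpow[OF K] ..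
    also have "\<dots> = of_real (inverse (R ^ Suc n) * inverse (R ^ Suc m) * s (n + m + 1))"
      by (simp add: s_def algebra_simps)
    also have "inverse (R ^ Suc n) * inverse (R ^ Suc m) * s (n + m + 1) = c (n + m + 1)"
      using R(1) by (simp add: c_def field_simps power_add)
    finally show ?thesis .
  qed
  have sg: "sqn P (g n) = c (2 * n + 1)" for n
    using ipg[of n n] ip_self[of P "g n"] by (simp add: mult_2)
  have sgd: "sqn P (\<lambda>p. g n p - g m p) = c (2 * n + 1) - 2 * c (n + m + 1) + c (2 * m + 1)" for n m
    by (simp add: P.P.sqn_diff gb ipg sg)
  from R(4) obtain c0 where c0: "c \<longlonglongrightarrow> c0" unfolding c_def convergent_def by blast
  have small: "\<exists>N. \<forall>n\<ge>N. \<forall>m\<ge>N. sqn P (\<lambda>p. g n p - g m p) < e" if "e > 0" for e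
  proof -
    from LIMSEQ_D[OF c0, of "e/4"] that obtain N where N: "\<And>n. n \<ge> N \<Longrightarrow> \<bar>c n - c0\<bar> < e / 4" by auto
    show ?thesis
    proof (intro exI[of _ N] allI impI)
      fix n m assume "n \<ge> N" "m \<ge> N"
      then show "sqn P (\<lambda>p. g n p - g m p) < e"
        unfolding sgd using N[of "2*n+1"] N[of "n+m+1"] N[of "2*m+1"] by (auto simp: abs_if split: if_splits)
    qed
  qed
  obtain B where B: "B \<ge> 0" "\<And>p. norm (K p) \<le> B" using Kb by (metis bdd_measE)
  \<comment> \<open>One more application of K on either side writes every value of
    \<open>g (Suc n)\<close> as a pairing of \<open>g n\<close> with a kernel bounded independently
    of the point. This upgrades Cauchy in norm to uniformly Cauchy.\<close>
  have gSuc: "kcomp K (kcomp K (g n)) = (\<lambda>p. of_real R * g (Suc n) p)"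
    and gSuc': "of_real R * g (Suc n) (x, y) = ip P (g n) (\<lambda>(u, v). cnj (K (x, u)) * cnj (K (v, y)))" for n x y
  proof -
    have col: "kcomp L (\<lambda>p. a * k p) = (\<lambda>p. a * kcomp L k p)" for L a k
      by (auto simp: kcomp_def app_cmult)
    show 1: "kcomp K (kcomp K (g n)) = (\<lambda>p. of_real R * g (Suc n) p)"
      unfolding g' col using R(1) by (simp add: field_simps)
    define e where "e = complex_of_real (inverse (R ^ Suc n))"
    have "of_real R * g (Suc n) (x, y) = e * kpow K (Suc (Suc (2 * n + 1 + 0))) (x, y)"
      unfolding g' e_def using R(1) by (simp add: field_simps del: kpow_simps)
    also have "kpow K (Suc (Suc (2 * n + 1 + 0))) = kcomp K (kcomp (kpow K (2 * n + 1)) K)"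
      using kpow_add[OF Kb, of "2 * n + 1" 0] by (simp only: kpow_simps)
    also have "\<dots> (x, y) = ip M (app (kpow K (2 * n + 1)) (\<lambda>v. K (v, y))) (\<lambda>u. cnj (K (x, u)))"
      unfolding kcomp_def app_def ip_def by (simp add: mult.commute)
    also have "\<dots> = ip P (kpow K (2 * n + 1)) (\<lambda>(u, v). cnj (K (x, u)) * cnj (K (v, y)))"
      by (rule ip_app_rank_one[OF bdd_meas_kpow[OF Kb] bdd_meas_col[OF Kb] bdd_meas_cnj[OF bdd_meas_row[OF Kb]]])
    also have "e * \<dots> = ip P (g n) (\<lambda>(u, v). cnj (K (x, u)) * cnj (K (v, y)))"
      unfolding g' P.P.ip_cmult_left e_def ..
    finally show "of_real R * g (Suc n) (x, y) = ip P (g n) (\<lambda>(u, v). cnj (K (x, u)) * cnj (K (v, y)))" .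
  qed
  have diff: "norm (g (Suc n) p - g (Suc m) p) \<le> B\<^sup>2 / R * sqrt (sqn P (\<lambda>p. g n p - g m p))" for n m p
  proof -
    obtain x y where p: "p = (x, y)" by (cases p)
    define T where "T = (\<lambda>(u, v). cnj (K (x, u)) * cnj (K (v, y)))"
    have T: "bdd_meas P T"
      using bdd_meas_mult[OF bdd_meas_cnj[OF bdd_meas_fst[OF bdd_meas_row[OF Kb, of x]]]
          bdd_meas_cnj[OF bdd_meas_snd[OF bdd_meas_col[OF Kb, of y]]]]
      by (simp add: T_def case_prod_unfold)
    have TB: "sqrt (sqn P T) \<le> B\<^sup>2"
    proof (rule real_le_lsqrt)
      have "(norm (T q))\<^sup>2 \<le> (B\<^sup>2)\<^sup>2" for q
        unfolding T_def case_prod_unfold norm_mult complex_mod_cnj power2_eq_square[of B]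
        using B by (intro power_mono mult_mono) auto
      then show "sqn P T \<le> (B\<^sup>2)\<^sup>2"
        unfolding sqn_def by (intro P.P.integral_le_const P.P.sqn_integrable T AE_I2)
    qed auto
    have "of_real R * (g (Suc n) p - g (Suc m) p) = ip P (\<lambda>p. g n p - g m p) T"
      unfolding right_diff_distrib p gSuc' T_def[symmetric] P.P.ip_diff_left[OF gb gb T] ..
    then have "R * norm (g (Suc n) p - g (Suc m) p) = norm (ip P (\<lambda>p. g n p - g m p) T)"
      using R(1) by (metis abs_of_pos norm_mult norm_of_real)
    also have "\<dots> \<le> sqrt (sqn P (\<lambda>p. g n p - g m p)) * sqrt (sqn P T)"
      by (intro P.P.norm_ip_le bdd_intros gb T)
    also have "\<dots> \<le> sqrt (sqn P (\<lambda>p. g n p - g m p)) * B\<^sup>2"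
      using TB by (intro mult_left_mono) auto
    finally show ?thesis using R(1) by (simp add: field_simps)
  qed
  have unif: "\<exists>N. \<forall>n\<ge>N. \<forall>m\<ge>N. \<forall>p. norm (g n p - g m p) < e" if "e > 0" for e
  proof -
    \<comment> \<open>The estimate \<open>diff\<close> then yields e B^2 / (B^2 + 1); the added 1
      keeps this strictly below e and the quotient defined for B = 0.\<close>
    define d where "d = e * R / (B\<^sup>2 + 1)"
    have B1: "B\<^sup>2 + 1 > 0" using zero_le_power2[of B] by linarith
    have d: "d > 0" using that R(1) B1 by (simp add: d_def)
    then obtain N where N: "\<And>n m. n \<ge> N \<Longrightarrow> m \<ge> N \<Longrightarrow> sqn P (\<lambda>p. g n p - g m p) < d\<^sup>2"
      using small[of "d\<^sup>2"] by auto
    have *: "norm (g (Suc n) p - g (Suc m) p) < e" if "n \<ge> N" "m \<ge> N" for n m p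
    proof -
      have "sqrt (sqn P (\<lambda>p. g n p - g m p)) \<le> d"
        using N[OF that] d by (intro real_le_lsqrt) auto
      then have "norm (g (Suc n) p - g (Suc m) p) \<le> B\<^sup>2 / R * d"
        using R(1) by (intro order_trans[OF diff] mult_left_mono) auto
      also have "\<dots> = e * (B\<^sup>2 / (B\<^sup>2 + 1))" using R(1) by (simp add: d_def)
      also have "\<dots> < e" using \<open>e > 0\<close> B1 by (simp add: field_simps)
      finally show ?thesis .
    qed
    show ?thesis
    proof (intro exI[of _ "Suc N"] allI impI)
      fix n m p assume "n \<ge> Suc N" "m \<ge> Suc N"
      then show "norm (g n p - g m p) < e" using *[of "n - 1" "m - 1" p] by auto
    qed
  qed
  have "Cauchy (\<lambda>n. g n p)" for p
    by (rule CauchyI) (use unif in blast)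
  then have "\<exists>l. (\<lambda>n. g n p) \<longlonglongrightarrow> l" for p
    using Cauchy_convergent convergent_def by metis
  then obtain L where L: "\<And>p. (\<lambda>n. g n p) \<longlonglongrightarrow> L p" by metis
  obtain N where N: "\<And>n m p. n \<ge> N \<Longrightarrow> m \<ge> N \<Longrightarrow> norm (g n p - g m p) < 1" 
  proof -
    have "(0::real) < 1" by simp
    from unif[OF this] that show thesis by blast
  qed
  obtain B' where B': "\<And>p. norm (g N p) \<le> B'" using gb[of N] by (metis bdd_measE)
  have gB: "norm (g (n + N) p) \<le> B' + 1" for n p
    using N[of "n + N" N p] B'[of p] norm_triangle_sub[of "g (n + N) p" "g N p"] by simp
  have L': "(\<lambda>n. g (n + N) p) \<longlonglongrightarrow> L p" for p by (rule LIMSEQ_ignore_initial_segment[OF L])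
  have Lb: "bdd_meas P L"
  proof (rule bdd_measI)
    show "L \<in> borel_measurable P"
      by (rule borel_measurable_LIMSEQ_metric[of g]) (use gb L in auto)
    show "norm (L p) \<le> B' + 1" for p
      by (rule LIMSEQ_le_const2[OF tendsto_norm[OF L']]) (use gB in auto)
  qed
  have eig: "app K (app K (\<lambda>x. L (x, y))) x = of_real R * L (x, y)" for x y
  proof (rule LIMSEQ_unique)
    have *: "app K (app K (\<lambda>x. g n (x, y))) x = of_real R * g (Suc n) (x, y)" for n
      using fun_cong[OF gSuc[of n], of "(x, y)"] by (simp add: kcomp_def)
    show "(\<lambda>n. app K (app K (\<lambda>x. g (n + N) (x, y))) x) \<longlonglongrightarrow> of_real R * L (x, y)"
      unfolding * using LIMSEQ_ignore_initial_segment[OF L[of "(x, y)"], of "Suc N"]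
      by (intro tendsto_mult_left) simp
    show "(\<lambda>n. app K (app K (\<lambda>x. g (n + N) (x, y))) x) \<longlonglongrightarrow> app K (app K (\<lambda>x. L (x, y))) x"
    proof (rule app_tendsto[OF Kb])
      show "norm (app K (\<lambda>x. g (n + N) (x, y)) x) \<le> B * (B' + 1)" for n x
        by (rule norm_app_le[OF Kb bdd_meas_col[OF gb]]) (use B gB in auto)
      show "(\<lambda>n. app K (\<lambda>x. g (n + N) (x, y)) x) \<longlonglongrightarrow> app K (\<lambda>x. L (x, y)) x" for x
        by (rule app_tendsto[OF Kb bdd_meas_col[OF gb] gB L'])
    qed (intro bdd_meas_app Kb bdd_meas_col[OF gb])
  qed
  \<comment> \<open>All \<open>g n\<close> have squared norm at least 1, by the lower bound R^(n+1)
    <= s n, so they cannot tend to zero in norm.\<close>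
  have Lnz: "sqn P L \<noteq> 0"
  proof
    assume L0: "sqn P L = 0"
    have "sqn P (\<lambda>p. L p - g (n + N) p) \<ge> 1" for n
    proof -
      have "ip P L (g (n + N)) = 0" using P.P.ip_zero_AE[OF gb Lb L0, of "n + N"] cnj_ip by (metis complex_cnj_zero)
      then have "sqn P (\<lambda>p. L p - g (n + N) p) = c (2 * (n + N) + 1)"
        by (simp add: P.P.sqn_diff Lb gb L0 sg)
      then show ?thesis using R(3)[of "2 * (n + N) + 1"] R(1) by (simp add: c_def)
    qed
    moreover have "(\<lambda>n. sqn P (\<lambda>p. L p - g (n + N) p)) \<longlonglongrightarrow> 0"
      by (rule sqn_diff_tendsto_0[OF Lb gb L' gB])
    ultimately have "(1::real) \<le> 0" by (intro LIMSEQ_le_const) auto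
    then show False by simp
  qed
  have "\<exists>y. sqn M (\<lambda>x. L (x, y)) \<noteq> 0"
  proof (rule ccontr)
    assume "\<nexists>y. sqn M (\<lambda>x. L (x, y)) \<noteq> 0"
    then have "ip P L L = 0" using ip_columns[OF Lb Lb] by (simp add: ip_self)
    with Lnz show False by (simp add: ip_self)
  qed
  then obtain y where y: "sqn M (\<lambda>x. L (x, y)) \<noteq> 0" by blast
  \<comment> \<open>The growth inequality at n = 0, in other words tr K^4 <= R tr K^2.\<close>
  have "ktr K 2 \<le> R * ktr K 0" using R(2)[of 0] by (simp add: s_def)
  with R(1) y eig bdd_meas_col[OF Lb, of y] that[of R "\<lambda>x. L (x, y)"] show ?thesis by blast
qed

text \<open>Factor K^2 - R as (K - r)(K + r) with r the square root of R: either (K + r) f is an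
  eigenfunction for r, or it vanishes almost everywhere and - r is an eigenvalue.\<close>

lemma exists_eigenfunction:
  assumes K: "hermitian K" and nz: "ktr K 0 \<noteq> 0"
  obtains \<mu> :: real and f where "\<mu> \<noteq> 0" "bdd_meas M f" "sqn M f \<noteq> 0" "app K f = (\<lambda>x. of_real \<mu> * f x)"
    "ktr K 2 \<le> \<mu>\<^sup>2 * ktr K 0"
proof -
  note Kb = hermitian_bdd[OF K]
  obtain R f where R: "R > 0" and f: "bdd_meas M f" "sqn M f \<noteq> 0" "app K (app K f) = (\<lambda>x. of_real R * f x)"
    and le: "ktr K 2 \<le> R * ktr K 0"
    by (rule exists_square_eigenfunction[OF K nz])
  define r where "r = sqrt R"
  have r: "r > 0" "r\<^sup>2 = R" "r * r = R" using R by (auto simp: r_def)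
  define h where "h = (\<lambda>x. app K f x + of_real r * f x)"
  have h: "bdd_meas M h" unfolding h_def by (intro bdd_intros Kb f)
  have Kh: "app K h = (\<lambda>x. of_real r * h x)"
  proof -
    have "app K h = (\<lambda>x. app K (app K f) x + app K (\<lambda>x. of_real r * f x) x)"
      unfolding h_def by (rule app_add) (intro bdd_intros Kb f)+
    also have "\<dots> = (\<lambda>x. of_real (r * r) * f x + of_real r * app K f x)"
      unfolding f(3) app_cmult r(3) ..
    finally show ?thesis by (auto simp: h_def algebra_simps)
  qed
  show ?thesis
  proof (cases "sqn M h = 0")
    case False
    with Kh h r le that[of r h] show ?thesis by simp
  next
    case True
    \<comment> \<open>Taking \<open>K f\<close> in place of \<open>f\<close> turns an equation valid
      almost everywhere into one valid everywhere, since \<open>app\<close> ignores null sets of its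
      argument.\<close>
    define k where "k = app K f"
    have k: "bdd_meas M k" unfolding k_def by (intro bdd_intros Kb f)
    from True have "AE x in M. k x = of_real (- r) * f x"
      using sqn_eq_0_iff[OF h] by (auto simp: h_def k_def add_eq_0_iff)
    then have "app K k = app K (\<lambda>x. of_real (- r) * f x)"
      by (intro app_cong_AE Kb k bdd_intros f)
    then have Kk: "app K k = (\<lambda>x. of_real (- r) * k x)"
      unfolding app_cmult k_def .
    have "sqn M k \<noteq> 0"
    proof
      assume "sqn M k = 0"
      then have "AE x in M. k x = 0" using sqn_eq_0_iff[OF k] by simp
      then have "app K k = app K (\<lambda>x. 0)" by (intro app_cong_AE Kb k bdd_intros)
      then have "f = (\<lambda>x. 0)" using f(3) R by (auto simp: k_def app_def fun_eq_iff)
      with f(2) show False by (simp add: sqn_def)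
    qed
    with Kk k r le that[of "- r" k] show ?thesis by simp
  qed
qed

end

section \<open>Deflation and trace formulas\<close>

context kernel_space
begin

definition eig :: "('a \<times> 'a \<Rightarrow> complex) \<Rightarrow> complex \<Rightarrow> ('a \<Rightarrow> complex) \<Rightarrow> bool" where
  "eig K \<mu> f \<longleftrightarrow> bdd_meas M f \<and> app K f = (\<lambda>x. \<mu> * f x)"

lemma eig_real:
  assumes K: "hermitian K" and f: "eig K \<mu> f" and nz: "sqn M f \<noteq> 0"
  shows "\<mu> \<in> \<real>"
proof -
  have b: "bdd_meas M f" and e: "app K f = (\<lambda>x. \<mu> * f x)" using f by (auto simp: eig_def)
  have "ip M (\<lambda>x. \<mu> * f x) f = ip M f (\<lambda>x. \<mu> * f x)"
    using ip_app_hermitian[OF K b b] unfolding e .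
  then have "\<mu> = cnj \<mu>" using nz by (simp add: ip_cmult_left ip_cmult_right ip_self)
  then show ?thesis by (metis Reals_cnj_iff)
qed

lemma eig_orthogonal:
  assumes K: "hermitian K" and f: "eig K (of_real \<mu>) f" and g: "eig K (of_real \<nu>) g" and ne: "\<mu> \<noteq> \<nu>"
  shows "ip M f g = 0"
proof -
  have "ip M (\<lambda>x. of_real \<mu> * f x) g = ip M f (\<lambda>x. of_real \<nu> * g x)"
    using ip_app_hermitian[OF K, of f g] f g by (auto simp: eig_def)
  then show ?thesis using ne by (simp add: ip_cmult_left ip_cmult_right)
qed

definition on_family :: "('a \<times> 'a \<Rightarrow> complex) \<Rightarrow> nat \<Rightarrow> (nat \<Rightarrow> real) \<Rightarrow> (nat \<Rightarrow> 'a \<Rightarrow> complex) \<Rightarrow> bool" where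
  "on_family K n l e \<longleftrightarrow> (\<forall>j<n. eig K (of_real (l j)) (e j)) \<and>
     (\<forall>i<n. \<forall>j<n. ip M (e i) (e j) = (if i = j then 1 else 0))"

definition rank_one :: "('a \<Rightarrow> complex) \<Rightarrow> 'a \<times> 'a \<Rightarrow> complex" where
  "rank_one f = (\<lambda>(x, y). f x * cnj (f y))"

definition deflate :: "('a \<times> 'a \<Rightarrow> complex) \<Rightarrow> nat \<Rightarrow> (nat \<Rightarrow> real) \<Rightarrow> (nat \<Rightarrow> 'a \<Rightarrow> complex) \<Rightarrow> 'a \<times> 'a \<Rightarrow> complex" where
  "deflate K n l e = (\<lambda>p. K p - (\<Sum>j<n. of_real (l j) * rank_one (e j) p))"

lemma bdd_meas_rank_one [bdd_intros]: "bdd_meas M f \<Longrightarrow> bdd_meas P (rank_one f)"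
  using bdd_meas_mult[OF bdd_meas_fst bdd_meas_cnj[OF bdd_meas_snd], of f f]
  by (simp add: rank_one_def case_prod_unfold)

lemma ip_rank_one: "bdd_meas P K \<Longrightarrow> bdd_meas M f \<Longrightarrow> ip P K (rank_one f) = ip M (app K f) f"
  unfolding rank_one_def by (rule ip_app_rank_one[symmetric])

context
  fixes K :: "'a \<times> 'a \<Rightarrow> complex" and n :: nat and l :: "nat \<Rightarrow> real" and e :: "nat \<Rightarrow> 'a \<Rightarrow> complex"
  assumes K: "hermitian K" and fam: "on_family K n l e"
begin

private abbreviation "D \<equiv> deflate K n l e"

private lemma Kb: "bdd_meas P K" by (rule hermitian_bdd[OF K])

private lemma eb: "j < n \<Longrightarrow> bdd_meas M (e j)"
  and Ke: "j < n \<Longrightarrow> app K (e j) = (\<lambda>x. of_real (l j) * e j x)"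
  and on: "i < n \<Longrightarrow> j < n \<Longrightarrow> ip M (e i) (e j) = (if i = j then 1 else 0)"
  using fam by (auto simp: on_family_def eig_def)

private lemma rb: "j < n \<Longrightarrow> bdd_meas P (rank_one (e j))"
  by (intro bdd_intros eb)

lemma hermitian_deflate: "hermitian D"
  unfolding hermitian_def
proof (intro conjI allI)
  show "bdd_meas P D" unfolding deflate_def
    by (intro bdd_meas_diff bdd_meas_sum bdd_meas_mult bdd_meas_const Kb rb) simp
  fix x y
  show "D (x, y) = cnj (D (y, x))"
    by (simp add: deflate_def rank_one_def hermitian_cnj[OF K] mult_ac)
qed

private lemma Db: "bdd_meas P D" by (rule hermitian_bdd[OF hermitian_deflate])

lemma app_deflate:
  assumes f: "bdd_meas M f"
  shows "app D f = (\<lambda>x. app K f x - (\<Sum>j<n. of_real (l j) * (ip M f (e j) * e j x)))"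
proof
  fix x
  have int: "integrable M (\<lambda>s. of_real (l j) * (e j x * (f s * cnj (e j s))))" if "j < n" for j
    using ip_integrable[OF f eb[OF that]] by simp
  have "app D f x = (\<integral>s. K (x, s) * f s - (\<Sum>j<n. of_real (l j) * (e j x * (f s * cnj (e j s)))) \<partial>M)"
    unfolding app_def deflate_def rank_one_def
      prod.case left_diff_distrib sum_distrib_right by (simp only: mult_ac)
  also have "\<dots> = app K f x - (\<integral>s. (\<Sum>j<n. of_real (l j) * (e j x * (f s * cnj (e j s)))) \<partial>M)"
    unfolding app_def
    by (rule Bochner_Integration.integral_diff[OF bdd_meas_integrable[OF bdd_meas_mult[OF bdd_meas_row[OF Kb] f]]
          Bochner_Integration.integrable_sum[OF int]]) simp
  also have "(\<integral>s. (\<Sum>j<n. of_real (l j) * (e j x * (f s * cnj (e j s)))) \<partial>M) =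
      (\<Sum>j<n. \<integral>s. of_real (l j) * (e j x * (f s * cnj (e j s))) \<partial>M)"
    by (intro Bochner_Integration.integral_sum int) simp
  also have "\<dots> = (\<Sum>j<n. of_real (l j) * (ip M f (e j) * e j x))"
    by (simp add: ip_def mult.commute)
  finally show "app D f x = app K f x - (\<Sum>j<n. of_real (l j) * (ip M f (e j) * e j x))" .
qed

lemma app_deflate_self: "i < n \<Longrightarrow> app D (e i) = (\<lambda>x. 0)"
proof
  fix x assume i: "i < n"
  have "(\<Sum>j<n. of_real (l j) * (ip M (e i) (e j) * e j x)) = (\<Sum>j<n. if j = i then of_real (l j) * e j x else 0)"
    by (intro sum.cong refl) (use on[OF i] in auto)
  then show "app D (e i) x = 0"
    using i by (simp add: app_deflate[OF eb[OF i]] Ke[OF i])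
qed

private lemma app_kpow_e: "j < n \<Longrightarrow> app (kpow K m) (e j) = (\<lambda>x. of_real (l j ^ Suc m) * e j x)"
proof (induction m)
  case (Suc m)
  then show ?case
    unfolding kpow_simps app_kcomp[OF Kb bdd_meas_kpow[OF Kb] eb[OF Suc.prems]] Suc.IH[OF Suc.prems]
      app_cmult Ke[OF Suc.prems] by (simp add: mult_ac)
qed (simp add: Ke)

private lemma app_kpow_deflate: "j < n \<Longrightarrow> app (kpow D m) (e j) = (\<lambda>x. 0)"
proof (induction m)
  case (Suc m)
  then show ?case
    by (simp add: app_kcomp Db bdd_meas_kpow eb) (simp add: app_def)
qed (simp add: app_deflate_self)

text \<open>No cross terms arise: \<open>D\<close> annihilates every \<open>e j\<close>, and the
  pairing of a column of a power of K with \<open>e j\<close> is an eigenvalue power times the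
  conjugate of \<open>e j\<close>.\<close>

private lemma kpow_deflate:
  "kpow D m = (\<lambda>p. kpow K m p - (\<Sum>j<n. of_real (l j ^ Suc m) * rank_one (e j) p))"
proof (induction m)
  case 0
  show ?case by (simp add: deflate_def)
next
  case (Suc m)
  have "kpow D (Suc m) (x, y) = kpow K (Suc m) (x, y) - (\<Sum>j<n. of_real (l j ^ Suc (Suc m)) * rank_one (e j) (x, y))" for x y
  proof -
    let ?u = "\<lambda>s. kpow K m (s, y)"
    let ?w = "\<lambda>j s. of_real (l j ^ Suc m) * cnj (e j y) * e j s"
    have ub: "bdd_meas M ?u" by (rule bdd_meas_col[OF bdd_meas_kpow[OF Kb]])
    have wb: "bdd_meas M (?w j)" if "j < n" for j by (intro bdd_intros eb that)
    have "kpow D (Suc m) (x, y) = app D (\<lambda>s. ?u s - (\<Sum>j<n. ?w j s)) x"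
      unfolding kpow_simps kcomp_def prod.case Suc.IH by (simp add: rank_one_def mult_ac)
    also have "\<dots> = app D ?u x - (\<Sum>j<n. app D (?w j) x)"
      using app_diff[OF Db ub bdd_meas_sum[of "{..<n}" M ?w]] app_sum[OF Db, of "{..<n}" ?w] wb by simp
    also have "(\<Sum>j<n. app D (?w j) x) = 0"
      unfolding app_cmult by (intro sum.neutral ballI) (simp add: app_deflate_self)
    also have "app D ?u x = app K ?u x - (\<Sum>j<n. of_real (l j) * (ip M ?u (e j) * e j x))"
      using fun_cong[OF app_deflate[OF ub], of x] .
    also have "(\<Sum>j<n. of_real (l j) * (ip M ?u (e j) * e j x)) =
        (\<Sum>j<n. of_real (l j ^ Suc (Suc m)) * rank_one (e j) (x, y))"
    proof (intro sum.cong refl)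
      fix j assume "j \<in> {..<n}"
      then have j: "j < n" by simp
      have "ip M ?u (e j) = cnj (app (kpow K m) (e j) y)"
        unfolding ip_def app_def
        by (subst Bochner_Integration.integral_cnj[symmetric]) (simp add: hermitian_cnj[OF hermitian_kpow[OF K]])
      also have "\<dots> = of_real (l j ^ Suc m) * cnj (e j y)"
        unfolding app_kpow_e[OF j] by simp
      finally show "of_real (l j) * (ip M ?u (e j) * e j x) = of_real (l j ^ Suc (Suc m)) * rank_one (e j) (x, y)"
        by (simp add: rank_one_def mult_ac)
    qed
    finally show ?thesis by (simp add: kcomp_def)
  qed
  then show ?case by (auto simp: fun_eq_iff simp del: kpow_simps power_Suc)
qed

private lemma ip_kpow_deflate: "ip P (kpow D m) D = ip P (kpow D m) K"
proof -
  have bp: "bdd_meas P (kpow D m)" by (intro bdd_intros Db)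
  have "ip P (kpow D m) D = ip P (kpow D m) K - (\<Sum>j<n. of_real (l j) * ip P (kpow D m) (rank_one (e j)))"
    unfolding deflate_def[of K n l e]
    by (subst P.P.ip_diff_right, intro Kb, intro bdd_meas_sum bdd_meas_mult bdd_meas_const rb, simp,
        fold deflate_def[of K n l e], rule bp, subst P.P.ip_sum_right,
        intro bdd_meas_mult bdd_meas_const rb, simp, rule bp, simp add: P.P.ip_cmult_right)
  also have "(\<Sum>j<n. of_real (l j) * ip P (kpow D m) (rank_one (e j))) = 0"
    by (intro sum.neutral ballI) (simp add: ip_rank_one bp eb app_kpow_deflate, simp add: ip_def)
  finally show ?thesis by simp
qed

lemma ktr_deflate: "ktr D m = ktr K m - (\<Sum>j<n. l j ^ (m + 2))"
proof -
  have ipr: "ip P (rank_one (e j)) K = of_real (l j)" if j: "j < n" for j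
  proof -
    have "ip P K (rank_one (e j)) = of_real (l j)"
      using on[OF j j] by (simp add: ip_rank_one Kb eb j Ke ip_cmult_left)
    then show ?thesis using cnj_ip[of P K "rank_one (e j)"] by simp
  qed
  have bp: "bdd_meas P (kpow K m)" by (intro bdd_intros Kb)
  have "ip P (kpow D m) K = ip P (kpow K m) K - (\<Sum>j<n. of_real (l j ^ Suc m) * ip P (rank_one (e j)) K)"
    unfolding kpow_deflate
    by (subst P.P.ip_diff_left, rule bp, intro bdd_meas_sum bdd_meas_mult bdd_meas_const rb, simp, rule Kb,
        subst P.P.ip_sum_left, intro bdd_meas_mult bdd_meas_const rb, simp, rule Kb, simp add: P.P.ip_cmult_left)
  also have "(\<Sum>j<n. of_real (l j ^ Suc m) * ip P (rank_one (e j)) K) = of_real (\<Sum>j<n. l j ^ (m + 2))"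
    by (simp add: ipr mult_ac)
  finally show ?thesis unfolding ktr_def ip_kpow_deflate by simp
qed

text \<open>\<open>D\<close> is orthogonal to the rank-one kernels that were subtracted, so its
  pairing with K is its own squared norm. Through this identity weak convergence becomes convergence
  in norm.\<close>

lemma ip_deflate: "ip P D K = of_real (ktr D 0)"
  using ip_kpow_deflate[of 0] ip_kpow[OF hermitian_deflate, of 0 0] by simp

text \<open>The difference of the two sides is the squared norm of the deflated kernel.\<close>

lemma Bessel: "(\<Sum>j<n. (l j)\<^sup>2) \<le> ktr K 0"
  using ktr_nonneg[OF hermitian_deflate, of 0] ktr_deflate[of 0] by (simp add: numeral_2_eq_2)

text \<open>Since \<open>D\<close> kills every \<open>e j\<close>, self-adjointness makes f
  orthogonal to all of them when \<mu> is nonzero, and on such f the operators of \<open>D\<close>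
  and K agree.\<close>

lemma eig_deflate:
  assumes f: "eig D \<mu> f" and \<mu>: "\<mu> \<noteq> 0"
  shows "eig K \<mu> f" and "j < n \<Longrightarrow> ip M f (e j) = 0"
proof -
  have fb: "bdd_meas M f" and Df: "app D f = (\<lambda>x. \<mu> * f x)" using f by (auto simp: eig_def)
  show orth: "ip M f (e j) = 0" if j: "j < n" for j
  proof -
    have "\<mu> * ip M f (e j) = ip M (app D f) (e j)" by (simp add: Df ip_cmult_left)
    also have "\<dots> = ip M f (app D (e j))" by (rule ip_app_hermitian[OF hermitian_deflate fb eb[OF j]])
    also have "\<dots> = 0" by (simp add: app_deflate_self[OF j] ip_def)
    finally show ?thesis using \<mu> by simp
  qed
  have "app D f = app K f" by (simp add: app_deflate[OF fb] orth)
  with Df fb show "eig K \<mu> f" by (simp add: eig_def)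
qed

end

text \<open>By Bessel's inequality such a family exists, and deflating by it leaves only eigenvalues of
  modulus at most \<open>\<epsilon>\<close>.\<close>

definition max_family :: "('a \<times> 'a \<Rightarrow> complex) \<Rightarrow> real \<Rightarrow> nat \<Rightarrow> (nat \<Rightarrow> real) \<Rightarrow> (nat \<Rightarrow> 'a \<Rightarrow> complex) \<Rightarrow> bool" where
  "max_family K \<epsilon> n l e \<longleftrightarrow> on_family K n l e \<and> (\<forall>j<n. \<bar>l j\<bar> > \<epsilon>) \<and>
     (\<forall>\<mu> f. \<bar>\<mu>\<bar> > \<epsilon> \<and> eig K (of_real \<mu>) f \<and> (\<forall>j<n. ip M f (e j) = 0) \<longrightarrow> sqn M f = 0)"

lemma exists_max_family:
  assumes K: "hermitian K" and \<epsilon>: "\<epsilon> > 0"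
  shows "\<exists>n l e. max_family K \<epsilon> n l e"
proof -
  define Q where "Q = (\<lambda>n. \<exists>l e. on_family K n l e \<and> (\<forall>j<n. \<bar>l j\<bar> > \<epsilon>))"
  have "Q 0" by (auto simp: Q_def on_family_def)
  have bound: "real n * \<epsilon>\<^sup>2 \<le> ktr K 0" if "Q n" for n
  proof -
    from that obtain l e where le: "on_family K n l e" "\<forall>j<n. \<bar>l j\<bar> > \<epsilon>" by (auto simp: Q_def)
    have "real n * \<epsilon>\<^sup>2 = (\<Sum>j<n. \<epsilon>\<^sup>2)" by simp
    also have "\<dots> \<le> (\<Sum>j<n. (l j)\<^sup>2)"
      using le(2) \<epsilon> by (intro sum_mono) (simp add: abs_le_square_iff[symmetric] less_imp_le)
    finally show ?thesis using Bessel[OF K le(1)] by linarith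
  qed
  have "n \<le> nat \<lfloor>ktr K 0 / \<epsilon>\<^sup>2\<rfloor>" if "Q n" for n
  proof -
    have "real n \<le> ktr K 0 / \<epsilon>\<^sup>2" using bound[OF that] \<epsilon> by (simp add: field_simps)
    then show ?thesis by (simp add: le_nat_floor)
  qed
  \<comment> \<open>Take a family of greatest size. An eigenfunction orthogonal to it, once
    normalised, would extend it.\<close>
  then obtain n where n: "Q n" "\<And>m. Q m \<Longrightarrow> m \<le> n"
    using GreatestI_nat[of Q 0] Greatest_le_nat[of Q] \<open>Q 0\<close> by metis
  from n(1) obtain l e where le: "on_family K n l e" "\<forall>j<n. \<bar>l j\<bar> > \<epsilon>" by (auto simp: Q_def)
  have "sqn M f = 0" if \<mu>: "\<bar>\<mu>\<bar> > \<epsilon>" and f: "eig K (of_real \<mu>) f" and orth: "\<forall>j<n. ip M f (e j) = 0" for \<mu> f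
  proof (rule ccontr)
    assume nz: "sqn M f \<noteq> 0"
    then have pos: "sqn M f > 0" using sqn_nonneg[of M f] by linarith
    define c where "c = complex_of_real (inverse (sqrt (sqn M f)))"
    define h where "h = (\<lambda>x. c * f x)"
    have hb: "eig K (of_real \<mu>) h"
      using f unfolding eig_def h_def by (auto simp: app_cmult mult_ac intro!: bdd_intros)
    have "ip M h h = c * cnj c * of_real (sqn M f)"
      unfolding h_def ip_cmult_left ip_cmult_right by (simp add: ip_self)
    also have "\<dots> = of_real (inverse (sqrt (sqn M f)) * inverse (sqrt (sqn M f)) * sqn M f)"
      by (simp add: c_def)
    also have "inverse (sqrt (sqn M f)) * inverse (sqrt (sqn M f)) * sqn M f = 1"
      using pos by (simp add: field_simps)
    finally have hh: "ip M h h = 1" by simp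
    have he: "ip M h (e j) = 0" "ip M (e j) h = 0" if "j < n" for j
    proof -
      show *: "ip M h (e j) = 0" using orth that by (simp add: h_def ip_cmult_left)
      show "ip M (e j) h = 0" using cnj_ip[of M h "e j"] * by simp
    qed
    have "on_family K (Suc n) (l(n := \<mu>)) (e(n := h))"
      using le(1) hb hh he unfolding on_family_def by (auto simp: less_Suc_eq)
    moreover have "\<forall>j<Suc n. \<bar>(l(n := \<mu>)) j\<bar> > \<epsilon>" using le(2) \<mu> by (auto simp: less_Suc_eq)
    ultimately have "Q (Suc n)" unfolding Q_def by blast
    with n(2) show False by force
  qed
  with le show ?thesis unfolding max_family_def by blast
qed

text \<open>The deflated kernel D has some eigenvalue \<mu> with tr D^4 <= \<mu>^2 tr D^2, and
  maximality forces |\<mu>| <= \<epsilon>. If tr D^2 = 0 there is no eigenfunction to use, but then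
  tr D^4 = 0 by submultiplicativity.\<close>

lemma ktr_deflate_max_family:
  assumes K: "hermitian K" and fam: "max_family K \<epsilon> n l e" and \<epsilon>: "\<epsilon> > 0"
  shows "ktr (deflate K n l e) 2 \<le> \<epsilon>\<^sup>2 * ktr K 0"
proof -
  have on: "on_family K n l e" using fam by (simp add: max_family_def)
  let ?D = "deflate K n l e"
  note D = hermitian_deflate[OF K on]
  have D0: "0 \<le> ktr ?D 0" "ktr ?D 0 \<le> ktr K 0"
    using ktr_nonneg[OF D, of 0] ktr_deflate[OF K on, of 0] by (auto intro: sum_nonneg)
  show ?thesis
  proof (cases "ktr ?D 0 = 0")
    case True
    then have "ktr ?D 2 \<le> 0" using ktr_submult[OF D, of 0 0] by simp
    moreover have "0 \<le> \<epsilon>\<^sup>2 * ktr K 0" using D0 by (intro mult_nonneg_nonneg) auto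
    ultimately show ?thesis by linarith
  next
    case False
    then obtain \<mu> f where f: "\<mu> \<noteq> 0" "bdd_meas M f" "sqn M f \<noteq> 0" "app ?D f = (\<lambda>x. of_real \<mu> * f x)"
      and le: "ktr ?D 2 \<le> \<mu>\<^sup>2 * ktr ?D 0"
      by (rule exists_eigenfunction[OF D])
    have ef: "eig ?D (of_real \<mu>) f" using f by (simp add: eig_def)
    have "eig K (of_real \<mu>) f" "\<forall>j<n. ip M f (e j) = 0"
      using eig_deflate[OF K on ef] f(1) by auto
    then have "\<bar>\<mu>\<bar> \<le> \<epsilon>" using fam f(3) unfolding max_family_def by (meson not_le)
    then have "\<mu>\<^sup>2 \<le> \<epsilon>\<^sup>2" using \<epsilon> by (simp add: abs_le_square_iff[symmetric])
    then have "\<mu>\<^sup>2 * ktr ?D 0 \<le> \<epsilon>\<^sup>2 * ktr K 0" using D0 by (intro mult_mono) auto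
    with le show ?thesis by linarith
  qed
qed

text \<open>By \<open>ktr_deflate\<close> the error is a trace of the remainder. The squared norm is
  the delicate case \<open>m = 0\<close>, settled by weak convergence and \<open>ip_deflate\<close>;
  the higher traces are dominated by it.\<close>

lemma ktr_power_sums:
  assumes K: "hermitian K" and fam: "\<And>N. max_family K (inverse (real (Suc N))) (n N) (l N) (e N)"
  shows "(\<lambda>N. \<Sum>j<n N. (l N j) ^ (m + 2)) \<longlonglongrightarrow> ktr K m"
proof -
  define D where "D = (\<lambda>N. deflate K (n N) (l N) (e N))"
  have on: "on_family K (n N) (l N) (e N)" for N using fam by (simp add: max_family_def)
  have D: "hermitian (D N)" for N unfolding D_def by (rule hermitian_deflate[OF K on])
  have D2: "ktr (D N) 2 \<le> (inverse (real (Suc N)))\<^sup>2 * ktr K 0" for N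
    unfolding D_def by (rule ktr_deflate_max_family[OF K fam]) simp
  have "(\<lambda>N. (inverse (real (Suc N)))\<^sup>2 * ktr K 0) \<longlonglongrightarrow> 0\<^sup>2 * ktr K 0"
    by (intro tendsto_intros LIMSEQ_inverse_real_of_nat)
  then have "(\<lambda>N. (inverse (real (Suc N)))\<^sup>2 * ktr K 0) \<longlonglongrightarrow> 0" by simp
  from tendsto_sandwich[OF _ _ tendsto_const this, of "\<lambda>N. ktr (D N) 2"]
  have lim2: "(\<lambda>N. ktr (D N) 2) \<longlonglongrightarrow> 0"
    using D2 ktr_nonneg[OF D, of _ 1] by simp
  have D0: "0 \<le> ktr (D N) 0" "ktr (D N) 0 \<le> ktr K 0" for N
    using ktr_nonneg[OF D, of N 0] ktr_deflate[OF K on, of N 0] by (auto simp: D_def intro: sum_nonneg)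
  have "weak_null D K"
  proof (rule weak_null_bdd_meas[where C = "ktr K 0"])
    show "sqn P (D N) \<le> ktr K 0" for N using sqn_kpow[OF D, of N 0] D0(2)[of N] by simp
    show "(\<lambda>N. sqn P (kcomp (D N) (D N))) \<longlonglongrightarrow> 0"
      using lim2 sqn_kpow[OF D, of _ 1] by simp
  qed (use D hermitian_bdd[OF K] in auto)
  then have "(\<lambda>N. complex_of_real (ktr (D N) 0)) \<longlonglongrightarrow> of_real 0"
    unfolding weak_null_def D_def ip_deflate[OF K on] by simp
  then have lim0: "(\<lambda>N. ktr (D N) 0) \<longlonglongrightarrow> 0" by (simp only: tendsto_of_real_iff)
  have pw: "ktr (D N) (2 * k) \<le> ktr (D N) 0 ^ Suc k" for N k
  proof (induction k)
    case (Suc k)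
    have "ktr (D N) (2 * Suc k) \<le> ktr (D N) 0 * ktr (D N) (2 * k)"
      using ktr_submult[OF D, of N 0 k] by simp
    also have "\<dots> \<le> ktr (D N) 0 * ktr (D N) 0 ^ Suc k"
      by (intro mult_left_mono Suc D0)
    finally show ?case by simp
  qed simp
  \<comment> \<open>The square is estimated because m may be odd, and then the trace has no definite
    sign.\<close>
  have sq: "(ktr (D N) m)\<^sup>2 \<le> ktr (D N) 0 ^ Suc m * ktr (D N) 0" for N
    using ktr_square_le[OF D, of N m 0] mult_right_mono[OF pw[of N m] D0(1)[of N]] by simp
  have "(\<lambda>N. ktr (D N) 0 ^ Suc m * ktr (D N) 0) \<longlonglongrightarrow> 0 ^ Suc m * 0"
    by (intro tendsto_intros lim0)
  then have "(\<lambda>N. ktr (D N) 0 ^ Suc m * ktr (D N) 0) \<longlonglongrightarrow> 0" by simp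
  from tendsto_sandwich[OF _ _ tendsto_const this, of "\<lambda>N. (ktr (D N) m)\<^sup>2"]
  have "(\<lambda>N. (ktr (D N) m)\<^sup>2) \<longlonglongrightarrow> 0"
    using sq by simp
  then have "(\<lambda>N. ktr (D N) m) \<longlonglongrightarrow> 0" by (simp add: power_tendsto_0_iff)
  then have "(\<lambda>N. ktr K m - ktr (D N) m) \<longlonglongrightarrow> ktr K m - 0" by (intro tendsto_intros)
  then show ?thesis unfolding D_def ktr_deflate[OF K on] by simp
qed

end

section \<open>Dimensions of eigenspaces\<close>

text \<open>Gaussian elimination on the last equation: the unknown \<open>i0\<close> with nonzero
  coefficient is eliminated and restored at the end.\<close>

lemma underdetermined_system:
  fixes a :: "nat \<Rightarrow> 'i \<Rightarrow> 'f :: field"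
  assumes "finite I" "n < card I"
  shows "\<exists>c. (\<exists>i\<in>I. c i \<noteq> 0) \<and> (\<forall>k<n. (\<Sum>i\<in>I. a k i * c i) = 0)"
  using assms
proof (induction n arbitrary: I a)
  case 0
  then have "I \<noteq> {}" by auto
  then show ?case by (intro exI[of _ "\<lambda>_. 1"]) auto
next
  case (Suc n)
  show ?case
  proof (cases "\<forall>i\<in>I. a n i = 0")
    case True
    with Suc.IH[of I a] Suc.prems show ?thesis by (auto simp: less_Suc_eq)
  next
    case False
    then obtain i0 where i0: "i0 \<in> I" "a n i0 \<noteq> 0" by blast
    define J where "J = I - {i0}"
    have J: "finite J" "n < card J" "I = insert i0 J" "i0 \<notin> J"
      using Suc.prems i0 by (auto simp: J_def)
    from Suc.IH[OF J(1,2), of "\<lambda>k i. a k i - a k i0 * a n i / a n i0"]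
    obtain c where c: "\<exists>i\<in>J. c i \<noteq> 0" "\<forall>k<n. (\<Sum>i\<in>J. (a k i - a k i0 * a n i / a n i0) * c i) = 0"
      by blast
    define S where "S = (\<Sum>i\<in>J. a n i * c i)"
    define d where "d = c(i0 := - S / a n i0)"
    have sum: "(\<Sum>i\<in>I. a k i * d i) = (\<Sum>i\<in>J. a k i * c i) - a k i0 * S / a n i0" for k
    proof -
      have "(\<Sum>i\<in>J. a k i * d i) = (\<Sum>i\<in>J. a k i * c i)"
        by (intro sum.cong refl) (use J(4) in \<open>auto simp: d_def\<close>)
      then show ?thesis using J by (simp add: d_def)
    qed
    have "(\<Sum>i\<in>I. a k i * d i) = 0" if "k < Suc n" for k
    proof (cases "k = n")
      case True
      then show ?thesis using i0 unfolding sum by (simp add: S_def)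
    next
      case False
      with that c(2) have "(\<Sum>i\<in>J. (a k i - a k i0 * a n i / a n i0) * c i) = 0" by auto
      moreover have "(\<Sum>i\<in>J. (a k i - a k i0 * a n i / a n i0) * c i) = (\<Sum>i\<in>J. a k i * c i) - a k i0 / a n i0 * S"
        unfolding S_def sum_distrib_left sum_subtractf[symmetric]
        by (intro sum.cong refl) (simp add: left_diff_distrib)
      ultimately show ?thesis unfolding sum by simp
    qed
    moreover have "\<exists>i\<in>I. d i \<noteq> 0" using c(1) J by (auto simp: d_def)
    ultimately show ?thesis by blast
  qed
qed

context kernel_space
begin

lemma eig_sum:
  assumes K: "bdd_meas P K" and f: "\<And>i. i \<in> I \<Longrightarrow> eig K \<mu> (f i)"
  shows "eig K \<mu> (\<lambda>x. \<Sum>i\<in>I. c i * f i x)"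
proof -
  have b: "bdd_meas M (\<lambda>x. c i * f i x)" if "i \<in> I" for i
    using f[OF that] by (auto simp: eig_def intro: bdd_intros)
  have "app K (\<lambda>x. \<Sum>i\<in>I. c i * f i x) = (\<lambda>x. \<Sum>i\<in>I. app K (\<lambda>x. c i * f i x) x)"
    by (rule app_sum[OF K b])
  also have "\<dots> = (\<lambda>x. \<mu> * (\<Sum>i\<in>I. c i * f i x))"
    unfolding app_cmult sum_distrib_left
    by (intro ext sum.cong refl) (use f in \<open>simp add: eig_def mult_ac\<close>)
  finally show ?thesis using bdd_meas_sum[OF b] by (simp add: eig_def)
qed

text \<open>Upper bound for multiplicities. With more functions than members of eigenvalue \<mu>,
  some nontrivial combination is orthogonal to those members; it is orthogonal to the others because
  their eigenvalues differ. Maximality makes it null.\<close>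

lemma max_family_dependent:
  assumes K: "hermitian K" and fam: "max_family K \<epsilon> n l e" and \<mu>: "\<bar>\<mu>\<bar> > \<epsilon>"
    and f: "\<And>i. i < m \<Longrightarrow> eig K (of_real \<mu>) (f i)" and card: "card {j. j < n \<and> l j = \<mu>} < m"
  shows "\<exists>c. (\<exists>i<m. c i \<noteq> 0) \<and> sqn M (\<lambda>x. \<Sum>i<m. c i * f i x) = 0"
proof -
  let ?J = "{j. j < n \<and> l j = \<mu>}"
  have on: "on_family K n l e" using fam by (simp add: max_family_def)
  have eb: "bdd_meas M (e j)" "eig K (of_real (l j)) (e j)" if "j < n" for j
    using on that by (auto simp: on_family_def eig_def)
  obtain g where g: "bij_betw g {..<card ?J} ?J"
    using ex_bij_betw_nat_finite[of ?J] by (auto simp: atLeast0LessThan)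
  have "\<exists>c. (\<exists>i\<in>{..<m}. c i \<noteq> 0) \<and> (\<forall>k<card ?J. (\<Sum>i\<in>{..<m}. ip M (f i) (e (g k)) * c i) = 0)"
    by (rule underdetermined_system) (use card in auto)
  then obtain c where c: "\<exists>i<m. c i \<noteq> 0" "\<And>k. k < card ?J \<Longrightarrow> (\<Sum>i<m. ip M (f i) (e (g k)) * c i) = 0"
    by auto
  define F where "F = (\<lambda>x. \<Sum>i<m. c i * f i x)"
  have F: "eig K (of_real \<mu>) F" unfolding F_def
    by (rule eig_sum[OF hermitian_bdd[OF K]]) (use f in auto)
  have "ip M F (e j) = 0" if j: "j < n" for j
  proof (cases "l j = \<mu>")
    case True
    then obtain k where k: "k < card ?J" "j = g k"
      using g j unfolding bij_betw_def by (metis (mono_tags, lifting) image_iff lessThan_iff mem_Collect_eq)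
    have "ip M F (e j) = (\<Sum>i<m. c i * ip M (f i) (e j))"
      unfolding F_def using f eb(1)[OF j]
      by (subst ip_sum_left) (auto simp: ip_cmult_left eig_def intro!: bdd_intros)
    then show ?thesis using c(2)[OF k(1)] by (simp add: k(2) mult.commute)
  next
    case False
    then show ?thesis using eig_orthogonal[OF K F eb(2)[OF j]] by auto
  qed
  then have "sqn M F = 0" using fam F \<mu> unfolding max_family_def by blast
  with c(1) show ?thesis unfolding F_def by blast
qed

lemma on_family_independent:
  assumes on: "on_family K n l e" and J: "J \<subseteq> {..<n}" and z: "sqn M (\<lambda>x. \<Sum>j\<in>J. c j * e j x) = 0" and i: "i \<in> J"
  shows "c i = 0"
proof -
  have eb: "bdd_meas M (e j)" if "j < n" for j
    using on that by (auto simp: on_family_def eig_def)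
  have J': "finite J" "\<And>j. j \<in> J \<Longrightarrow> j < n" using J by (auto intro: finite_subset)
  define F where "F = (\<lambda>x. \<Sum>j\<in>J. c j * e j x)"
  have Fb: "bdd_meas M F" unfolding F_def by (intro bdd_intros eb J')
  have "ip M F (e i) = (\<Sum>j\<in>J. c j * ip M (e j) (e i))"
    unfolding F_def by (subst ip_sum_left) (auto simp: ip_cmult_left intro!: bdd_intros eb J' i)
  also have "\<dots> = (\<Sum>j\<in>J. if j = i then c j else 0)"
    using on J' i by (intro sum.cong refl) (auto simp: on_family_def)
  also have "\<dots> = c i" using J' i by simp
  finally have "ip M F (e i) = c i" .
  moreover have "ip M (e i) F = 0"
    using ip_zero_AE[OF eb[OF J'(2)[OF i]] Fb] z by (simp add: F_def)
  ultimately show ?thesis using cnj_ip[of M "e i" F] by simp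
qed

end

section \<open>Cycle densities of kernels\<close>

context kernel_space
begin

lemma product_prob_space_M: "product_prob_space (\<lambda>_::nat. M)"
  by standard

lemma bdd_meas_components:
  assumes "bdd_meas P K" "u \<in> I" "v \<in> I"
  shows "bdd_meas (PiM I (\<lambda>_::nat. M)) (\<lambda>x. K (x u, x v))"
proof -
  have [measurable]: "K \<in> borel_measurable (M \<Otimes>\<^sub>M M)" using assms by auto
  have "(\<lambda>x. K (x u, x v)) \<in> borel_measurable (PiM I (\<lambda>_::nat. M))"
    using assms(2,3) by measurable
  then show ?thesis using assms(1) by (auto simp: bdd_meas_def)
qed

text \<open>This pulls statements that hold almost everywhere on the square back to two coordinates.
  They must be distinct: equal ones would land on the diagonal, which may be null for
  \<open>P\<close>.\<close>

lemma distr_components: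
  assumes I: "finite I" "u \<in> I" "v \<in> I" "u \<noteq> v"
  shows "distr (PiM I (\<lambda>_::nat. M)) P (\<lambda>x. (x u, x v)) = P"
proof -
  have e1: "emeasure M UNIV = 1" using emeasure_space_1 by simp
  have sf: "sigma_finite_measure M" by (rule sigma_finite_measure_axioms)
  interpret product_prob_space "\<lambda>_::nat. M" by (rule product_prob_space_M)
  have meas: "(\<lambda>x. (x u, x v)) \<in> PiM I (\<lambda>_. M) \<rightarrow>\<^sub>M P" using I by measurable
  show ?thesis
  proof (rule pair_measure_eqI[symmetric])
    fix A B assume A: "A \<in> sets M" and B: "B \<in> sets M"
    define X where "X = (\<lambda>i. if i = u then A else if i = v then B else UNIV)"
    have X: "X i \<in> sets M" for i using A B sets.top[of M] by (auto simp: X_def)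
    have "emeasure (distr (PiM I (\<lambda>_. M)) P (\<lambda>x. (x u, x v))) (A \<times> B) =
        emeasure (PiM I (\<lambda>_. M)) ((\<lambda>x. (x u, x v)) -` (A \<times> B) \<inter> space (PiM I (\<lambda>_. M)))"
      by (rule emeasure_distr[OF meas]) (use A B in auto)
    also have "(\<lambda>x. (x u, x v)) -` (A \<times> B) \<inter> space (PiM I (\<lambda>_. M)) = Pi\<^sub>E I X"
      using I by (auto simp: space_PiM X_def PiE_iff split: if_splits)
    also have "emeasure (PiM I (\<lambda>_. M)) (Pi\<^sub>E I X) = (\<Prod>i\<in>I. emeasure M (X i))"
      by (rule emeasure_PiM[OF I(1)]) (rule X)
    also have "\<dots> = emeasure M (X u) * (emeasure M (X v) * (\<Prod>i\<in>I - {u} - {v}. emeasure M (X i)))"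
      using I by (simp add: prod.remove[of I u] prod.remove[of "I - {u}" v])
    also have "(\<Prod>i\<in>I - {u} - {v}. emeasure M (X i)) = 1"
      using e1 by (intro prod.neutral) (auto simp: X_def)
    finally show "emeasure M A * emeasure M B = emeasure (distr (PiM I (\<lambda>_. M)) P (\<lambda>x. (x u, x v))) (A \<times> B)"
      using I by (simp add: X_def)
  qed (auto intro: sf)
qed

lemma AE_components:
  assumes "finite I" "u \<in> I" "v \<in> I" "u \<noteq> v" "AE p in P. Q p"
  shows "AE x in PiM I (\<lambda>_::nat. M). Q (x u, x v)"
proof -
  have "(\<lambda>x. (x u, x v)) \<in> PiM I (\<lambda>_. M) \<rightarrow>\<^sub>M P" using assms by measurable
  from AE_distrD[OF this, of Q] show ?thesis
    unfolding distr_components[OF assms(1-4)] using assms(5) by blast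
qed

text \<open>Continuous counterpart of \<open>sum_PiE_path\<close>: integrating out the last variable
  composes K with the closing weight.\<close>

lemma integral_PiM_path:
  assumes K: "bdd_meas P K" and g: "bdd_meas P g"
  shows "(\<integral>x. (\<Prod>i<k. K (x i, x (Suc i))) * g (x k, x 0) \<partial>PiM {..k} (\<lambda>_::nat. M)) =
    (\<integral>s. (kcomp K ^^ k) g (s, s) \<partial>M)"
  using g
proof (induction k arbitrary: g)
  case 0
  interpret product_prob_space "\<lambda>_::nat. M" by (rule product_prob_space_M)
  have [measurable]: "g \<in> borel_measurable (M \<Otimes>\<^sub>M M)" using 0 by auto
  have "(\<integral>x. g (x 0, x 0) \<partial>PiM {0} (\<lambda>_::nat. M)) = (\<integral>s. g (s, s) \<partial>M)"
    by (rule product_integral_singleton) measurable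
  then show ?case by (simp add: atMost_0)
next
  case (Suc k)
  have ps: "prob_space M" by (rule prob_space_axioms)
  interpret product_prob_space "\<lambda>_::nat. M" by (rule product_prob_space_M)
  interpret PP: prob_space "PiM {..Suc k} (\<lambda>_::nat. M)" by (rule prob_space_PiM) (rule ps)
  let ?F = "\<lambda>x. (\<Prod>i<Suc k. K (x i, x (Suc i))) * g (x (Suc k), x 0)"
  have "bdd_meas (PiM {..Suc k} (\<lambda>_::nat. M)) ?F"
    by (intro bdd_meas_mult bdd_meas_prod bdd_meas_components K Suc.prems) auto
  then have int: "integrable (PiM (insert (Suc k) {..k}) (\<lambda>_::nat. M)) ?F"
    unfolding atMost_Suc[symmetric] by (rule PP.bdd_meas_integrable)
  have "(\<integral>x. ?F x \<partial>PiM {..Suc k} (\<lambda>_::nat. M)) =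
      (\<integral>x. (\<integral>y. ?F (x(Suc k := y)) \<partial>M) \<partial>PiM {..k} (\<lambda>_::nat. M))"
    unfolding atMost_Suc by (rule product_integral_insert[OF _ _ int]) auto
  also have "\<dots> = (\<integral>x. (\<Prod>i<k. K (x i, x (Suc i))) * kcomp K g (x k, x 0) \<partial>PiM {..k} (\<lambda>_::nat. M))"
  proof (intro Bochner_Integration.integral_cong refl)
    fix x :: "nat \<Rightarrow> 'a"
    have F: "?F (x(Suc k := y)) = (\<Prod>i<k. K (x i, x (Suc i))) * (K (x k, y) * g (y, x 0))" for y
      by (simp add: mult.assoc)
    show "(\<integral>y. ?F (x(Suc k := y)) \<partial>M) = (\<Prod>i<k. K (x i, x (Suc i))) * kcomp K g (x k, x 0)"
      unfolding F by (simp add: kcomp_def app_def)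
  qed
  also have "\<dots> = (\<integral>s. (kcomp K ^^ Suc k) g (s, s) \<partial>M)"
    unfolding Suc.IH[OF bdd_meas_kcomp[OF K Suc.prems]] by (simp only: funpow_Suc_right o_def)
  finally show ?case .
qed

text \<open>At least two factors are composed, so the diagonal values are integrals and the trace is
  meaningful; for K alone they would be arbitrary.\<close>

lemma integral_diag_kpow:
  assumes K: "hermitian K"
  shows "(\<integral>s. kpow K (Suc j) (s, s) \<partial>M) = of_real (ktr K j)"
proof -
  note Kb = hermitian_bdd[OF K]
  have "of_real (ktr K j) = ip P (kpow K j) K" using ip_kpow[OF K, of j 0] by simp
  also have "\<dots> = (\<integral>s. ip M (\<lambda>t. kpow K j (t, s)) (\<lambda>t. K (t, s)) \<partial>M)"
    by (intro ip_columns bdd_intros Kb)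
  also have "\<dots> = (\<integral>s. kpow K (Suc j) (s, s) \<partial>M)"
    unfolding ip_def kpow_simps kcomp_def app_def by (simp add: hermitian_cnj[OF K] mult.commute)
  finally show ?thesis by simp
qed

text \<open>The cycle has j + 2 vertices. For \<open>j = 0\<close> the integrand is K(x 0, x 1) K(x
  1, x 0), giving the squared norm and not the edge density; \<open>integral_PiM_edge\<close>
  supplies the latter.\<close>

lemma integral_PiM_cycle:
  assumes K: "hermitian K"
  shows "(\<integral>x. (\<Prod>i<Suc j. K (x i, x (Suc i))) * K (x (Suc j), x 0) \<partial>PiM {..Suc j} (\<lambda>_::nat. M)) = of_real (ktr K j)"
  using integral_PiM_path[OF hermitian_bdd[OF K] hermitian_bdd[OF K], of "Suc j"] integral_diag_kpow[OF K, of j]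
  by (simp add: kpow_def)

lemma integral_PiM_edge:
  assumes K: "bdd_meas P K"
  shows "(\<integral>x. K (x 0, x 1) \<partial>PiM {..1} (\<lambda>_::nat. M)) = (\<integral>p. K p \<partial>P)"
proof -
  have "(\<integral>x. K (x 0, x 1) \<partial>PiM {..1} (\<lambda>_::nat. M)) = (\<integral>s. kcomp K (\<lambda>_. 1) (s, s) \<partial>M)"
    using integral_PiM_path[OF K bdd_meas_const[of P 1], of 1] by simp
  also have "\<dots> = (\<integral>s. (\<integral>t. K (s, t) \<partial>M) \<partial>M)" by (simp add: kcomp_def app_def)
  also have "\<dots> = (\<integral>p. K p \<partial>P)"
    using Fubini_bdd(2)[of "\<lambda>x y. K (x, y)"] K by (simp add: case_prod_unfold)
  finally show ?thesis .
qed

end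

text \<open>In a complete measure, altering a measurable function on a null set keeps it measurable.
  This licenses exchanging \<open>W\<close> for its Borel version under integrals.\<close>

lemma complete_measurable_cong_AE:
  assumes "complete_measure N" and g: "g \<in> borel_measurable N" and ae: "AE x in N. f x = g x"
  shows "f \<in> borel_measurable N"
proof (rule measurableI)
  interpret complete_measure N by fact
  fix A :: "'b set" assume A: "A \<in> sets borel"
  show "f -` A \<inter> space N \<in> sets N"
  proof (rule in_sets_AE[where A = "g -` A \<inter> space N"])
    show "AE x in N. (x \<in> g -` A \<inter> space N) = (x \<in> f -` A \<inter> space N)"
      using ae by eventually_elim auto
  qed (use A g in auto)
qed auto

lemma complete_integral_cong_AE:
  fixes f g :: "'b \<Rightarrow> 'c :: {banach, second_countable_topology}"
  assumes "complete_measure N" "g \<in> borel_measurable N" "AE x in N. f x = g x"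
  shows "(\<integral>x. f x \<partial>N) = (\<integral>x. g x \<partial>N)"
  by (rule integral_cong_AE[OF complete_measurable_cong_AE[OF assms] assms(2,3)])

lemma complete_measure_lebesgue_on:
  assumes "S \<in> sets lebesgue"
  shows "complete_measure (lebesgue_on S)"
proof
  fix A B assume "B \<subseteq> A" "A \<in> null_sets (lebesgue_on S)"
  then show "B \<in> sets (lebesgue_on S)"
    using assms completion.complete2[of B A lborel]
    by (auto simp: null_sets_restrict_space sets_restrict_space_iff)
qed

section \<open>The unit interval\<close>

abbreviation unit_lebesgue :: "real measure" where
  "unit_lebesgue \<equiv> lebesgue_on {0..1}"

text \<open>A copy of the measure that lives on all of \<open>\<real>\<close>, so that no statement about kernels has to
  restrict its arguments to the unit interval.\<close>

definition unit_measure :: "real measure" where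
  "unit_measure = distr unit_lebesgue lebesgue (\<lambda>x. x)"

lemma prob_space_unit_lebesgue: "prob_space unit_lebesgue"
  by (rule prob_spaceI) (simp add: emeasure_restrict_space)

lemma measurable_unit_lebesgue_id: "(\<lambda>x. x) \<in> unit_lebesgue \<rightarrow>\<^sub>M lebesgue"
  by (rule measurable_restrict_space1) simp

lemma sets_unit_measure [simp, measurable_cong]: "sets unit_measure = sets lebesgue"
  by (simp add: unit_measure_def)

lemma kernel_space_unit_measure: "kernel_space unit_measure"
proof -
  interpret prob_space unit_lebesgue by (rule prob_space_unit_lebesgue)
  interpret D: prob_space unit_measure
    unfolding unit_measure_def by (rule prob_space_distr[OF measurable_unit_lebesgue_id])
  show ?thesis by standard (simp add: unit_measure_def)
qed

interpretation U: kernel_space unit_measure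
  by (rule kernel_space_unit_measure)

lemma integral_unit_measure:
  fixes f :: "real \<Rightarrow> 'b :: {banach, second_countable_topology}"
  assumes "f \<in> borel_measurable lebesgue"
  shows "(\<integral>x. f x \<partial>unit_measure) = (\<integral>x. f x \<partial>unit_lebesgue)"
  unfolding unit_measure_def by (rule integral_distr[OF measurable_unit_lebesgue_id assms])

lemma AE_unit_measureD: "AE x in unit_measure. Q x \<Longrightarrow> AE x in unit_lebesgue. Q x"
  unfolding unit_measure_def by (rule AE_distrD[OF measurable_unit_lebesgue_id])

lemma AE_unit_measure_zero_iff:
  fixes f :: "real \<Rightarrow> complex"
  assumes "f \<in> borel_measurable lebesgue"
  shows "(AE x in unit_measure. f x = 0) \<longleftrightarrow> (AE x in unit_lebesgue. f x = 0)"
proof -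
  have "{x \<in> space lebesgue. f x = 0} \<in> sets lebesgue" using assms by measurable
  then show ?thesis
    unfolding unit_measure_def by (intro AE_distr_iff measurable_unit_lebesgue_id)
qed

lemma borel_measurable_lebesgueI:
  "f \<in> borel_measurable borel \<Longrightarrow> f \<in> borel_measurable (lebesgue :: 'a::euclidean_space measure)"
  by (intro measurable_completion) simp

text \<open>Borel functions of the plane are measurable for the product of the two Lebesgue
  sigma-algebras, which Lebesgue measurable ones need not be.\<close>

lemma borel_measurable_square:
  assumes "g \<in> borel_measurable (borel :: (real \<times> real) measure)"
  shows "g \<in> borel_measurable U.P"
proof -
  have [measurable]: "(\<lambda>x::real. x) \<in> unit_measure \<rightarrow>\<^sub>M borel"
    using borel_measurable_lebesgueI[of "\<lambda>x. x"] by (simp cong: measurable_cong_sets)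
  have "(\<lambda>p. (fst p, snd p)) \<in> U.P \<rightarrow>\<^sub>M (borel \<Otimes>\<^sub>M borel)"
    by (intro measurable_Pair measurable_compose[OF measurable_fst] measurable_compose[OF measurable_snd]) measurable
  from measurable_compose[OF this] assms show ?thesis by (simp add: borel_prod)
qed

lemma integral_unit_measure_lborel:
  fixes f :: "real \<Rightarrow> real"
  assumes [measurable]: "f \<in> borel_measurable borel"
  shows "(\<integral>x. f x \<partial>unit_measure) = (\<integral>x. indicator {0..1} x * f x \<partial>lborel)"
proof -
  have "(\<integral>x. f x \<partial>unit_measure) = (\<integral>x. indicator {0..1} x *\<^sub>R f x \<partial>lebesgue)"
    unfolding integral_unit_measure[OF borel_measurable_lebesgueI[OF assms]]
    by (rule integral_restrict_space) simp
  also have "\<dots> = (\<integral>x. indicator {0..1} x *\<^sub>R f x \<partial>lborel)"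
    by (rule integral_completion) measurable
  finally show ?thesis by simp
qed

lemma unit_square_borel: "{0..1} \<times> {0..1} \<in> sets (borel :: (real \<times> real) measure)"
  by (intro borel_closed closed_Times) auto

text \<open>The two measures live on different sigma-algebras but agree with Borel-Lebesgue measure
  on Borel functions, where Fubini applies.\<close>

lemma integral_unit_square:
  fixes g :: "real \<times> real \<Rightarrow> real"
  assumes g: "g \<in> borel_measurable borel" and B: "\<And>p. \<bar>g p\<bar> \<le> B"
  shows "(\<integral>p. g p \<partial>lebesgue_on ({0..1} \<times> {0..1})) = (\<integral>p. g p \<partial>U.P)"
proof -
  have g' [measurable]: "g \<in> borel_measurable (borel \<Otimes>\<^sub>M borel)" using g by (simp add: borel_prod)
  define h where "h = (\<lambda>p. indicator ({0..1} \<times> {0..1}) p * g p)"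
  have hm: "h \<in> borel_measurable borel"
    unfolding h_def using g unit_square_borel by (intro borel_measurable_times borel_measurable_indicator)
  have hint: "integrable lborel h"
  proof (rule Bochner_Integration.integrable_bound)
    have "emeasure lborel ({0..1} \<times> {0..1} :: (real \<times> real) set) < \<infinity>"
      by (intro emeasure_bounded_finite bounded_Times) auto
    then have "integrable lborel (indicator ({0..1} \<times> {0..1}) :: real \<times> real \<Rightarrow> real)"
      using unit_square_borel by (intro integrable_real_indicator) auto
    then show "integrable lborel (\<lambda>p :: real \<times> real. B * indicator ({0..1} \<times> {0..1}) p)" by simp
    show "AE p in lborel. norm (h p) \<le> norm (B * indicator ({0..1} \<times> {0..1}) p)"
      using order_trans[OF B abs_ge_self] by (auto simp: h_def indicator_def)
  qed (use hm in simp)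
  have inner: "(\<integral>y. g (x, y) \<partial>unit_measure) = (\<integral>y. indicator {0..1} y * g (x, y) \<partial>lborel)" for x
    by (rule integral_unit_measure_lborel) measurable
  have "(\<integral>p. g p \<partial>lebesgue_on ({0..1} \<times> {0..1})) = (\<integral>p. indicator ({0..1} \<times> {0..1}) p *\<^sub>R g p \<partial>lebesgue)"
    using unit_square_borel by (intro integral_restrict_space) auto
  also have "\<dots> = (\<integral>p. h p \<partial>lborel)"
    using hm unfolding h_def by (subst integral_completion) auto
  also have "\<dots> = (\<integral>p. h p \<partial>(lborel \<Otimes>\<^sub>M lborel))" by (simp add: lborel_prod)
  also have "\<dots> = (\<integral>x. (\<integral>y. h (x, y) \<partial>lborel) \<partial>lborel)"
    by (rule lborel_pair.integral_fst'[symmetric]) (use hint in \<open>simp add: lborel_prod\<close>)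
  also have "\<dots> = (\<integral>x. indicator {0..1} x * (\<integral>y. indicator {0..1} y * g (x, y) \<partial>lborel) \<partial>lborel)"
    by (simp add: h_def indicator_times mult.assoc)
  also have "\<dots> = (\<integral>x. (\<integral>y. indicator {0..1} y * g (x, y) \<partial>lborel) \<partial>unit_measure)"
    by (rule integral_unit_measure_lborel[symmetric]) measurable
  also have "\<dots> = (\<integral>x. (\<integral>y. g (x, y) \<partial>unit_measure) \<partial>unit_measure)"
    by (simp add: inner)
  also have "\<dots> = (\<integral>p. g p \<partial>U.P)"
    by (rule U.P.integral_fst', rule U.P.P.integrable_const_bound[where B = B])
       (use B borel_measurable_square[OF g] in auto)
  finally show ?thesis .
qed

lemma AE_unit_square_iff:
  assumes N: "N \<in> sets (borel :: (real \<times> real) measure)"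
  shows "(AE p in U.P. p \<notin> N) \<longleftrightarrow> (AE p in lebesgue_on ({0..1} \<times> {0..1}). p \<notin> N)"
proof -
  let ?L = "lebesgue_on ({0..1} \<times> {0..1} :: (real \<times> real) set)"
  have ind: "(indicator N :: real \<times> real \<Rightarrow> real) \<in> borel_measurable borel" using N by simp
  have fin: "finite_measure ?L"
  proof
    have "emeasure lborel ({0..1} \<times> {0..1} :: (real \<times> real) set) < \<infinity>"
      by (intro emeasure_bounded_finite bounded_Times) auto
    then show "emeasure ?L (space ?L) \<noteq> \<infinity>"
      using unit_square_borel by (simp add: emeasure_restrict_space)
  qed
  have int1: "integrable U.P (indicator N :: _ \<Rightarrow> real)"
    by (rule U.P.P.integrable_const_bound[OF _ borel_measurable_square[OF ind], where B = 1]) (simp add: indicator_def)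
  have int2: "integrable ?L (indicator N :: _ \<Rightarrow> real)"
    by (rule finite_measure.integrable_const_bound[OF fin _ measurable_restrict_space1[OF borel_measurable_lebesgueI[OF ind]], where B = 1])
       (simp add: indicator_def)
  have ind0: "p \<notin> N \<longleftrightarrow> indicator N p = (0::real)" for p by (simp add: indicator_def)
  have "(AE p in U.P. p \<notin> N) \<longleftrightarrow> (\<integral>p. indicator N p \<partial>U.P) = (0::real)"
    unfolding ind0 by (rule integral_nonneg_eq_0_iff_AE[symmetric, OF int1]) auto
  also have "\<dots> \<longleftrightarrow> (\<integral>p. indicator N p \<partial>?L) = (0::real)"
    using integral_unit_square[OF ind, of 1] by (simp add: indicator_def)
  also have "\<dots> \<longleftrightarrow> (AE p in ?L. p \<notin> N)"
    unfolding ind0 by (rule integral_nonneg_eq_0_iff_AE[OF int2]) auto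
  finally show ?thesis .
qed

lemma AE_swap:
  assumes "AE p in U.P. Q p"
  shows "AE p in U.P. Q (snd p, fst p)"
proof -
  have "(\<lambda>(x, y). (y, x)) \<in> U.P \<rightarrow>\<^sub>M U.P" by (rule measurable_pair_swap')
  from AE_distrD[OF this, of Q] show ?thesis
    unfolding U.P.distr_pair_swap[symmetric] using assms by (simp add: case_prod_unfold)
qed

lemma AE_in_unit_square: "AE p in U.P. p \<in> {0..1} \<times> {0..1}"
proof -
  have "AE p in U.P. p \<notin> - ({0..1} \<times> {0..1})"
    by (subst AE_unit_square_iff) (use unit_square_borel in \<open>auto intro!: AE_I2 simp: space_restrict_space\<close>)
  then show ?thesis by simp
qed

text \<open>A Borel version of the extension of \<open>W\<close> by zero is clamped to [0,1] and
  averaged with its transpose, so that the bounds and the symmetry hold at every point. Invariance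
  of the product measure under swapping keeps it equal to \<open>W\<close> almost
  everywhere.\<close>

lemma graphon_Borel_version:
  assumes W: "graphon W"
  obtains W0 where "W0 \<in> borel_measurable (borel :: (real \<times> real) measure)" "\<And>p. 0 \<le> W0 p" "\<And>p. W0 p \<le> 1"
    "\<And>x y. W0 (x, y) = W0 (y, x)" "AE p in U.P. W p = W0 p"
    "AE p in lebesgue_on ({0..1} \<times> {0..1}). W p = W0 p"
proof -
  let ?S = "{0..1} \<times> {0..1} :: (real \<times> real) set"
  have range: "W p \<in> {0..1}" if "p \<in> ?S" for p
    using W that unfolding graphon_def by (cases p) blast
  have sym: "W (x, y) = W (y, x)" if "(x, y) \<in> ?S" for x y
    using W that unfolding graphon_def by blast
  have "(\<lambda>p. if p \<in> ?S then W p else 0) \<in> borel_measurable (completion lborel)"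
    using W unit_square_borel by (subst borel_measurable_if) (auto simp: graphon_def)
  from completion_ex_borel_measurable_real[OF this] obtain g where g: "g \<in> borel_measurable lborel"
    "AE p in lborel. (if p \<in> ?S then W p else 0) = g p" by blast
  from g(2) obtain N where N: "N \<in> null_sets lborel" "{p. (if p \<in> ?S then W p else 0) \<noteq> g p} \<subseteq> N"
    unfolding eventually_ae_filter by auto
  have Nb: "N \<in> sets borel" using N(1) by auto
  have "AE p in lebesgue. p \<notin> N" using AE_not_in[OF N(1)] by (rule AE_completion)
  then have NL: "AE p in lebesgue_on ?S. p \<notin> N"
    using unit_square_borel by (subst AE_restrict_space_iff) auto
  then have NP: "AE p in U.P. p \<notin> N" using AE_unit_square_iff[OF Nb] by simp
  define V where "V = (\<lambda>p. max 0 (min 1 (g p)))"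
  have V: "V \<in> borel_measurable borel" using g(1) unfolding V_def by simp
  have WV: "W p = V p" if "p \<notin> N" "p \<in> ?S" for p
  proof -
    have "(if p \<in> ?S then W p else 0) = g p" using N(2) that(1) by blast
    then have "W p = g p" unfolding if_P[OF that(2)] .
    with range[OF that(2)] show ?thesis by (simp add: V_def)
  qed
  define W0 where "W0 = (\<lambda>p. (V p + V (snd p, fst p)) / 2)"
  have W0: "W0 \<in> borel_measurable borel"
  proof -
    have "(\<lambda>p. (snd p, fst p)) \<in> borel \<rightarrow>\<^sub>M (borel :: (real \<times> real) measure)"
      by (intro borel_measurable_continuous_onI continuous_intros)
    from measurable_compose[OF this V] V show ?thesis unfolding W0_def by simp
  qed
  \<comment> \<open>Equality with \<open>V\<close> is recorded too: only Borel sets can be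
    transferred between the two measures, and the set where \<open>W0\<close> and \<open>V\<close>
    differ is Borel.\<close>
  have "AE p in U.P. W p = W0 p \<and> W p = V p"
    using NP AE_swap[OF NP] AE_in_unit_square
  proof eventually_elim
    case (elim p)
    obtain x y where p: "p = (x, y)" by (cases p)
    have "W (x, y) = V (x, y)" "W (y, x) = V (y, x)" "W (x, y) = W (y, x)"
      using elim WV[of "(x, y)"] WV[of "(y, x)"] sym[of x y] by (auto simp: p)
    then show ?case by (simp add: p W0_def)
  qed
  then have AEP: "AE p in U.P. W p = W0 p" and "AE p in U.P. p \<notin> {p. W0 p \<noteq> V p}" by auto
  moreover have "{p. W0 p \<noteq> V p} \<in> sets borel" using W0 V by measurable
  ultimately have "AE p in lebesgue_on ?S. p \<notin> {p. W0 p \<noteq> V p}"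
    using AE_unit_square_iff by blast
  then have AEL: "AE p in lebesgue_on ?S. W p = W0 p"
    using NL AE_space[of "lebesgue_on ?S"]
    by eventually_elim (use WV in \<open>auto simp: space_restrict_space\<close>)
  show ?thesis
    by (rule that[of W0, OF W0 _ _ _ AEP AEL]) (auto simp: W0_def V_def)
qed

section \<open>Finite powers of the two interval measures\<close>

lemma distr_PiM_unit_measure:
  assumes I: "finite I"
  shows "distr (PiM I (\<lambda>_::nat. unit_lebesgue)) (PiM I (\<lambda>_. unit_measure)) (compose I (\<lambda>x. x)) = PiM I (\<lambda>_. unit_measure)"
proof -
  have "product_prob_space (\<lambda>_::nat. unit_lebesgue)"
    by (intro product_prob_spaceI prob_space_unit_lebesgue)
  moreover have "(\<lambda>x. x) \<in> unit_lebesgue \<rightarrow>\<^sub>M unit_measure"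
    using measurable_unit_lebesgue_id by (simp cong: measurable_cong_sets)
  ultimately have "distr (PiM I (\<lambda>_::nat. unit_lebesgue)) (PiM I (\<lambda>_. unit_measure)) (compose I (\<lambda>x. x)) =
      PiM I (\<lambda>_. distr unit_lebesgue unit_measure (\<lambda>x. x))"
    using U.product_prob_space_M by (intro distr_PiM_finite_prob_space I)
  also have "distr unit_lebesgue unit_measure (\<lambda>x. x) = unit_measure"
    unfolding unit_measure_def by (rule distr_cong) auto
  finally show ?thesis .
qed

text \<open>Points of a product space are extensional functions, so the coordinatewise identity has
  to be written as \<open>compose\<close>.\<close>

lemma compose_id_measurable:
  "compose I (\<lambda>x. x) \<in> PiM I (\<lambda>_::nat. unit_lebesgue) \<rightarrow>\<^sub>M PiM I (\<lambda>_. unit_measure)"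
proof -
  have id: "(\<lambda>x. x) \<in> unit_lebesgue \<rightarrow>\<^sub>M unit_measure"
    using measurable_unit_lebesgue_id by (simp cong: measurable_cong_sets)
  show ?thesis
    unfolding compose_def
  proof (rule measurable_restrict)
    fix i assume "i \<in> I"
    from measurable_compose[OF measurable_component_singleton[OF this, of "\<lambda>_. unit_lebesgue"] id]
    show "(\<lambda>x. x i) \<in> PiM I (\<lambda>_. unit_lebesgue) \<rightarrow>\<^sub>M unit_measure" .
  qed
qed

lemma compose_id_PiM: "x \<in> space (PiM I (\<lambda>_::nat. unit_lebesgue)) \<Longrightarrow> compose I (\<lambda>x. x) x = x"
  by (auto simp: space_PiM compose_def PiE_def extensional_def fun_eq_iff)

lemma integral_PiM_unit_measure:
  fixes F :: "(nat \<Rightarrow> real) \<Rightarrow> real"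
  assumes "finite I" "F \<in> borel_measurable (PiM I (\<lambda>_. unit_measure))"
  shows "(\<integral>x. F x \<partial>PiM I (\<lambda>_. unit_lebesgue)) = (\<integral>x. F x \<partial>PiM I (\<lambda>_. unit_measure))"
proof -
  have "(\<integral>x. F x \<partial>PiM I (\<lambda>_. unit_measure)) = (\<integral>x. F (compose I (\<lambda>x. x) x) \<partial>PiM I (\<lambda>_. unit_lebesgue))"
    by (subst distr_PiM_unit_measure[OF assms(1), symmetric]) (rule integral_distr[OF compose_id_measurable assms(2)])
  also have "\<dots> = (\<integral>x. F x \<partial>PiM I (\<lambda>_. unit_lebesgue))"
    by (intro Bochner_Integration.integral_cong refl) (simp add: compose_id_PiM)
  finally show ?thesis by simp
qed

lemma AE_PiM_unit_measure:
  assumes "finite I" "AE x in PiM I (\<lambda>_::nat. unit_measure). Q x"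
  shows "AE x in PiM I (\<lambda>_. unit_lebesgue). Q x"
proof -
  have "AE x in PiM I (\<lambda>_. unit_lebesgue). Q (compose I (\<lambda>x. x) x)"
    using AE_distrD[OF compose_id_measurable[of I], of Q] assms(2) unfolding distr_PiM_unit_measure[OF assms(1)] by blast
  then show ?thesis
    by (rule AE_mp) (auto intro!: AE_I2 simp: compose_id_PiM)
qed

section \<open>The kernel operator of a graphon\<close>

lemma complete_square: "complete_measure (lebesgue_on ({0..1} \<times> {0..1} :: (real \<times> real) set))"
  by (rule complete_measure_lebesgue_on) (use unit_square_borel in auto)

lemma complete_unit: "complete_measure unit_lebesgue"
  by (rule complete_measure_lebesgue_on) simp

lemma bdd_meas_lebesgue: "bdd_meas unit_measure f \<Longrightarrow> f \<in> borel_measurable lebesgue"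
  unfolding bdd_meas_def by (simp cong: measurable_cong_sets)

lemma sqn_eq_0_iff_AE:
  "bdd_meas unit_measure f \<Longrightarrow> sqn unit_measure f = 0 \<longleftrightarrow> (AE x in unit_lebesgue. f x = 0)"
  by (simp add: U.sqn_eq_0_iff AE_unit_measure_zero_iff bdd_meas_lebesgue)

locale graphon_kernel =
  fixes W W0 :: "real \<times> real \<Rightarrow> real"
  assumes W0_borel: "W0 \<in> borel_measurable borel"
    and W0_nonneg: "\<And>p. 0 \<le> W0 p" and W0_le_1: "\<And>p. W0 p \<le> 1"
    and W0_sym: "\<And>x y. W0 (x, y) = W0 (y, x)"
    and AE_P: "AE p in U.P. W p = W0 p"
    and AE_square: "AE p in lebesgue_on ({0..1} \<times> {0..1}). W p = W0 p"
begin

definition K :: "real \<times> real \<Rightarrow> complex" where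
  "K = (\<lambda>p. of_real (W0 p))"

lemma hermitian_K: "U.hermitian K"
  unfolding U.hermitian_def
proof (intro conjI allI)
  show "bdd_meas U.P K"
    by (rule bdd_measI[where B = 1])
       (use borel_measurable_square[OF W0_borel] W0_nonneg W0_le_1 in \<open>auto simp: K_def\<close>)
  show "K (x, y) = cnj (K (y, x))" for x y by (simp add: K_def W0_sym[of x y])
qed

lemmas K_bdd = U.hermitian_bdd[OF hermitian_K]

lemma norm1_eq: "graphon_norm1 W = (\<integral>p. W0 p \<partial>U.P)"
proof -
  have "graphon_norm1 W = (\<integral>p. W0 p \<partial>lebesgue_on ({0..1} \<times> {0..1}))"
    unfolding graphon_norm1_def
  proof (rule complete_integral_cong_AE[OF complete_square])
    show "W0 \<in> borel_measurable (lebesgue_on ({0..1} \<times> {0..1}))"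
      by (rule measurable_restrict_space1[OF borel_measurable_lebesgueI[OF W0_borel]])
    show "AE p in lebesgue_on ({0..1} \<times> {0..1}). \<bar>W p\<bar> = W0 p"
      using AE_square by eventually_elim (simp add: W0_nonneg)
  qed
  also have "\<dots> = (\<integral>p. W0 p \<partial>U.P)"
    by (rule integral_unit_square[OF W0_borel, where B = 1]) (simp add: W0_nonneg W0_le_1)
  finally show ?thesis .
qed

lemma norm2_eq: "(graphon_norm2 W)\<^sup>2 = U.ktr K 0"
proof -
  have sq: "(\<lambda>p. (W0 p)\<^sup>2) \<in> borel_measurable borel" using W0_borel by simp
  have "(graphon_norm2 W)\<^sup>2 = (\<integral>p. \<bar>W p\<bar>\<^sup>2 \<partial>lebesgue_on ({0..1} \<times> {0..1}))"
    unfolding graphon_norm2_def by simp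
  also have "\<dots> = (\<integral>p. (W0 p)\<^sup>2 \<partial>lebesgue_on ({0..1} \<times> {0..1}))"
  proof (rule complete_integral_cong_AE[OF complete_square])
    show "(\<lambda>p. (W0 p)\<^sup>2) \<in> borel_measurable (lebesgue_on ({0..1} \<times> {0..1}))"
      by (rule measurable_restrict_space1[OF borel_measurable_lebesgueI[OF sq]])
    show "AE p in lebesgue_on ({0..1} \<times> {0..1}). \<bar>W p\<bar>\<^sup>2 = (W0 p)\<^sup>2"
      using AE_square by eventually_elim simp
  qed
  also have "\<dots> = (\<integral>p. (W0 p)\<^sup>2 \<partial>U.P)"
    by (rule integral_unit_square[OF sq, where B = 1]) (simp add: W0_nonneg W0_le_1 power_le_one)
  also have "\<dots> = sqn U.P K" by (simp add: sqn_def K_def)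
  also have "\<dots> = U.ktr K 0" using U.sqn_kpow[OF hermitian_K, of 0] by simp
  finally show ?thesis .
qed

text \<open>Only arcs with u < v enter, so every factor reads two distinct coordinates and
  \<open>AE_components\<close> allows replacing \<open>W\<close> by \<open>W0\<close>; completion
  keeps the integrand measurable.\<close>

lemma graphon_density_PiM:
  assumes F: "finite (pverts F)" "finite (parcs F)" "\<And>u v. (u, v) \<in> parcs F \<Longrightarrow> u \<in> pverts F \<and> v \<in> pverts F"
  shows "of_real (graphon_density F W) =
    (\<integral>x. (\<Prod>(u, v)\<in>{(u, v). (u, v) \<in> parcs F \<and> u < v}. K (x u, x v)) \<partial>PiM (pverts F) (\<lambda>_. unit_measure))"
proof -
  let ?I = "pverts F"
  define A where "A = {(u, v). (u, v) \<in> parcs F \<and> u < v}"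
  let ?N = "PiM ?I (\<lambda>_. unit_lebesgue)"
  have finA: "finite A" by (rule finite_subset[OF _ F(2)]) (auto simp: A_def)
  define h where "h = (\<lambda>x. \<Prod>(u, v)\<in>A. W0 (x u, x v))"
  have hM: "h \<in> borel_measurable (PiM ?I (\<lambda>_. unit_measure))"
    unfolding h_def case_prod_unfold
  proof (rule borel_measurable_prod)
    fix a assume "a \<in> A"
    then have "fst a \<in> ?I" "snd a \<in> ?I" using F(3) by (auto simp: A_def)
    then have "(\<lambda>x. (x (fst a), x (snd a))) \<in> PiM ?I (\<lambda>_. unit_measure) \<rightarrow>\<^sub>M U.P" by measurable
    from measurable_compose[OF this borel_measurable_square[OF W0_borel]]
    show "(\<lambda>x. W0 (x (fst a), x (snd a))) \<in> borel_measurable (PiM ?I (\<lambda>_. unit_measure))" .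
  qed
  have hN: "h \<in> borel_measurable ?N"
    using measurable_compose[OF compose_id_measurable hM]
    by (rule measurable_cong[THEN iffD1, rotated]) (simp add: compose_id_PiM)
  have ae: "AE x in PiM ?I (\<lambda>_. unit_measure). \<forall>(u, v)\<in>A. W (x u, x v) = W0 (x u, x v)"
    unfolding case_prod_unfold
    by (rule AE_finite_allI[OF finA]) (use F U.AE_components[OF F(1) _ _ _ AE_P] in \<open>auto simp: A_def\<close>)
  have "graphon_density F W = (\<integral>x. h x \<partial>completion ?N)"
    unfolding graphon_density_def A_def[symmetric]
  proof (rule complete_integral_cong_AE)
    show "complete_measure (completion ?N)" by (rule completion.complete_measure_axioms)
    show "h \<in> borel_measurable (completion ?N)" by (rule measurable_completion[OF hN])
    show "AE x in completion ?N. (\<Prod>(u, v)\<in>A. W (x u, x v)) = h x"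
      using AE_completion[OF AE_PiM_unit_measure[OF F(1) ae]]
      by eventually_elim (auto simp: h_def intro!: prod.cong)
  qed
  also have "\<dots> = (\<integral>x. h x \<partial>?N)" by (rule integral_completion[OF hN])
  also have "\<dots> = (\<integral>x. h x \<partial>PiM ?I (\<lambda>_. unit_measure))" by (rule integral_PiM_unit_measure[OF F(1) hM])
  finally have "complex_of_real (graphon_density F W) = (\<integral>x. of_real (h x) \<partial>PiM ?I (\<lambda>_. unit_measure))"
    by simp
  then show ?thesis unfolding h_def A_def[symmetric] by (simp add: K_def case_prod_unfold)
qed

lemma graphon_density_edge: "graphon_density (cycle_graph 1) W = graphon_norm1 W"
proof -
  have A: "{(u, v). (u, v) \<in> parcs (cycle_graph 1) \<and> u < v} = {(0, 1)}"
    by (auto simp: cycle_graph_def)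
  have "complex_of_real (graphon_density (cycle_graph 1) W) = (\<integral>x. K (x 0, x 1) \<partial>PiM {..1} (\<lambda>_::nat. unit_measure))"
    using graphon_density_PiM[OF cycle_finite(1,2)[of 1] cycle_finite(3)] unfolding A pverts_cycle_graph by simp
  also have "\<dots> = (\<integral>p. K p \<partial>U.P)" by (rule U.integral_PiM_edge[OF K_bdd])
  also have "\<dots> = of_real (graphon_norm1 W)" unfolding K_def norm1_eq by simp
  finally show ?thesis by (simp only: of_real_eq_iff)
qed

lemma graphon_density_cycle:
  assumes j: "j \<ge> 1"
  shows "graphon_density (cycle_graph (Suc j)) W = U.ktr K j"
proof -
  let ?C = "(\<lambda>i. (i, Suc i)) ` {..<Suc j}"
  have A: "{(u, v). (u, v) \<in> parcs (cycle_graph (Suc j)) \<and> u < v} = insert (0, Suc j) ?C"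
    by (auto simp: cycle_graph_def)
  \<comment> \<open>For j = 0 the closing arc would coincide with the path arc (0, 1) and the
    product would lose a factor.\<close>
  have notin: "(0, Suc j) \<notin> ?C" using j by auto
  have prod: "(\<Prod>(u, v)\<in>insert (0, Suc j) ?C. K (x u, x v)) = (\<Prod>i<Suc j. K (x i, x (Suc i))) * K (x (Suc j), x 0)" for x
  proof -
    have "(\<Prod>(u, v)\<in>?C. K (x u, x v)) = (\<Prod>i<Suc j. K (x i, x (Suc i)))"
      by (subst prod.reindex) (auto simp: inj_on_def)
    moreover have "K (x 0, x (Suc j)) = K (x (Suc j), x 0)" by (simp add: K_def W0_sym[of "x 0"])
    ultimately show ?thesis using notin by (subst prod.insert) (auto simp: mult.commute)
  qed
  have "complex_of_real (graphon_density (cycle_graph (Suc j)) W) =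
      (\<integral>x. (\<Prod>i<Suc j. K (x i, x (Suc i))) * K (x (Suc j), x 0) \<partial>PiM {..Suc j} (\<lambda>_::nat. unit_measure))"
    using graphon_density_PiM[OF cycle_finite(1,2)[of "Suc j"] cycle_finite(3)]
    unfolding A prod pverts_cycle_graph by simp
  also have "\<dots> = of_real (U.ktr K j)" by (rule U.integral_PiM_cycle[OF hermitian_K])
  finally show ?thesis by (simp only: of_real_eq_iff)
qed

lemma graphon_op_eq_AE:
  assumes h: "h \<in> borel_measurable unit_lebesgue"
  shows "AE x in unit_lebesgue. graphon_op W h x = graphon_op W0 h x"
proof -
  have "AE x in unit_measure. AE y in unit_measure. W (x, y) = W0 (x, y)"
    using U.P.AE_pair[OF AE_P] .
  then have "AE x in unit_lebesgue. AE y in unit_measure. W (x, y) = W0 (x, y)"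
    by (rule AE_unit_measureD)
  then show ?thesis
  proof eventually_elim
    case (elim x)
    have sec: "(\<lambda>y. W0 (x, y)) \<in> borel_measurable unit_lebesgue"
      using W0_borel by (intro measurable_restrict_space1 borel_measurable_lebesgueI) (simp flip: borel_prod)
    show ?case
      unfolding graphon_op_def
    proof (rule complete_integral_cong_AE[OF complete_unit])
      show "(\<lambda>y. complex_of_real (W0 (x, y)) * h y) \<in> borel_measurable unit_lebesgue"
        using sec h by measurable
      show "AE y in unit_lebesgue. complex_of_real (W (x, y)) * h y = complex_of_real (W0 (x, y)) * h y"
        using AE_unit_measureD[OF elim] by eventually_elim simp
    qed
  qed
qed

lemma app_K_eq:
  assumes "f \<in> borel_measurable lebesgue"
  shows "U.app K f x = graphon_op W0 f x"
proof -
  have "(\<lambda>y. W0 (x, y)) \<in> borel_measurable lebesgue"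
    using W0_borel by (intro borel_measurable_lebesgueI) (simp flip: borel_prod)
  then have "(\<lambda>y. complex_of_real (W0 (x, y)) * f y) \<in> borel_measurable lebesgue" using assms by measurable
  then show ?thesis
    unfolding U.app_def graphon_op_def K_def by (rule integral_unit_measure)
qed

lemma eig_in_eigenspace:
  assumes f: "U.eig K lam f"
  shows "f \<in> eigenspace W lam"
proof -
  have fb: "bdd_meas unit_measure f" and e: "U.app K f = (\<lambda>x. lam * f x)" using f by (auto simp: U.eig_def)
  note fm = bdd_meas_lebesgue[OF fb]
  have fr: "f \<in> borel_measurable unit_lebesgue" by (rule measurable_restrict_space1[OF fm])
  obtain B where B: "\<And>x. norm (f x) \<le> B" using fb by (metis bdd_measE)
  interpret unit: prob_space unit_lebesgue by (rule prob_space_unit_lebesgue)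
  have "bdd_meas unit_lebesgue f" using fr B by (rule bdd_measI)
  then have "integrable unit_lebesgue (\<lambda>x. (norm (f x))\<^sup>2)" by (rule unit.sqn_integrable)
  with fr have "square_integrable f" by (simp add: square_integrable_def)
  moreover have "AE x in unit_lebesgue. graphon_op W f x = lam * f x"
    using graphon_op_eq_AE[OF fr] by eventually_elim (simp add: app_K_eq[OF fm, symmetric] e)
  ultimately show ?thesis by (simp add: eigenspace_def)
qed

text \<open>Applying the operator smooths an eigenfunction to a bounded one that satisfies the eigenvalue
  equation everywhere.\<close>

lemma eigenspace_lift:
  assumes h: "h \<in> eigenspace W lam" and lam: "lam \<noteq> 0"
  obtains f where "U.eig K lam f" "AE x in unit_lebesgue. h x = f x"
proof -
  interpret unit: prob_space unit_lebesgue by (rule prob_space_unit_lebesgue)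
  have hm [measurable]: "h \<in> borel_measurable unit_lebesgue" and hi: "integrable unit_lebesgue (\<lambda>x. (norm (h x))\<^sup>2)"
    and he: "AE x in unit_lebesgue. graphon_op W h x = lam * h x"
    using h by (auto simp: eigenspace_def square_integrable_def)
  have hint: "integrable unit_lebesgue h"
  proof (rule Bochner_Integration.integrable_bound)
    show "integrable unit_lebesgue (\<lambda>x. 1 + (norm (h x))\<^sup>2)" using hi by simp
    have "norm z \<le> 1 + (norm z)\<^sup>2" for z :: complex
      using zero_le_power2[of "norm z - 1"] by (simp add: power2_eq_square algebra_simps) (smt (verit) norm_ge_zero)
    then show "AE x in unit_lebesgue. norm (h x) \<le> norm (1 + (norm (h x))\<^sup>2)" by simp
  qed (rule hm)
  define f where "f = (\<lambda>x. graphon_op W0 h x / lam)"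
  have [measurable]: "W0 \<in> borel_measurable (borel \<Otimes>\<^sub>M borel)" using W0_borel by (simp add: borel_prod)
  have [measurable]: "(\<lambda>x. x) \<in> unit_lebesgue \<rightarrow>\<^sub>M borel"
    by (intro measurable_restrict_space1 borel_measurable_lebesgueI) simp
  have sec: "(\<lambda>y. complex_of_real (W0 (x, y)) * h y) \<in> borel_measurable unit_lebesgue" for x
    by measurable
  have fb: "f \<in> borel_measurable borel"
    unfolding f_def graphon_op_def by measurable
  have bound: "norm (graphon_op W0 h x) \<le> (\<integral>y. norm (h y) \<partial>unit_lebesgue)" for x
  proof -
    have le: "norm (complex_of_real (W0 (x, y)) * h y) \<le> norm (h y)" for y
      using W0_nonneg[of "(x, y)"] W0_le_1[of "(x, y)"] mult_right_mono[of "W0 (x, y)" 1 "norm (h y)"]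
      by (simp add: norm_mult)
    have "norm (graphon_op W0 h x) \<le> (\<integral>y. norm (complex_of_real (W0 (x, y)) * h y) \<partial>unit_lebesgue)"
      unfolding graphon_op_def by (rule integral_norm_bound)
    also have "\<dots> \<le> (\<integral>y. norm (h y) \<partial>unit_lebesgue)"
    proof (rule integral_mono)
      show "integrable unit_lebesgue (\<lambda>y. norm (complex_of_real (W0 (x, y)) * h y))"
        by (rule integrable_norm, rule Bochner_Integration.integrable_bound[OF hint sec]) (simp add: le)
    qed (use hint le in auto)
    finally show ?thesis .
  qed
  have fbm: "bdd_meas unit_measure f"
  proof (rule bdd_measI)
    show "f \<in> borel_measurable unit_measure"
      using borel_measurable_lebesgueI[OF fb] by (simp cong: measurable_cong_sets)
    show "norm (f x) \<le> (\<integral>y. norm (h y) \<partial>unit_lebesgue) / norm lam" for x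
      using bound[of x] by (simp add: f_def norm_divide divide_right_mono)
  qed
  have hf: "AE x in unit_lebesgue. h x = f x"
    using he graphon_op_eq_AE[OF hm] by eventually_elim (use lam in \<open>simp add: f_def\<close>)
  have "graphon_op W0 f x = graphon_op W0 h x" for x
    unfolding graphon_op_def
    by (rule complete_integral_cong_AE[OF complete_unit sec]) (use hf in eventually_elim, simp)
  then have "U.app K f x = lam * f x" for x
    using lam app_K_eq[OF bdd_meas_lebesgue[OF fbm], of x] by (simp add: f_def)
  then have "U.eig K lam f" using fbm by (auto simp: U.eig_def)
  with hf that show ?thesis by blast
qed

lemma graphon_eigenvalue_iff:
  assumes "lam \<noteq> 0"
  shows "graphon_eigenvalue W lam \<longleftrightarrow> (\<exists>f. U.eig K lam f \<and> sqn unit_measure f \<noteq> 0)"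
proof
  assume "graphon_eigenvalue W lam"
  then obtain h where h: "h \<in> eigenspace W lam" "\<not> (AE x in unit_lebesgue. h x = 0)"
    by (auto simp: graphon_eigenvalue_def)
  obtain f where f: "U.eig K lam f" "AE x in unit_lebesgue. h x = f x"
    by (rule eigenspace_lift[OF h(1) assms])
  have "\<not> (AE x in unit_lebesgue. f x = 0)"
  proof
    assume "AE x in unit_lebesgue. f x = 0"
    with f(2) have "AE x in unit_lebesgue. h x = 0" by eventually_elim simp
    with h(2) show False by contradiction
  qed
  with f(1) show "\<exists>f. U.eig K lam f \<and> sqn unit_measure f \<noteq> 0"
    using sqn_eq_0_iff_AE by (auto simp: U.eig_def)
next
  assume "\<exists>f. U.eig K lam f \<and> sqn unit_measure f \<noteq> 0"
  then obtain f where "U.eig K lam f" "sqn unit_measure f \<noteq> 0" by blast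
  then show "graphon_eigenvalue W lam"
    unfolding graphon_eigenvalue_def using eig_in_eigenspace sqn_eq_0_iff_AE by (auto simp: U.eig_def)
qed

text \<open>The members with eigenvalue \<mu> are independent, which is the lower bound. For the
  upper one, elements of the eigenspace are lifted to bounded eigenfunctions and
  \<open>max_family_dependent\<close> applies.\<close>

lemma eigenvalue_mult_eq:
  assumes fam: "U.max_family K \<epsilon> n l e" and \<mu>: "\<bar>\<mu>\<bar> > \<epsilon>" "\<mu> \<noteq> 0"
  shows "eigenvalue_mult W (of_real \<mu>) = enat (card {j. j < n \<and> l j = \<mu>})"
proof -
  let ?J = "{j. j < n \<and> l j = \<mu>}"
  have on: "U.on_family K n l e" using fam by (simp add: U.max_family_def)
  have ee: "U.eig K (of_real \<mu>) (e j)" if "j \<in> ?J" for j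
    using on that by (auto simp: U.on_family_def)
  obtain g where g: "bij_betw g {..<card ?J} ?J"
    using ex_bij_betw_nat_finite[of ?J] by (auto simp: atLeast0LessThan)
  have gJ: "g i \<in> ?J" if "i < card ?J" for i using g that by (auto simp: bij_betw_def)
  let ?Q = "\<lambda>m. \<exists>f. (\<forall>i<m. f i \<in> eigenspace W (of_real \<mu>)) \<and> ae_independent m f"
  have Q: "?Q (card ?J)"
  proof (intro exI[of _ "\<lambda>i. e (g i)"] conjI allI impI)
    show "e (g i) \<in> eigenspace W (of_real \<mu>)" if "i < card ?J" for i
      by (rule eig_in_eigenspace[OF ee[OF gJ[OF that]]])
    show "ae_independent (card ?J) (\<lambda>i. e (g i))"
      unfolding ae_independent_def
    proof (intro allI impI)
      fix c i assume z: "AE x in unit_lebesgue. (\<Sum>i<card ?J. c i * e (g i) x) = 0" and i: "i < card ?J"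
      define d where "d = (\<lambda>j. c (the_inv_into {..<card ?J} g j))"
      have d: "d (g i) = c i" if "i < card ?J" for i
        using the_inv_into_f_f[of g "{..<card ?J}" i] g that by (simp add: d_def bij_betw_def)
      have eq: "(\<Sum>j\<in>?J. d j * e j x) = (\<Sum>i<card ?J. c i * e (g i) x)" for x
        using sum.reindex_bij_betw[OF g, of "\<lambda>j. d j * e j x"] d by simp
      have b: "bdd_meas unit_measure (\<lambda>x. \<Sum>j\<in>?J. d j * e j x)"
        using ee by (intro bdd_meas_sum bdd_meas_mult bdd_meas_const) (auto simp: U.eig_def)
      have "sqn unit_measure (\<lambda>x. \<Sum>j\<in>?J. d j * e j x) = 0"
        using z sqn_eq_0_iff_AE[OF b] by (simp add: eq)
      from U.on_family_independent[OF on _ this gJ[OF i]] show "c i = 0" using d[OF i] by auto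
    qed
  qed
  have le: "m \<le> card ?J" if "?Q m" for m
  proof (rule ccontr)
    assume "\<not> m \<le> card ?J"
    then have card: "card ?J < m" by simp
    from that obtain f where f: "\<And>i. i < m \<Longrightarrow> f i \<in> eigenspace W (of_real \<mu>)" "ae_independent m f" by blast
    have "\<forall>i\<in>{..<m}. \<exists>f'. U.eig K (of_real \<mu>) f' \<and> (AE x in unit_lebesgue. f i x = f' x)"
      using eigenspace_lift[OF f(1)] \<mu>(2) by (metis lessThan_iff of_real_eq_0_iff)
    then obtain f' where f': "\<And>i. i < m \<Longrightarrow> U.eig K (of_real \<mu>) (f' i)"
      "\<And>i. i < m \<Longrightarrow> AE x in unit_lebesgue. f i x = f' i x"
      by (metis lessThan_iff)
    from U.max_family_dependent[OF hermitian_K fam \<mu>(1) f'(1) card]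
    obtain c where "(\<exists>i<m. c i \<noteq> 0) \<and> sqn unit_measure (\<lambda>x. \<Sum>i<m. c i * f' i x) = 0" ..
    then have c: "\<exists>i<m. c i \<noteq> 0" "sqn unit_measure (\<lambda>x. \<Sum>i<m. c i * f' i x) = 0" by (rule conjunct1, rule conjunct2)
    have b: "bdd_meas unit_measure (\<lambda>x. \<Sum>i<m. c i * f' i x)"
      using f'(1) by (intro bdd_meas_sum bdd_meas_mult bdd_meas_const) (auto simp: U.eig_def)
    have "AE x in unit_lebesgue. \<forall>i\<in>{..<m}. f i x = f' i x"
      by (rule AE_finite_allI) (use f'(2) in auto)
    moreover have "AE x in unit_lebesgue. (\<Sum>i<m. c i * f' i x) = 0"
      using c(2) sqn_eq_0_iff_AE[OF b] by simp
    ultimately have "AE x in unit_lebesgue. (\<Sum>i<m. c i * f i x) = 0"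
    proof eventually_elim
      case (elim x)
      have "(\<Sum>i<m. c i * f i x) = (\<Sum>i<m. c i * f' i x)" by (rule sum.cong) (use elim in auto)
      then show ?case using elim by simp
    qed
    with f(2) c(1) show False unfolding ae_independent_def by blast
  qed
  show ?thesis
    unfolding eigenvalue_mult_def
  proof (rule antisym)
    show "Sup {enat m | m. ?Q m} \<le> enat (card ?J)"
    proof (rule Sup_least)
      fix x assume "x \<in> {enat m | m. ?Q m}"
      then obtain m where "x = enat m" "?Q m" by blast
      with le show "x \<le> enat (card ?J)" by simp
    qed
    show "enat (card ?J) \<le> Sup {enat m | m. ?Q m}"
      by (rule Sup_upper) (use Q in blast)
  qed
qed

end

section \<open>Convergence of the characteristic polynomials\<close>

context graphon_kernel
begin

definition E :: "complex set" where
  "E = {lam. graphon_eigenvalue W lam \<and> lam \<noteq> 0}"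

text \<open>By \<open>finite_mult\<close> all multiplicities on \<open>E\<close> are finite, so
  \<open>the_enat\<close> returns their actual values there.\<close>

definition mlt :: "complex \<Rightarrow> nat" where
  "mlt lam = the_enat (eigenvalue_mult W lam)"

lemma E_real: "lam \<in> E \<Longrightarrow> lam \<in> \<real>"
  using U.eig_real[OF hermitian_K] graphon_eigenvalue_iff unfolding E_def by blast

context
  fixes \<epsilon> n l e
  assumes fam: "U.max_family K \<epsilon> n l e" and \<epsilon>: "\<epsilon> > 0"
begin

lemma family_gt: "j < n \<Longrightarrow> \<bar>l j\<bar> > \<epsilon>"
  using fam by (simp add: U.max_family_def)

lemma family_on: "U.on_family K n l e"
  using fam by (simp add: U.max_family_def)

lemma family_subset: "(\<lambda>j. complex_of_real (l j)) ` {..<n} \<subseteq> E"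
proof safe
  fix j assume j: "j < n"
  have nz: "l j \<noteq> 0" using family_gt[OF j] \<epsilon> by auto
  have eig: "U.eig K (of_real (l j)) (e j)" and one: "ip unit_measure (e j) (e j) = 1"
    using family_on j by (auto simp: U.on_family_def)
  from one have "sqn unit_measure (e j) \<noteq> 0" by (auto simp: ip_self)
  with eig nz show "complex_of_real (l j) \<in> E"
    unfolding E_def using graphon_eigenvalue_iff[of "of_real (l j)"] by auto
qed

lemma family_exhausts:
  assumes lam: "lam \<in> E" "norm lam > \<epsilon>"
  shows "lam \<in> (\<lambda>j. complex_of_real (l j)) ` {..<n}"
proof -
  from E_real[OF lam(1)] obtain \<mu> where \<mu>: "lam = of_real \<mu>" by (auto elim: Reals_cases)
  from lam(1) graphon_eigenvalue_iff[of lam] obtain f where f: "U.eig K lam f" "sqn unit_measure f \<noteq> 0"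
    by (auto simp: E_def)
  have "\<bar>\<mu>\<bar> > \<epsilon>" using lam(2) by (simp add: \<mu>)
  with fam f obtain j where j: "j < n" "ip unit_measure f (e j) \<noteq> 0"
    unfolding U.max_family_def \<mu> by blast
  have "U.eig K (of_real (l j)) (e j)" using family_on j by (auto simp: U.on_family_def)
  then have "\<mu> = l j" using U.eig_orthogonal[OF hermitian_K] f(1) j(2) unfolding \<mu> by blast
  then show ?thesis using j \<mu> by auto
qed

lemma family_mult:
  assumes "j < n"
  shows "eigenvalue_mult W (of_real (l j)) = enat (card {i. i < n \<and> l i = l j})"
    and "card {i. i < n \<and> l i = l j} > 0"
proof -
  show "eigenvalue_mult W (of_real (l j)) = enat (card {i. i < n \<and> l i = l j})"
    by (rule eigenvalue_mult_eq[OF fam family_gt[OF assms]]) (use family_gt[OF assms] \<epsilon> in auto)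
  show "card {i. i < n \<and> l i = l j} > 0" using assms by (auto simp: card_gt_0_iff)
qed

lemma family_sum:
  fixes \<phi> :: "complex \<Rightarrow> 'b :: comm_semiring_1"
  shows "(\<Sum>j<n. \<phi> (of_real (l j))) = (\<Sum>lam\<in>(\<lambda>j. complex_of_real (l j)) ` {..<n}. of_nat (mlt lam) * \<phi> lam)"
proof -
  let ?g = "\<lambda>j. complex_of_real (l j)"
  have "(\<Sum>j<n. \<phi> (?g j)) = (\<Sum>lam\<in>?g ` {..<n}. \<Sum>j | j \<in> {..<n} \<and> ?g j = lam. \<phi> (?g j))"
    by (rule sum.image_gen) simp
  also have "\<dots> = (\<Sum>lam\<in>?g ` {..<n}. of_nat (mlt lam) * \<phi> lam)"
  proof (rule sum.cong[OF refl])
    fix lam assume "lam \<in> ?g ` {..<n}"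
    then obtain i where i: "i < n" "lam = ?g i" by auto
    have "{j. j \<in> {..<n} \<and> ?g j = lam} = {j. j < n \<and> l j = l i}" by (auto simp: i)
    moreover have "mlt lam = card {j. j < n \<and> l j = l i}"
      using family_mult(1)[OF i(1)] by (simp add: mlt_def i)
    moreover have "(\<Sum>j | j \<in> {..<n} \<and> ?g j = lam. \<phi> (?g j)) = (\<Sum>j | j \<in> {..<n} \<and> ?g j = lam. \<phi> lam)"
      by (rule sum.cong) auto
    ultimately show "(\<Sum>j | j \<in> {..<n} \<and> ?g j = lam. \<phi> (?g j)) = of_nat (mlt lam) * \<phi> lam" by simp
  qed
  finally show ?thesis .
qed

end

text \<open>Any threshold strictly below the modulus of \<open>lam\<close> yields a finite family in
  which \<open>lam\<close> occurs.\<close>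

lemma finite_mult:
  assumes "lam \<in> E"
  obtains m where "eigenvalue_mult W lam = enat m" "m > 0"
proof -
  have "norm lam > 0" using assms by (simp add: E_def)
  then obtain \<epsilon> where \<epsilon>: "0 < \<epsilon>" "\<epsilon> < norm lam" using dense by blast
  from U.exists_max_family[OF hermitian_K \<epsilon>(1)] obtain n l e where fam: "U.max_family K \<epsilon> n l e" by blast
  from family_exhausts[OF fam \<epsilon>(1) assms \<epsilon>(2)] obtain j where "j < n" "lam = of_real (l j)" by auto
  with family_mult[OF fam \<epsilon>(1)] that show ?thesis by blast
qed

lemma mlt_eq: "lam \<in> E \<Longrightarrow> eigenvalue_mult W lam = enat (mlt lam)" "lam \<in> E \<Longrightarrow> mlt lam > 0"
  by (metis finite_mult mlt_def the_enat.simps)+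

lemma finite_family_cover:
  assumes F: "finite F" "F \<subseteq> E"
  shows "\<exists>\<delta>>0. \<forall>lam\<in>F. norm lam > \<delta>"
proof (cases "F = {}")
  case False
  have "Min (norm ` F) > 0" using F False by (auto simp: E_def)
  then obtain \<delta> where "0 < \<delta>" "\<delta> < Min (norm ` F)" using dense by blast
  then show ?thesis using F False by (intro exI[of _ \<delta>]) auto
qed (auto intro: exI[of _ 1])

text \<open>A finite set of nonzero eigenvalues is contained in a family of small enough threshold,
  and Bessel's inequality bounds all these families by the squared norm of K.\<close>

lemma square_summable: "square_summable_multiset mlt E"
proof
  show "mlt lam > 0" if "lam \<in> E" for lam by (rule mlt_eq(2)[OF that])
  show "(\<lambda>lam. real (mlt lam) * (norm lam)\<^sup>2) summable_on E"
  proof (rule nonneg_bdd_above_summable_on)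
    show "bdd_above (sum (\<lambda>lam. real (mlt lam) * (norm lam)\<^sup>2) ` {F. F \<subseteq> E \<and> finite F})"
    proof (rule bdd_aboveI2)
      fix F assume "F \<in> {F. F \<subseteq> E \<and> finite F}"
      then have F: "finite F" "F \<subseteq> E" by auto
      from finite_family_cover[OF F] obtain \<delta> where \<delta>: "\<delta> > 0" "\<And>lam. lam \<in> F \<Longrightarrow> norm lam > \<delta>" by blast
      from U.exists_max_family[OF hermitian_K \<delta>(1)] obtain n l e where fam: "U.max_family K \<delta> n l e" by blast
      have sub: "F \<subseteq> (\<lambda>j. complex_of_real (l j)) ` {..<n}"
      proof
        fix lam assume "lam \<in> F"
        then show "lam \<in> (\<lambda>j. complex_of_real (l j)) ` {..<n}"
          using F(2) \<delta>(2) by (intro family_exhausts[OF fam \<delta>(1)]) auto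
      qed
      have "(\<Sum>lam\<in>F. real (mlt lam) * (norm lam)\<^sup>2) \<le>
          (\<Sum>lam\<in>(\<lambda>j. complex_of_real (l j)) ` {..<n}. real (mlt lam) * (norm lam)\<^sup>2)"
        by (rule sum_mono2[OF _ sub]) simp_all
      also have "\<dots> = (\<Sum>j<n. (norm (complex_of_real (l j)))\<^sup>2)"
        using family_sum[OF fam \<delta>(1), of "\<lambda>lam. (norm lam)\<^sup>2"] by simp
      also have "\<dots> \<le> U.ktr K 0"
        using U.Bessel[OF hermitian_K family_on[OF fam \<delta>(1)]] by simp
      finally show "(\<Sum>lam\<in>F. real (mlt lam) * (norm lam)\<^sup>2) \<le> U.ktr K 0" .
    qed
  qed simp
qed

sublocale S: square_summable_multiset mlt E
  by (rule square_summable)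

text \<open>The families for thresholds 1/(N+1) eventually contain every finite part of
  \<open>E\<close>, so the sum over the net equals the sequential limit of
  \<open>ktr_power_sums\<close>. Degrees are at least 2, away from the exceptional value of
  \<open>reg_sum\<close> at 1.\<close>

lemma reg_sum_infsum: "(\<Sum>\<^sub>\<infinity>lam\<in>E. reg_sum mlt lam (k + 2)) = of_real (U.ktr K k)"
proof -
  define \<epsilon> where "\<epsilon> = (\<lambda>N. inverse (real (Suc N)))"
  have \<epsilon>: "\<epsilon> N > 0" for N by (simp add: \<epsilon>_def)
  have "\<forall>N. \<exists>n l e. U.max_family K (\<epsilon> N) n l e"
    using U.exists_max_family[OF hermitian_K \<epsilon>] by blast
  then obtain n l e where fam: "\<And>N. U.max_family K (\<epsilon> N) (n N) (l N) (e N)" by metis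
  define EN where "EN = (\<lambda>N. (\<lambda>j. complex_of_real (l N j)) ` {..<n N})"
  have "filterlim EN (finite_subsets_at_top E) sequentially"
    unfolding filterlim_finite_subsets_at_top
  proof (intro allI impI)
    fix F assume F: "finite F \<and> F \<subseteq> E"
    from finite_family_cover[OF conjunct1[OF F] conjunct2[OF F]]
    obtain \<delta> where \<delta>: "\<delta> > 0" "\<And>lam. lam \<in> F \<Longrightarrow> norm lam > \<delta>" by blast
    have "eventually (\<lambda>N. \<epsilon> N < \<delta>) sequentially"
      unfolding \<epsilon>_def by (rule order_tendstoD(2)[OF LIMSEQ_inverse_real_of_nat \<delta>(1)])
    then show "\<forall>\<^sub>F N in sequentially. finite (EN N) \<and> F \<subseteq> EN N \<and> EN N \<subseteq> E"
    proof eventually_elim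
      case (elim N)
      have "F \<subseteq> EN N"
      proof
        fix lam assume lam: "lam \<in> F"
        have "lam \<in> E" using F lam by blast
        moreover have "norm lam > \<epsilon> N" using \<delta>(2)[OF lam] elim by linarith
        ultimately show "lam \<in> EN N" unfolding EN_def by (rule family_exhausts[OF fam \<epsilon>])
      qed
      then show ?case using family_subset[OF fam \<epsilon>] by (simp add: EN_def)
    qed
  qed
  from filterlim_compose[OF S.reg_sum_tendsto[of "k + 1"] this]
  have "(\<lambda>N. \<Sum>lam\<in>EN N. reg_sum mlt lam (k + 2)) \<longlonglongrightarrow> (\<Sum>\<^sub>\<infinity>lam\<in>E. reg_sum mlt lam (k + 2))"
    by simp
  moreover have "(\<Sum>lam\<in>EN N. reg_sum mlt lam (k + 2)) = of_real (\<Sum>j<n N. (l N j) ^ (k + 2))" for N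
    using family_sum[OF fam[of N] \<epsilon>, of "\<lambda>lam. lam ^ (k + 2)"] by (simp add: EN_def reg_sum_def)
  moreover have "(\<lambda>N. complex_of_real (\<Sum>j<n N. (l N j) ^ (k + 2))) \<longlonglongrightarrow> of_real (U.ktr K k)"
    by (intro tendsto_of_real U.ktr_power_sums[OF hermitian_K, where e = e]) (use fam in \<open>simp add: \<epsilon>_def\<close>)
  ultimately show ?thesis by (simp only: LIMSEQ_unique)
qed

text \<open>The correction in degree 2 comes from the factor exp(c z^2) and replaces the squared
  2-norm by the 1-norm, which is the edge density.\<close>

definition limit_power_sums :: "nat \<Rightarrow> complex" where
  "limit_power_sums k = (\<Sum>\<^sub>\<infinity>lam\<in>E. reg_sum mlt lam k) +
     (if k = 2 then - 2 * of_real (((graphon_norm2 W)\<^sup>2 - graphon_norm1 W) / 2) else 0)"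

lemma limit_power_sums_simps:
  "limit_power_sums 1 = 0"
  "j \<ge> 1 \<Longrightarrow> limit_power_sums (Suc j) = of_real (graphon_density (cycle_graph j) W)"
proof -
  show "limit_power_sums 1 = 0" by (simp add: limit_power_sums_def reg_sum_def)
  assume j: "j \<ge> 1"
  show "limit_power_sums (Suc j) = of_real (graphon_density (cycle_graph j) W)"
  proof (cases "j = 1")
    case True
    have "limit_power_sums 2 = of_real (graphon_norm1 W)"
      unfolding limit_power_sums_def norm2_eq using reg_sum_infsum[of 0, unfolded add_0] by (simp add: field_simps)
    moreover have "Suc j = 2" "cycle_graph j = cycle_graph 1" using True by simp_all
    ultimately show ?thesis using graphon_density_edge by (simp only:)
  next
    case False
    then obtain i where i: "j = Suc i" "i \<ge> 1" using j by (cases j) auto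
    then show ?thesis
      using reg_sum_infsum[of i] graphon_density_cycle[OF i(2)] by (simp add: limit_power_sums_def)
  qed
qed

lemma char_power_series_eq:
  "char_power_series W z = reg_det mlt E z * exp (z\<^sup>2 * of_real (((graphon_norm2 W)\<^sup>2 - graphon_norm1 W) / 2))"
  unfolding char_power_series_def regularized_det_def reg_det_def reg_prod_def E_def mlt_def ..

lemma char_power_series_newton: "char_power_series W = newton_series limit_power_sums"
  unfolding char_power_series_eq[abs_def] S.reg_det_exp_eq limit_power_sums_def[abs_def] ..

lemma char_power_series_roots:
  "{z. char_power_series W z = 0} = {inverse lam | lam. graphon_eigenvalue W lam \<and> lam \<noteq> 0}"
proof -
  have "char_power_series W z = 0 \<longleftrightarrow> (\<exists>lam\<in>E. lam * z = 1)" for z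
    by (simp add: char_power_series_eq S.reg_det_eq_0_iff)
  moreover have "lam * z = 1 \<longleftrightarrow> z = inverse lam" if "lam \<in> E" for lam z
    using that by (auto simp: E_def field_simps)
  then have "(\<exists>lam\<in>E. lam * z = 1) \<longleftrightarrow> (\<exists>lam. z = inverse lam \<and> lam \<in> E)" for z
    by blast
  ultimately show ?thesis by (auto simp: E_def)
qed

lemma char_power_series_zorder:
  assumes "graphon_eigenvalue W lam" "lam \<noteq> 0"
  shows "\<exists>m. eigenvalue_mult W lam = enat m \<and> zorder (char_power_series W) (inverse lam) = int m"
proof -
  have lam: "lam \<in> E" using assms by (simp add: E_def)
  show ?thesis
    using mlt_eq(1)[OF lam] S.zorder_reg_det_exp[OF lam assms(2)]
    unfolding char_power_series_eq[abs_def] by blast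
qed

end

section \<open>The graph side\<close>

lemma adjacency_char_poly:
  fixes G :: "'v pair_pre_digraph"
  assumes G: "pair_graph G" and vs: "distinct vs" "set vs = pverts G" and n: "card (pverts G) = n" "n \<ge> 1"
  obtains lam :: "nat \<Rightarrow> real" where
    "\<And>z. z \<noteq> 0 \<Longrightarrow> inverse ((of_nat n / z) ^ n) * poly (char_poly (adjacency_mat G vs)) (of_nat n / z) =
       (\<Prod>i<n. 1 - of_real (lam i) * z)"
    "(\<Sum>i<n. lam i) = 0"
    "\<And>j. j \<ge> 1 \<Longrightarrow> (\<Sum>i<n. lam i ^ Suc j) = hom_density (cycle_graph j) G"
proof -
  interpret pair_graph G by fact
  define A where "A = adjacency_mat G vs"
  have len: "length vs = n" using vs n distinct_card by metis
  have A: "A \<in> carrier_mat n n" by (simp add: A_def adjacency_mat_def len)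
  have ent: "A $$ (i, j) = (if (vs ! i, vs ! j) \<in> parcs G then 1 else 0)" if "i < n" "j < n" for i j
    using that by (simp add: A_def adjacency_mat_def len)
  have sym: "A $$ (i, j) = A $$ (j, i)" if "i < n" "j < n" for i j
    using that arcs_symmetric ent by auto
  have real: "A $$ (i, j) \<in> \<real>" if "i < n" "j < n" for i j using ent[OF that] by simp
  obtain es where es: "char_poly A = (\<Prod>a\<leftarrow>es. [:- a, 1:])" "length es = n"
    "\<And>k. mat_trace (A ^\<^sub>m k) = (\<Sum>a\<leftarrow>es. a ^ k)"
    using trace_pow_eigenvalues[OF A] by metis
  have root: "poly (char_poly A) x = (\<Prod>i<n. x - es ! i)" for x
  proof -
    have "poly (char_poly A) x = (\<Prod>a\<leftarrow>es. x - a)"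
      unfolding es(1) by (induction es) (auto simp: algebra_simps)
    also have "\<dots> = (\<Prod>i<n. x - es ! i)"
      using es(2) by (simp add: prod.list_conv_set_nth atLeast0LessThan)
    finally show ?thesis .
  qed
  have esreal: "es ! i \<in> \<real>" if "i < n" for i
  proof (rule real_symmetric_eigenvalue_real[OF A sym real])
    show "poly (char_poly A) (es ! i) = 0" unfolding root by (rule prod_zero) (use that in auto)
  qed
  \<comment> \<open>Dividing by n turns the trace of the power j + 1 into a homomorphism density,
    since the cycle has j + 1 vertices.\<close>
  define lam where "lam = (\<lambda>i. Re (es ! i) / real n)"
  have lam: "complex_of_real (lam i) = es ! i / of_nat n" if "i < n" for i
    using esreal[OF that] by (simp add: lam_def of_real_divide)
  have sums: "complex_of_real (\<Sum>i<n. lam i ^ k) = mat_trace (A ^\<^sub>m k) / of_nat n ^ k" for k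
  proof -
    have "complex_of_real (\<Sum>i<n. lam i ^ k) = (\<Sum>i<n. (es ! i) ^ k / of_nat n ^ k)"
      unfolding of_real_sum of_real_power by (intro sum.cong refl) (simp add: lam power_divide)
    also have "\<dots> = (\<Sum>a\<leftarrow>es. a ^ k) / of_nat n ^ k"
      using es(2) by (simp add: sum_divide_distrib sum_list_sum_nth atLeast0LessThan)
    finally show ?thesis by (simp add: es(3))
  qed
  show ?thesis
  proof (rule that[of lam])
    fix z :: complex assume z: "z \<noteq> 0"
    have n0: "of_nat n \<noteq> (0::complex)" using n by simp
    have "inverse ((of_nat n / z) ^ n) * poly (char_poly A) (of_nat n / z) =
        (\<Prod>i<n. inverse (of_nat n / z) * (of_nat n / z - es ! i))"
      unfolding root prod.distrib by (simp only: prod_constant card_lessThan power_inverse)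
    also have "\<dots> = (\<Prod>i<n. 1 - of_real (lam i) * z)"
      by (intro prod.cong refl) (use z n0 in \<open>simp add: lam field_simps\<close>)
    finally show "inverse ((of_nat n / z) ^ n) * poly (char_poly (adjacency_mat G vs)) (of_nat n / z) =
       (\<Prod>i<n. 1 - of_real (lam i) * z)" by (simp add: A_def)
  next
    have "mat_trace (A ^\<^sub>m 1) = 0"
    proof -
      have "A ^\<^sub>m 1 = A" using A by simp
      moreover have "A $$ (i, i) = 0" if "i < n" for i
        using ent[OF that that] pair_no_loops by fastforce
      ultimately show ?thesis using A by (auto simp: mat_trace_def)
    qed
    then have "complex_of_real (\<Sum>i<n. lam i ^ 1) = 0" unfolding sums by simp
    then show "(\<Sum>i<n. lam i) = 0" by (simp only: of_real_eq_0_iff power_one_right)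
  next
    fix j :: nat assume j: "j \<ge> 1"
    have "complex_of_real (\<Sum>i<n. lam i ^ Suc j) = of_real (hom_density (cycle_graph j) G)"
      unfolding sums A_def card_cycle_homs[OF G j vs, symmetric] hom_density_def n(1)
      by (simp add: cycle_graph_def)
    then show "(\<Sum>i<n. lam i ^ Suc j) = hom_density (cycle_graph j) G" by (simp only: of_real_eq_iff)
  qed
qed

lemma exists_graphon_kernel:
  assumes "graphon W"
  obtains W0 where "graphon_kernel W W0"
proof (rule graphon_Borel_version[OF assms])
  fix W0 :: "real \<times> real \<Rightarrow> real"
  assume a: "W0 \<in> borel_measurable borel" "\<And>p. 0 \<le> W0 p" "\<And>p. W0 p \<le> 1"
    "\<And>x y. W0 (x, y) = W0 (y, x)" "AE p in U.P. W p = W0 p"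
    "AE p in lebesgue_on ({0..1} \<times> {0..1}). W p = W0 p"
  have "graphon_kernel W W0" by (rule graphon_kernel.intro) (fact a)+
  then show thesis by (rule that)
qed

lemma real_rooted_prod:
  fixes lam :: "nat \<Rightarrow> real"
  shows "poly (map_poly complex_of_real (\<Prod>i<n. [:1, - lam i:])) z = (\<Prod>i<n. 1 - of_real (lam i) * z)"
proof (induction n)
  case (Suc n)
  have mult: "map_poly complex_of_real (p * q) = map_poly of_real p * map_poly of_real q" for p q
    by (rule poly_eqI) (simp add: coeff_map_poly coeff_mult)
  have linear: "map_poly complex_of_real [:a, b:] = [:of_real a, of_real b:]" for a b
    by (rule poly_eqI) (simp add: coeff_map_poly coeff_pCons split: nat.split)
  show ?case
    unfolding prod.lessThan_Suc mult linear poly_mult Suc.IH by (simp add: mult.commute)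
qed simp

theorem theorem3:
  fixes G :: "nat \<Rightarrow> 'v pair_pre_digraph"
    and vs :: "nat \<Rightarrow> 'v list"
    and W :: "real \<times> real \<Rightarrow> real"
    and \<phi> \<psi> :: "nat \<Rightarrow> complex poly"
  assumes graphs: "\<And>n. n \<ge> 1 \<Longrightarrow> pair_graph (G n) \<and> card (pverts (G n)) = n"
    and enumeration: "\<And>n. n \<ge> 1 \<Longrightarrow> distinct (vs n) \<and> set (vs n) = pverts (G n)"
    and graphon: "graphon W"
    and convergence: "left_convergent_to G W"
    and phi: "\<And>n. n \<ge> 1 \<Longrightarrow> \<phi> n = char_poly (adjacency_mat (G n) (vs n))"
    and psi_nonzero: "\<And>n z. n \<ge> 1 \<Longrightarrow> z \<noteq> 0 \<Longrightarrow>
          poly (\<psi> n) z = (let x = of_nat n / z in inverse (x ^ n) * poly (\<phi> n) x)"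
    and psi_zero: "\<And>n. n \<ge> 1 \<Longrightarrow> poly (\<psi> n) 0 = 1"
  shows "(\<forall>z. (\<lambda>n. poly (\<psi> n) z) \<longlonglongrightarrow> char_power_series W z) \<and>
    (\<forall>K. compact K \<longrightarrow>
       uniform_limit K (\<lambda>n. poly (\<psi> n)) (char_power_series W) sequentially) \<and>
    (\<forall>k. (\<lambda>n. poly.coeff (\<psi> n) k) \<longlonglongrightarrow> (deriv ^^ k) (char_power_series W) 0 / fact k) \<and>
    char_power_series W holomorphic_on UNIV \<and>
    laguerre_polya (char_power_series W) \<and>
    {z. char_power_series W z = 0} =
      {inverse lam | lam. graphon_eigenvalue W lam \<and> lam \<noteq> 0} \<and>
    (\<forall>lam. graphon_eigenvalue W lam \<and> lam \<noteq> 0 \<longrightarrow>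
       (\<exists>m. eigenvalue_mult W lam = enat m \<and>
            zorder (char_power_series W) (inverse lam) = int m))"
proof -
  obtain W0 where "graphon_kernel W W0"
    by (rule exists_graphon_kernel[OF graphon])
  then interpret graphon_kernel W W0 .
  have "\<forall>n\<in>{1..}. \<exists>lam :: nat \<Rightarrow> real. (\<forall>z. poly (\<psi> n) z = (\<Prod>i<n. 1 - of_real (lam i) * z)) \<and>
      (\<Sum>i<n. lam i) = 0 \<and> (\<forall>j\<ge>1. (\<Sum>i<n. lam i ^ Suc j) = hom_density (cycle_graph j) (G n))"
  proof
    fix n :: nat assume "n \<in> {1..}"
    then have n: "n \<ge> 1" by simp
    obtain lam :: "nat \<Rightarrow> real" where lam:
      "\<And>z. z \<noteq> 0 \<Longrightarrow> inverse ((of_nat n / z) ^ n) * poly (char_poly (adjacency_mat (G n) (vs n))) (of_nat n / z) =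
         (\<Prod>i<n. 1 - of_real (lam i) * z)"
      "(\<Sum>i<n. lam i) = 0" "\<And>j. j \<ge> 1 \<Longrightarrow> (\<Sum>i<n. lam i ^ Suc j) = hom_density (cycle_graph j) (G n)"
      using adjacency_char_poly[of "G n" "vs n" n] graphs[OF n] enumeration[OF n] n by blast
    have "poly (\<psi> n) z = (\<Prod>i<n. 1 - of_real (lam i) * z)" for z
      using lam(1)[of z] psi_nonzero[OF n, of z] psi_zero[OF n] phi[OF n] by (cases "z = 0") (auto simp: Let_def)
    with lam(2,3) show "\<exists>lam :: nat \<Rightarrow> real. (\<forall>z. poly (\<psi> n) z = (\<Prod>i<n. 1 - of_real (lam i) * z)) \<and>
      (\<Sum>i<n. lam i) = 0 \<and> (\<forall>j\<ge>1. (\<Sum>i<n. lam i ^ Suc j) = hom_density (cycle_graph j) (G n))" by blast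
  qed
  then obtain lam :: "nat \<Rightarrow> nat \<Rightarrow> real" where lam: "\<And>n z. n \<ge> 1 \<Longrightarrow> poly (\<psi> n) z = (\<Prod>i<n. 1 - of_real (lam n i) * z)"
    "\<And>n. n \<ge> 1 \<Longrightarrow> (\<Sum>i<n. lam n i) = 0"
    "\<And>n j. n \<ge> 1 \<Longrightarrow> j \<ge> 1 \<Longrightarrow> (\<Sum>i<n. lam n i ^ Suc j) = hom_density (cycle_graph j) (G n)"
    unfolding bchoice_iff by (metis atLeast_iff)
  define p where "p = (\<lambda>n k. \<Sum>i<n. complex_of_real (lam n i) ^ k)"
  have power_sums: "has_power_sums (poly (\<psi> n)) (p n)" if "n \<ge> 1" for n
  proof -
    have "poly (\<psi> n) = (\<lambda>z. \<Prod>i<n. 1 - of_real (lam n i) * z)" using lam(1)[OF that] by blast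
    then show ?thesis unfolding p_def using has_power_sums_prod[OF _ has_power_sums_linear, of "{..<n}"] by simp
  qed
  have hom_lim: "(\<lambda>n. hom_density (cycle_graph j) (G n)) \<longlonglongrightarrow> graphon_density (cycle_graph j) W" if "j \<ge> 1" for j
    using convergence pair_graph_cycle_graph[OF that] unfolding left_convergent_to_def by blast
  have p_lim: "(\<lambda>n. p n (Suc k)) \<longlonglongrightarrow> limit_power_sums (Suc k)" for k
  proof (cases "k = 0")
    case True
    have "eventually (\<lambda>n. 0 = p n (Suc k)) sequentially"
      using eventually_ge_at_top[of 1]
    proof eventually_elim
      case (elim n)
      then show ?case using lam(2)[OF elim] by (simp add: p_def True flip: of_real_sum)
    qed
    then show ?thesis using True limit_power_sums_simps(1) by (auto intro: Lim_transform_eventually)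
  next
    case False
    then have k: "k \<ge> 1" by simp
    have "eventually (\<lambda>n. complex_of_real (hom_density (cycle_graph k) (G n)) = p n (Suc k)) sequentially"
      using eventually_ge_at_top[of 1]
    proof eventually_elim
      case (elim n)
      then show ?case using lam(3)[OF elim k] by (simp add: p_def flip: of_real_power of_real_sum del: power_Suc)
    qed
    then show ?thesis
      unfolding limit_power_sums_simps(2)[OF k]
      by (rule Lim_transform_eventually[rotated]) (intro tendsto_of_real hom_lim k)
  qed
  \<comment> \<open>Any number above the limiting edge density would do: it eventually bounds the
    sum of the squares of the scaled eigenvalues.\<close>
  define C where "C = graphon_density (cycle_graph 1) W + 1"
  have "eventually (\<lambda>n. hom_density (cycle_graph 1) (G n) < C) sequentially"
    using order_tendstoD(2)[OF hom_lim[of 1], of C] by (simp add: C_def)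
  then have ev: "eventually (\<lambda>n. has_power_sums (poly (\<psi> n)) (p n) \<and>
      (\<forall>z. norm (poly (\<psi> n) z) \<le> exp ((norm z)\<^sup>2 / 2 * C))) sequentially"
    using eventually_ge_at_top[of 1]
  proof eventually_elim
    case (elim n)
    have "norm (poly (\<psi> n) z) \<le> exp ((norm z)\<^sup>2 / 2 * C)" for z
    proof -
      \<comment> \<open>The scaled eigenvalues sum to zero, so the exponentials multiply to 1 and
        may be inserted; the second power sum alone then bounds the polynomial.\<close>
      have "(\<Prod>i<n. exp (complex_of_real (lam n i) * z)) = exp (of_real (\<Sum>i<n. lam n i) * z)"
        by (simp add: exp_sum sum_distrib_right)
      then have "(\<Prod>i<n. exp (complex_of_real (lam n i) * z)) = 1" using lam(2)[OF elim(2)] by simp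
      then have "poly (\<psi> n) z = (\<Prod>i<n. (1 - of_real (lam n i) * z) * exp (of_real (lam n i) * z))"
        unfolding prod.distrib lam(1)[OF elim(2)] by simp
      also have "norm \<dots> \<le> (\<Prod>i<n. exp ((norm (of_real (lam n i) * z))\<^sup>2 / 2))"
        unfolding prod_norm[symmetric] by (intro prod_mono conjI norm_elementary_factor_le) auto
      also have "\<dots> = exp ((norm z)\<^sup>2 / 2 * (\<Sum>i<n. lam n i ^ Suc 1))"
        by (simp add: exp_sum sum_distrib_left norm_mult power_mult_distrib power2_eq_square mult_ac)
      also have "\<dots> \<le> exp ((norm z)\<^sup>2 / 2 * C)"
        unfolding lam(3)[OF elim(2) order_refl] using elim(1) by (intro iffD2[OF exp_le_cancel_iff] mult_left_mono) auto
      finally show ?thesis .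
    qed
    with power_sums[OF elim(2)] show ?case by blast
  qed
  note limit = newton_series_limit[OF sequentially_bot ev p_lim, folded char_power_series_newton]
  have unif: "uniform_limit K (\<lambda>n. poly (\<psi> n)) (char_power_series W) sequentially" if "compact K" for K
    by (rule limit(1)[OF that])
  have hol: "char_power_series W holomorphic_on UNIV" by (rule limit(2))
  have pointwise: "(\<lambda>n. poly (\<psi> n) z) \<longlonglongrightarrow> char_power_series W z" for z
    using tendsto_uniform_limitI[OF unif[of "{z}"], of z] by simp
  have coeffs: "(\<lambda>n. poly.coeff (\<psi> n) k) \<longlonglongrightarrow> (deriv ^^ k) (char_power_series W) 0 / fact k" for k
    unfolding limit(3)
  proof (rule Lim_transform_eventually[OF newton_coeff_tendsto[of p limit_power_sums, OF p_lim]])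
    show "\<forall>\<^sub>F n in sequentially. newton_coeff (p n) k = poly.coeff (\<psi> n) k"
      using eventually_ge_at_top[of 1]
    proof eventually_elim
      case (elim n)
      have "poly (\<psi> n) has_fps_expansion fps_of_poly (\<psi> n)"
        by (simp add: has_fps_expansion_def)
      from fps_expansion_eqI[OF this] show ?case
        using has_power_sums_nth[OF power_sums[OF elim], of k] by simp
    qed
  qed
  have "laguerre_polya (char_power_series W)"
    unfolding laguerre_polya_def
  proof (intro conjI exI allI impI)
    \<comment> \<open>The approximating polynomials are the \<psi> n themselves, written with real
      coefficients; their roots are reciprocals of real eigenvalues.\<close>
    let ?p = "\<lambda>n. \<Prod>i<n. [:1, - lam n i:]"
    show "z \<in> \<real>" if z: "poly (map_poly complex_of_real (?p n)) z = 0" for n z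
    proof -
      from z obtain i where "1 - of_real (lam n i) * z = 0" unfolding real_rooted_prod by auto
      then have "z = inverse (of_real (lam n i))" by (simp add: inverse_unique)
      then show ?thesis by simp
    qed
    show "uniform_limit K (\<lambda>n. poly (map_poly complex_of_real (?p n))) (char_power_series W) sequentially"
      if "compact K" for K
    proof (rule uniform_limit_cong[THEN iffD1, OF _ _ unif[OF that]])
      show "\<forall>\<^sub>F n in sequentially. \<forall>z\<in>K. poly (\<psi> n) z = poly (map_poly complex_of_real (?p n)) z"
        using eventually_ge_at_top[of 1] by eventually_elim (simp add: real_rooted_prod lam(1))
    qed simp
  qed (rule hol)
  with unif hol pointwise coeffs char_power_series_roots char_power_series_zorder show ?thesis by blast
qed

end
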